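(* For any mesh size $h\in(0,\overline h]$, the semi-discrete stabilizer free weak Galerkin scheme has a solution; that is, there exists $u_h\in H^1(0,\overline t;V_h^0)$ such that $u_h(0,\cdot)=Q_h\psi$ and, for (almost every) $t\in(0,\overline t]$, $$(u_{h,t},v_0)+(\Delta_w u_h,\Delta_w v)=(f,v_0)\qquad\text{for all } v=\{v_0,v_b,v_n\mathbf n_e\}\in V_h^0 .$$
   Context: Let $\Omega\subset\mathbb R^d$ ($d=2,3$) be a bounded polygonal/polyhedral domain and $(0,\overline t]$ a time interval, $\overline t>0$. The data are $f$ with $f\in L^2(0,\overline t;L^2(\Omega))$ and $\psi\in H_0^2(\Omega)$. Write $(\cdot,\cdot)$ and $\|\cdot\|$ for the $L^2(\Omega)$ inner product and norm (computed elementwise for piecewise functions), $(\cdot,\cdot)_T$, $\langle\cdot,\cdot\rangle_{\partial T}$ for $L^2(T)$, $L^2(\partial T)$ inner products. Mesh: $\mathcal T_h$ is a partition of $\Omega$ into polygons/polyhedra, $h_T$ is the diameter of $T$, $h=\max_T h_T$ (with $\overline h>0$ a fixed upper bound of the mesh sizes), and $\mathcal E_h$ is the set of edges/faces. It is shape regular in the usual weak Galerkin sense, with constants independent of $h$: (A1) $|T|\ge \varrho_v h_T^d$, $|e|\ge\varrho_e h_e^{d-1}$ for all $T$ and $e$; (A2) $h_e\ge\kappa h_T$ for each $e\subset\partial T$; (A3) for every $T$ and $e\subset\partial T$ there is a pyramid contained in $T$ with base $e$, apex $A_e\in T$ and height at least $\sigma_e h_T$, such that the angle between $x_e-A_e$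 and the outward normal is strictly acute for all $x_e\in e$; (A4) each $T$ has a shape regular circumscribed simplex $S(T)$ of diameter at most $\gamma_* h_T$, meeting only a fixed bounded number of other such simplices. For each $e\in\mathcal E_h$ fix one unit normal $\mathbf n_e$; $\mathbf n$ is the outward unit normal of $\partial T$. Spaces: for an integer $k\ge2$, $V_h=\{v=\{v_0,v_b,v_n\mathbf n_e\}: v_0|_T\in P_k(T),\ v_b|_e\in P_k(e),\ v_n|_e\in P_{k-1}(e),\ T\in\mathcal T_h,\ e\in\mathcal E_h\}$ ($v_b,v_n$ single valued on each $e$), and $V_h^0=\{v\in V_h: v_b|_e=0,\ v_n|_e=0\ \text{for } e\subset\partial\Omega\}$. The weak Laplacian $\Delta_w v|_T\in P_r(T)$ is defined by $(\Delta_w v,\varphi)_T=(v_0,\Delta\varphi)_T-\langle v_b,\nabla\varphi\cdot\mathbf n\rangle_{\partial T}+\langle v_n\mathbf n_e\cdot\mathbf n,\varphi\rangle_{\partial T}$ for all $\varphi\in P_r(T)$. The degree $r$ is taken large enough (depending on $k$ and the mesh regularity) that with $|||v|||^2=(\Delta_w v,\Delta_w v)$ and $\|v\|_{2,h}^2=\sum_T(\|\Delta v_0\|_T^2+h_T^{-3}\|v_0-v_b\|_{\partial T}^2+h_T^{-1}\|(\nabla v_0-v_n\mathbf n_e)\cdot\mathbf n\|_{\partial T}^2)$ one has $C_1\|v\|_{2,h}\le|||v|||\le C_2\|v\|_{2,h}$ for all $v\in V_h$, with $C_1,C_2>0$ independent of $h$. Projections: $Q_0$, $Q_b$, $Q_n$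 are the $L^2$ projections onto $P_k(T)$, $P_k(e)$, $P_{k-1}(e)$, and $Q_hu=\{Q_0u,Q_bu,Q_n(\nabla u\cdot\mathbf n_e)\mathbf n_e\}$. In the scheme $u_{h,t}$ paired with $v_0$ means the time derivative of the interior component of $u_h$.
   Formalization: The initial condition is attained continuously only by the interior component (equal to Q_0ψ at t=0); edge components are continuous only for t>0, since testing with v_0=0 forces a constraint that Q_hψ violates in general. *)

theory Defs
  imports "HOL-Analysis.Analysis"
begin

definition partial :: "'a::euclidean_space \<Rightarrow> ('a \<Rightarrow> real) \<Rightarrow> 'a \<Rightarrow> real" where
  "partial b f x = frechet_derivative f (at x) b"

text \<open>A multi-index derivative is given by a list of basis vectors.\<close>

definition iter_partial :: "'a::euclidean_space list \<Rightarrow> ('a \<Rightarrow> real) \<Rightarrow> 'a \<Rightarrow> real" where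
  "iter_partial bs f = foldr partial bs f"

definition gradient :: "('a::euclidean_space \<Rightarrow> real) \<Rightarrow> 'a \<Rightarrow> 'a" where
  "gradient f x = (\<Sum>b\<in>Basis. partial b f x *\<^sub>R b)"

definition laplacian :: "('a::euclidean_space \<Rightarrow> real) \<Rightarrow> 'a \<Rightarrow> real" where
  "laplacian f x = (\<Sum>b\<in>Basis. iter_partial [b, b] f x)"

definition test_function :: "'a::euclidean_space set \<Rightarrow> ('a \<Rightarrow> real) \<Rightarrow> bool" where
  "test_function S \<phi> \<longleftrightarrow>
     (\<forall>bs. set bs \<subseteq> Basis \<longrightarrow> iter_partial bs \<phi> differentiable_on UNIV) \<and>
     (\<exists>K. compact K \<and> K \<subseteq> S \<and> (\<forall>x. x \<notin> K \<longrightarrow> \<phi> x = 0))"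

definition L2_fun :: "'b measure \<Rightarrow> ('b \<Rightarrow> real) \<Rightarrow> bool" where
  "L2_fun M g \<longleftrightarrow> g \<in> borel_measurable M \<and> integrable M (\<lambda>x. (g x)\<^sup>2)"

definition L2_norm :: "'b measure \<Rightarrow> ('b \<Rightarrow> real) \<Rightarrow> real" where
  "L2_norm M g = sqrt (LINT x|M. (g x)\<^sup>2)"

definition L2_proj :: "'b measure \<Rightarrow> ('b \<Rightarrow> real) set \<Rightarrow> ('b \<Rightarrow> real) \<Rightarrow> 'b \<Rightarrow> real" where
  "L2_proj M V g = (THE p. p \<in> V \<and> (\<forall>q\<in>V. (LINT x|M. (g x - p x) * q x) = 0))"

definition weak_deriv ::
    "'a::euclidean_space set \<Rightarrow> 'a list \<Rightarrow> ('a \<Rightarrow> real) \<Rightarrow> ('a \<Rightarrow> real) \<Rightarrow> bool" where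
  "weak_deriv S bs g h \<longleftrightarrow>
     (\<forall>\<phi>. test_function S \<phi> \<longrightarrow>
        (LINT x|lebesgue_on S. g x * iter_partial bs \<phi> x) =
        (-1) ^ length bs * (LINT x|lebesgue_on S. h x * \<phi> x))"

text \<open>Convergence of smooth functions to \<open>g\<close> in the norm of \<open>H\<^sup>m(S)\<close>; this includes that \<open>g\<close> has
  square integrable weak derivatives up to order \<open>m\<close>.\<close>

definition Hm_tendsto ::
    "'a::euclidean_space set \<Rightarrow> nat \<Rightarrow> (nat \<Rightarrow> 'a \<Rightarrow> real) \<Rightarrow> ('a \<Rightarrow> real) \<Rightarrow> bool" where
  "Hm_tendsto S m \<phi> g \<longleftrightarrow> L2_fun (lebesgue_on S) g \<and>
     (\<forall>bs. set bs \<subseteq> Basis \<and> length bs \<le> m \<longrightarrow>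
        (\<exists>h. L2_fun (lebesgue_on S) h \<and> weak_deriv S bs g h \<and>
             (\<lambda>n. L2_norm (lebesgue_on S) (\<lambda>x. iter_partial bs (\<phi> n) x - h x)) \<longlonglongrightarrow> 0))"

definition H0m :: "'a::euclidean_space set \<Rightarrow> nat \<Rightarrow> ('a \<Rightarrow> real) set" where
  "H0m S m = {g. \<exists>\<phi>. (\<forall>n. test_function S (\<phi> n)) \<and> Hm_tendsto S m \<phi> g}"

text \<open>The Bochner space \<open>L\<^sup>2(0,tb;L\<^sup>2(S))\<close>: almost everywhere limits of simple functions
  with values in \<open>L\<^sup>2(S)\<close>, with square integrable norm.\<close>

definition simple_L2_valued ::
    "real \<Rightarrow> 'a::euclidean_space set \<Rightarrow> (real \<Rightarrow> 'a \<Rightarrow> real) \<Rightarrow> bool" where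
  "simple_L2_valued tb S s \<longleftrightarrow>
     (\<exists>(m::nat) A g.
        (\<forall>i<m. A i \<in> sets lebesgue \<and> A i \<subseteq> {0<..<tb} \<and> L2_fun (lebesgue_on S) (g i)) \<and>
        s = (\<lambda>t x. \<Sum>i<m. indicator (A i) t * g i x))"

definition L2_L2 :: "real \<Rightarrow> 'a::euclidean_space set \<Rightarrow> (real \<Rightarrow> 'a \<Rightarrow> real) set" where
  "L2_L2 tb S = {f.
     (\<exists>s. (\<forall>n. simple_L2_valued tb S (s n)) \<and>
          (AE t in lebesgue_on {0<..<tb}. L2_fun (lebesgue_on S) (f t) \<and>
             (\<lambda>n. L2_norm (lebesgue_on S) (\<lambda>x. s n t x - f t x)) \<longlonglongrightarrow> 0)) \<and>
     integrable (lebesgue_on {0<..<tb}) (\<lambda>t. (L2_norm (lebesgue_on S) (f t))\<^sup>2)}"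

text \<open>A finite union of \<open>m\<close>-dimensional convex polytopes in a common \<open>m\<close>-dimensional affine
  subspace, with connected interior relative to it; it need not be convex.\<close>

definition polyhedral_piece :: "int \<Rightarrow> 'a::euclidean_space set \<Rightarrow> bool" where
  "polyhedral_piece m S \<longleftrightarrow> aff_dim S = m \<and> connected (rel_interior S) \<and>
     (\<exists>P. finite P \<and> (\<forall>p\<in>P. polytope p \<and> aff_dim p = m) \<and> S = \<Union>P)"

definition polyhedral_domain :: "'a::euclidean_space set \<Rightarrow> bool" where
  "polyhedral_domain \<Omega> \<longleftrightarrow>
     open \<Omega> \<and> bounded \<Omega> \<and> connected \<Omega> \<and>
     polyhedral_piece (int DIM('a)) (closure \<Omega>) \<and> interior (closure \<Omega>) = \<Omega>"

definition is_unit_normal :: "'a::euclidean_space \<Rightarrow> 'a set \<Rightarrow> bool" where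
  "is_unit_normal n e \<longleftrightarrow> norm n = 1 \<and> (\<forall>x\<in>e. \<forall>y\<in>e. n \<bullet> (x - y) = 0)"

text \<open>The \<open>(d-1)\<close>-dimensional Lebesgue measure on a flat face \<open>e\<close>. The measure of a subset of the
  hyperplane through \<open>a\<close> with unit normal \<open>n\<close> is the volume of the prism of height 1 over it;
  this does not depend on the choice of \<open>n\<close> and \<open>a\<close>.\<close>

definition face_measure :: "'a::euclidean_space set \<Rightarrow> 'a measure" where
  "face_measure e =
     (let n = (SOME n. is_unit_normal n e); a = (SOME a. a \<in> e) in
      restrict_space
        (distr (restrict_space lborel {x. 0 \<le> n \<bullet> (x - a) \<and> n \<bullet> (x - a) \<le> 1}) borel
               (\<lambda>x. x - (n \<bullet> (x - a)) *\<^sub>R n))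
        e)"

text \<open>Cells are closed. Faces are subsets of the cell boundaries, so a side of a cell may be
  split into several faces.\<close>

definition faces_of :: "'a::euclidean_space set set \<Rightarrow> 'a set \<Rightarrow> 'a set set" where
  "faces_of Eh T = {e\<in>Eh. e \<subseteq> frontier T}"

definition is_mesh ::
    "'a::euclidean_space set \<Rightarrow> 'a set set \<Rightarrow> 'a set set \<Rightarrow> bool" where
  "is_mesh \<Omega> Th Eh \<longleftrightarrow>
     finite Th \<and> (\<forall>T\<in>Th. polyhedral_piece (int DIM('a)) T) \<and> \<Union>Th = closure \<Omega> \<and>
     (\<forall>T\<in>Th. \<forall>T'\<in>Th. T \<noteq> T' \<longrightarrow> interior T \<inter> interior T' = {}) \<and>
     finite Eh \<and> (\<forall>e\<in>Eh. polyhedral_piece (int DIM('a) - 1) e) \<and>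
     (\<forall>e\<in>Eh. \<forall>e'\<in>Eh. e \<noteq> e' \<longrightarrow> rel_interior e \<inter> rel_interior e' = {}) \<and>
     (\<forall>T\<in>Th. frontier T = \<Union>(faces_of Eh T)) \<and>
     (\<forall>e\<in>Eh. \<exists>T\<in>Th. e \<in> faces_of Eh T)"

definition mesh_size :: "'a::euclidean_space set set \<Rightarrow> real" where
  "mesh_size Th = Max (diameter ` Th)"

text \<open>The outward unit normal of \<open>T\<close> on its face \<open>e\<close>: near some point of \<open>e\<close>, the cell is the
  half ball on the side opposite to the normal.\<close>

definition outward_normal :: "'a::euclidean_space set \<Rightarrow> 'a set \<Rightarrow> 'a" where
  "outward_normal T e = (THE n. is_unit_normal n e \<and>
     (\<exists>x\<in>e. \<exists>\<delta>>0. T \<inter> ball x \<delta> = {y \<in> ball x \<delta>. n \<bullet> (y - x) \<le> 0}))"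

definition pyramid :: "'a::euclidean_space \<Rightarrow> 'a set \<Rightarrow> 'a set" where
  "pyramid a e = (\<Union>x\<in>e. closed_segment a x)"

text \<open>An angle between nonzero vectors is strictly acute iff their inner product is positive.
  Shape regularity of the circumscribed simplices means that the ratio of a contained ball's
  radius to the diameter is bounded below by \<open>\<rho>s\<close>.\<close>

definition shape_regular ::
    "real \<Rightarrow> real \<Rightarrow> real \<Rightarrow> real \<Rightarrow> real \<Rightarrow> real \<Rightarrow> nat \<Rightarrow>
     'a::euclidean_space set set \<Rightarrow> 'a set set \<Rightarrow> bool" where
  "shape_regular \<rho>v \<rho>e \<kappa> \<sigma> \<gamma> \<rho>s N Th Eh \<longleftrightarrow>
     (\<forall>T\<in>Th. measure lebesgue T \<ge> \<rho>v * diameter T ^ DIM('a)) \<and>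
     (\<forall>e\<in>Eh. measure (face_measure e) e \<ge> \<rho>e * diameter e ^ (DIM('a) - 1)) \<and>
     (\<forall>T\<in>Th. \<forall>e\<in>faces_of Eh T. diameter e \<ge> \<kappa> * diameter T) \<and>
     (\<forall>T\<in>Th. \<forall>e\<in>faces_of Eh T. \<exists>a\<in>T.
        pyramid a e \<subseteq> T \<and> infdist a (affine hull e) \<ge> \<sigma> * diameter T \<and>
        (\<forall>x\<in>e. (x - a) \<bullet> outward_normal T e > 0)) \<and>
     (\<exists>S. \<forall>T\<in>Th. int DIM('a) simplex S T \<and> T \<subseteq> S T \<and>
        diameter (S T) \<le> \<gamma> * diameter T \<and>
        (\<exists>c. cball c (\<rho>s * diameter (S T)) \<subseteq> S T) \<and>
        card {T'\<in>Th. T' \<noteq> T \<and> S T' \<inter> S T \<noteq> {}} \<le> N)"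

text \<open>Polynomial functions of total degree at most \<open>k\<close>; the exponents of a monomial are indexed
  by the basis vectors.\<close>

definition poly_space :: "nat \<Rightarrow> ('a::euclidean_space \<Rightarrow> real) set" where
  "poly_space k =
     {(\<lambda>x. \<Sum>\<alpha> | \<alpha> \<in> Basis \<rightarrow>\<^sub>E {..k} \<and> sum \<alpha> Basis \<le> k. c \<alpha> * (\<Prod>b\<in>Basis. (x \<bullet> b) ^ \<alpha> b)) | c. True}"

text \<open>\<open>P\<^sub>k(e)\<close>: restrictions to \<open>e\<close> of polynomials (equivalently, polynomials in affine coordinates
  of the hyperplane of \<open>e\<close>), represented by their extension by zero.\<close>

definition face_poly_space :: "nat \<Rightarrow> 'a::euclidean_space set \<Rightarrow> ('a \<Rightarrow> real) set" where
  "face_poly_space k e = {(\<lambda>x. if x \<in> e then p x else 0) | p. p \<in> poly_space k}"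

text \<open>A weak function \<open>{v\<^sub>0, v\<^sub>b, v\<^sub>n n\<^sub>e}\<close>. The cell part on \<open>T\<close> is stored as a polynomial on the
  whole space (it is determined by its values on \<open>T\<close>, which has interior points). The scalar
  \<open>v\<^sub>n\<close> is stored; the fixed normals \<open>n\<^sub>e\<close> are a separate parameter \<open>ne\<close> below.\<close>

record 'a weak_function =
  cell_part :: "'a set \<Rightarrow> 'a \<Rightarrow> real"
  face_part :: "'a set \<Rightarrow> 'a \<Rightarrow> real"
  normal_part :: "'a set \<Rightarrow> 'a \<Rightarrow> real"

definition Vh ::
    "'a::euclidean_space set set \<Rightarrow> 'a set set \<Rightarrow> nat \<Rightarrow> 'a weak_function set" where
  "Vh Th Eh k = {v.
     (\<forall>T\<in>Th. cell_part v T \<in> poly_space k) \<and> (\<forall>T. T \<notin> Th \<longrightarrow> cell_part v T = (\<lambda>x. 0)) \<and>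
     (\<forall>e\<in>Eh. face_part v e \<in> face_poly_space k e \<and> normal_part v e \<in> face_poly_space (k - 1) e) \<and>
     (\<forall>e. e \<notin> Eh \<longrightarrow> face_part v e = (\<lambda>x. 0) \<and> normal_part v e = (\<lambda>x. 0))}"

definition Vh0 ::
    "'a::euclidean_space set \<Rightarrow> 'a set set \<Rightarrow> 'a set set \<Rightarrow> nat \<Rightarrow> 'a weak_function set" where
  "Vh0 \<Omega> Th Eh k = {v \<in> Vh Th Eh k.
     \<forall>e\<in>Eh. e \<subseteq> frontier \<Omega> \<longrightarrow> (\<forall>x\<in>e. face_part v e x = 0 \<and> normal_part v e x = 0)}"

definition weak_laplacian ::
    "'a::euclidean_space set set \<Rightarrow> ('a set \<Rightarrow> 'a) \<Rightarrow> nat \<Rightarrow>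
     'a weak_function \<Rightarrow> 'a set \<Rightarrow> 'a \<Rightarrow> real" where
  "weak_laplacian Eh ne r v T = (THE p. p \<in> poly_space r \<and> (\<forall>\<phi>\<in>poly_space r.
     (LINT x|lebesgue_on T. p x * \<phi> x) =
       (LINT x|lebesgue_on T. cell_part v T x * laplacian \<phi> x)
       - (\<Sum>e\<in>faces_of Eh T.
            LINT x|face_measure e. face_part v e x * (gradient \<phi> x \<bullet> outward_normal T e))
       + (\<Sum>e\<in>faces_of Eh T.
            LINT x|face_measure e. normal_part v e x * (ne e \<bullet> outward_normal T e) * \<phi> x)))"

definition cell_inner ::
    "'a::euclidean_space set set \<Rightarrow> ('a set \<Rightarrow> 'a \<Rightarrow> real) \<Rightarrow> ('a set \<Rightarrow> 'a \<Rightarrow> real) \<Rightarrow> real" where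
  "cell_inner Th p q = (\<Sum>T\<in>Th. LINT x|lebesgue_on T. p T x * q T x)"

definition triple_norm ::
    "'a::euclidean_space set set \<Rightarrow> 'a set set \<Rightarrow> ('a set \<Rightarrow> 'a) \<Rightarrow> nat \<Rightarrow> 'a weak_function \<Rightarrow> real" where
  "triple_norm Th Eh ne r v =
     sqrt (cell_inner Th (weak_laplacian Eh ne r v) (weak_laplacian Eh ne r v))"

definition norm_2h ::
    "'a::euclidean_space set set \<Rightarrow> 'a set set \<Rightarrow> ('a set \<Rightarrow> 'a) \<Rightarrow> 'a weak_function \<Rightarrow> real" where
  "norm_2h Th Eh ne v = sqrt (\<Sum>T\<in>Th.
     (LINT x|lebesgue_on T. (laplacian (cell_part v T) x)\<^sup>2)
     + inverse (diameter T ^ 3) *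
         (\<Sum>e\<in>faces_of Eh T. LINT x|face_measure e. (cell_part v T x - face_part v e x)\<^sup>2)
     + inverse (diameter T) *
         (\<Sum>e\<in>faces_of Eh T. LINT x|face_measure e.
            ((gradient (cell_part v T) x - normal_part v e x *\<^sub>R ne e) \<bullet> outward_normal T e)\<^sup>2))"

text \<open>Traces on a face of a function in \<open>H\<^sub>0\<^sup>2(\<Omega>)\<close> and of its derivative in direction \<open>n\<close>: the
  limits in \<open>L\<^sup>2(e)\<close> along test functions converging in \<open>H\<^sup>2(\<Omega>)\<close>.\<close>

definition is_trace ::
    "'a::euclidean_space set \<Rightarrow> 'a set \<Rightarrow> ('a \<Rightarrow> real) \<Rightarrow> ('a \<Rightarrow> real) \<Rightarrow> bool" where
  "is_trace \<Omega> e \<psi> g \<longleftrightarrow> L2_fun (face_measure e) g \<and>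
     (\<exists>\<phi>. (\<forall>n. test_function \<Omega> (\<phi> n)) \<and> Hm_tendsto \<Omega> 2 \<phi> \<psi> \<and>
          (\<lambda>j. L2_norm (face_measure e) (\<lambda>x. \<phi> j x - g x)) \<longlonglongrightarrow> 0)"

definition is_normal_trace ::
    "'a::euclidean_space set \<Rightarrow> 'a set \<Rightarrow> 'a \<Rightarrow> ('a \<Rightarrow> real) \<Rightarrow> ('a \<Rightarrow> real) \<Rightarrow> bool" where
  "is_normal_trace \<Omega> e n \<psi> g \<longleftrightarrow> L2_fun (face_measure e) g \<and>
     (\<exists>\<phi>. (\<forall>j. test_function \<Omega> (\<phi> j)) \<and> Hm_tendsto \<Omega> 2 \<phi> \<psi> \<and>
          (\<lambda>j. L2_norm (face_measure e) (\<lambda>x. gradient (\<phi> j) x \<bullet> n - g x)) \<longlonglongrightarrow> 0)"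

definition Qh ::
    "'a::euclidean_space set \<Rightarrow> 'a set set \<Rightarrow> 'a set set \<Rightarrow> ('a set \<Rightarrow> 'a) \<Rightarrow> nat \<Rightarrow>
     ('a \<Rightarrow> real) \<Rightarrow> 'a weak_function" where
  "Qh \<Omega> Th Eh ne k \<psi> =
     \<lparr> cell_part = (\<lambda>T. if T \<in> Th then L2_proj (lebesgue_on T) (poly_space k) \<psi> else (\<lambda>x. 0)),
       face_part = (\<lambda>e. if e \<in> Eh
         then L2_proj (face_measure e) (face_poly_space k e) (SOME g. is_trace \<Omega> e \<psi> g)
         else (\<lambda>x. 0)),
       normal_part = (\<lambda>e. if e \<in> Eh
         then L2_proj (face_measure e) (face_poly_space (k - 1) e)
                (SOME g. is_normal_trace \<Omega> e (ne e) \<psi> g)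
         else (\<lambda>x. 0)) \<rparr>"

text \<open>\<open>u \<in> H\<^sup>1(0,tb;V)\<close> with weak time derivative \<open>w\<close>, for a finite dimensional space \<open>V\<close> of weak
  functions. The point evaluations span the dual of \<open>V\<close>, so strong measurability, square
  integrability of the norm and the weak derivative can all be tested on them.\<close>

definition evaluations :: "('a weak_function \<Rightarrow> real) set" where
  "evaluations =
     {(\<lambda>v. cell_part v T x) | T x. True} \<union> {(\<lambda>v. face_part v e x) | e x. True} \<union>
     {(\<lambda>v. normal_part v e x) | e x. True}"

definition H1_time ::
    "real \<Rightarrow> 'a::euclidean_space weak_function set \<Rightarrow>
     (real \<Rightarrow> 'a weak_function) \<Rightarrow> (real \<Rightarrow> 'a weak_function) \<Rightarrow> bool" where
  "H1_time tb V u w \<longleftrightarrow> (\<forall>t\<in>{0<..<tb}. u t \<in> V \<and> w t \<in> V) \<and>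
     (\<forall>l\<in>evaluations.
        L2_fun (lebesgue_on {0<..<tb}) (\<lambda>t. l (u t)) \<and>
        L2_fun (lebesgue_on {0<..<tb}) (\<lambda>t. l (w t)) \<and>
        weak_deriv {0<..<tb} [1] (\<lambda>t. l (u t)) (\<lambda>t. l (w t)))"

text \<open>The value at \<open>0\<close> of a function in \<open>H\<^sup>1(0,tb;V)\<close> is that of a continuous representative. For
  the semi-discrete scheme this can only be asked of the cell part: for test functions with
  \<open>v\<^sub>0 = 0\<close> the scheme contains no time derivative and is an algebraic constraint, by which \<open>u\<^sub>b\<close>
  and \<open>u\<^sub>n\<close> are determined by \<open>u\<^sub>0\<close> for \<open>t > 0\<close>, and which \<open>Q\<^sub>h \<psi>\<close> violates in general. Hence \<open>u\<close>
  takes the value \<open>u0\<close> at \<open>0\<close>, its cell part is continuous up to \<open>0\<close>, and all its parts are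
  continuous on \<open>(0,tb]\<close>.\<close>

definition initial_value ::
    "real \<Rightarrow> (real \<Rightarrow> 'a::euclidean_space weak_function) \<Rightarrow> 'a weak_function \<Rightarrow> bool" where
  "initial_value tb u u0 \<longleftrightarrow> u 0 = u0 \<and>
     (\<forall>T x. continuous_on {0..tb} (\<lambda>t. cell_part (u t) T x)) \<and>
     (\<forall>l\<in>evaluations. continuous_on {0<..tb} (\<lambda>t. l (u t)))"

end

theory Submission
  imports Defs "HOL-Library.Function_Algebras"
begin

text \<open>Testing the scheme with a basis of the finite dimensional space \<open>V\<close> of weak functions with
  vanishing boundary parts gives a linear system \<open>M y' + A y = F(t)\<close>, where \<open>M\<close> is the matrix of the
  inner product of the cell parts and \<open>A\<close> that of the weak Laplacians. The difficulty is that \<open>M\<close> is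
  singular: it does not see the face and normal parts, so the system is differential-algebraic.
  Both matrices are, however, symmetric and positive semidefinite, and this suffices. With respect
  to \<open>M + A\<close> there is an orthonormal family of eigenvectors \<open>e\<^sub>i\<close> of \<open>M\<close>, with eigenvalues \<open>\<mu>\<^sub>i\<close>, and
  then \<open>A\<close> is diagonal as well, with entries \<open>1 - \<mu>\<^sub>i\<close> (\<open>simultaneous_diagonalization\<close>). What the
  family does not span is null for both forms. So the system falls apart into the scalar equations
  \<open>\<mu>\<^sub>i y\<^sub>i' + (1 - \<mu>\<^sub>i) y\<^sub>i = F\<^sub>i\<close>. If \<open>\<mu>\<^sub>i = 0\<close>, then \<open>e\<^sub>i\<close> has cell part \<open>0\<close>, hence \<open>F\<^sub>i = 0\<close>, and \<open>y\<^sub>i = 0\<close>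
  is the solution; this is the algebraic constraint. If \<open>\<mu>\<^sub>i > 0\<close>, variation of constants gives a
  continuous solution with any prescribed initial value and with square integrable weak derivative
  (\<open>scalar_evolution\<close>), since \<open>F\<^sub>i\<close> is square integrable in time (\<open>load_L2_in_time\<close>). The vectors
  with \<open>\<mu>\<^sub>i > 0\<close> span all cell parts, so the cell part of the initial datum can be attained.

  It remains to see that the initial datum \<open>Q\<^sub>h \<psi>\<close> lies in \<open>V\<close> at all (\<open>Qh_in_Vh0\<close>). Its face and
  normal parts are projections of the traces of \<open>\<psi>\<close> and of its normal derivative. These exist by a
  trace inequality (\<open>trace_inequality\<close>) and the completeness of mean square convergence
  (\<open>L2_complete\<close>), and they vanish on the boundary because test functions do. Projections onto
  polynomials are well defined since a polynomial that is zero almost everywhere on a cell is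
  zero, and one that is zero almost everywhere on a face is zero on that face. The same argument
  makes the weak Laplacian well defined, and it is linear by uniqueness.\<close>

section \<open>Pairs of semidefinite forms\<close>

text \<open>With pointwise operations the spaces of polynomials and of weak functions are subspaces
  and spans in the usual sense.\<close>

instantiation "fun" :: (type, scaleR) scaleR
begin
definition scaleR_fun_def: "scaleR r f = (\<lambda>x. scaleR r (f x))"
instance ..
end

instance "fun" :: (type, real_vector) real_vector
  by standard (auto simp: scaleR_fun_def plus_fun_def scaleR_add_right scaleR_add_left)

lemma scaleR_fun_apply [simp]: "(r *\<^sub>R f) x = r *\<^sub>R f x"
  by (simp add: scaleR_fun_def)

lemma sum_fun_apply: "(\<Sum>i\<in>I. f i) x = (\<Sum>i\<in>I. f i x)"
  by (induction I rule: infinite_finite_induct) auto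

text \<open>Linearity is required on a subspace only, because integrals are additive only where the
  integrands are integrable.\<close>

definition linear_form_on :: "'v::real_vector set \<Rightarrow> ('v \<Rightarrow> real) \<Rightarrow> bool" where
  "linear_form_on U l \<longleftrightarrow> (\<forall>x\<in>U. \<forall>y\<in>U. \<forall>r s. l (r *\<^sub>R x + s *\<^sub>R y) = r * l x + s * l y)"

definition psd_form_on :: "'v::real_vector set \<Rightarrow> ('v \<Rightarrow> 'v \<Rightarrow> real) \<Rightarrow> bool" where
  "psd_form_on U c \<longleftrightarrow> (\<forall>x\<in>U. linear_form_on U (c x)) \<and> (\<forall>x\<in>U. \<forall>y\<in>U. c x y = c y x) \<and>
     (\<forall>x\<in>U. 0 \<le> c x x)"

lemma linear_form_onD:
  assumes "linear_form_on U l" "x \<in> U" "y \<in> U"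
  shows "l (r *\<^sub>R x + s *\<^sub>R y) = r * l x + s * l y"
  using assms by (auto simp: linear_form_on_def)

lemma linear_form_on_simps:
  assumes "linear_form_on U l" "x \<in> U" "y \<in> U"
  shows "l (x + y) = l x + l y" "l (x - y) = l x - l y" "l (r *\<^sub>R x) = r * l x"
  using linear_form_onD[OF assms, of 1 1] linear_form_onD[OF assms, of 1 "-1"]
    linear_form_onD[OF assms(1,2,2), of r 0] by simp_all

lemma linear_form_on_zero:
  assumes "linear_form_on U l" "subspace U"
  shows "l 0 = 0"
  using linear_form_on_simps(3)[OF assms(1) subspace_0[OF assms(2)] subspace_0[OF assms(2)], of 0]
  by simp

lemma linear_form_on_sum:
  assumes "linear_form_on U l" "subspace U" "\<And>i. i \<in> I \<Longrightarrow> x i \<in> U"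
  shows "l (\<Sum>i\<in>I. r i *\<^sub>R x i) = (\<Sum>i\<in>I. r i * l (x i))"
  using assms(3)
proof (induction I rule: infinite_finite_induct)
  case (insert j I)
  have "(\<Sum>i\<in>I. r i *\<^sub>R x i) \<in> U"
    using insert assms(2) by (intro subspace_sum subspace_mul) auto
  then have "l ((\<Sum>i\<in>I. r i *\<^sub>R x i) + r j *\<^sub>R x j) = l (\<Sum>i\<in>I. r i *\<^sub>R x i) + r j * l (x j)"
    using linear_form_onD[OF assms(1), of "\<Sum>i\<in>I. r i *\<^sub>R x i" "x j" 1 "r j"] insert by simp
  then show ?case using insert by (simp add: add.commute)
qed (use linear_form_on_zero[OF assms(1,2)] in simp_all)

lemma linear_form_on_zero_span:
  assumes l: "linear_form_on U l" "subspace U" and B: "B \<subseteq> U" "\<And>b. b \<in> B \<Longrightarrow> l b = 0"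
    and v: "v \<in> span B"
  shows "l v = 0"
proof -
  have "subspace {x \<in> U. l x = 0}"
    using l linear_form_on_zero[OF l] linear_form_on_simps[OF l(1)]
    by (auto simp: subspace_def)
  then have "span B \<subseteq> {x \<in> U. l x = 0}" using B by (intro span_minimal) auto
  then show ?thesis using v by auto
qed

lemma linear_form_on_subset: "linear_form_on U l \<Longrightarrow> W \<subseteq> U \<Longrightarrow> linear_form_on W l"
  unfolding linear_form_on_def by (meson subsetD)

lemma psd_form_on_subset: "psd_form_on U c \<Longrightarrow> W \<subseteq> U \<Longrightarrow> psd_form_on W c"
  unfolding psd_form_on_def by (meson linear_form_on_subset subsetD)

lemma psd_form_onD:
  assumes "psd_form_on U c" "x \<in> U"
  shows "linear_form_on U (c x)" "y \<in> U \<Longrightarrow> c x y = c y x" "0 \<le> c x x"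
  using assms by (auto simp: psd_form_on_def)

lemma psd_form_on_linear_left:
  assumes "psd_form_on U c" "subspace U" "y \<in> U"
  shows "linear_form_on U (\<lambda>x. c x y)"
  unfolding linear_form_on_def
proof (intro ballI allI)
  fix x z r s assume *: "x \<in> U" "z \<in> U"
  then have "r *\<^sub>R x + s *\<^sub>R z \<in> U"
    using assms(2) by (intro subspace_add subspace_mul)
  then show "c (r *\<^sub>R x + s *\<^sub>R z) y = r * c x y + s * c z y"
    using psd_form_onD(2)[OF assms(1)] linear_form_onD[OF psd_form_onD(1)[OF assms(1,3)] *] * assms(3)
    by metis
qed

lemma psd_form_on_line:
  assumes c: "psd_form_on U c" "subspace U" and x: "x \<in> U" and y: "y \<in> U"
  shows "c (x + s *\<^sub>R y) (x + s *\<^sub>R y) = c x x + 2 * s * c x y + s\<^sup>2 * c y y"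
proof -
  have z: "x + s *\<^sub>R y \<in> U" using assms by (intro subspace_add subspace_mul)
  have "c (x + s *\<^sub>R y) (x + s *\<^sub>R y) = c (x + s *\<^sub>R y) x + s * c (x + s *\<^sub>R y) y"
    using linear_form_onD[OF psd_form_onD(1)[OF c(1) z] x y, of 1 s] by simp
  also have "c (x + s *\<^sub>R y) x = c x x + s * c y x"
    using linear_form_onD[OF psd_form_on_linear_left[OF c x] x y, of 1 s] by simp
  also have "c (x + s *\<^sub>R y) y = c x y + s * c y y"
    using linear_form_onD[OF psd_form_on_linear_left[OF c y] x y, of 1 s] by simp
  also have "c y x = c x y" using psd_form_onD(2)[OF c(1) y x] .
  finally show ?thesis by (simp add: power2_eq_square algebra_simps)
qed

text \<open>A null vector of a positive semidefinite form lies in its radical: otherwise the form would be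
  an affine nonconstant function, hence negative somewhere, along a line in its direction.\<close>

lemma psd_form_on_null:
  assumes c: "psd_form_on U c" "subspace U" and x: "x \<in> U" "c x x = 0" and y: "y \<in> U"
  shows "c x y = 0"
proof (rule ccontr)
  assume "c x y \<noteq> 0"
  \<comment> \<open>chosen so that the form takes the value \<open>-1\<close> at \<open>y + s x\<close>\<close>
  define s where "s = - (c y y + 1) / (2 * c x y)"
  have "0 \<le> c (y + s *\<^sub>R x) (y + s *\<^sub>R x)"
    using c x y by (intro psd_form_onD(3)[OF c(1)] subspace_add subspace_mul)
  also have "\<dots> = c y y + 2 * s * c x y"
    using psd_form_on_line[OF c y x(1), of s] x psd_form_onD(2)[OF c(1) x(1) y] by simp
  also have "\<dots> = -1" using \<open>c x y \<noteq> 0\<close> by (simp add: s_def field_simps)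
  finally show False by simp
qed

lemma psd_form_on_Cauchy_Schwarz:
  assumes c: "psd_form_on U c" "subspace U" and x: "x \<in> U" and y: "y \<in> U"
  shows "(c x y)\<^sup>2 \<le> c x x * c y y"
proof (cases "c y y = 0")
  case True
  then show ?thesis
    using psd_form_on_null[OF c y True x] psd_form_onD(2)[OF c(1) x y] by simp
next
  case False
  then have pos: "0 < c y y" using psd_form_onD(3)[OF c(1) y] by simp
  define s where "s = - c x y / c y y"
  have "0 \<le> c (x + s *\<^sub>R y) (x + s *\<^sub>R y)"
    using x y c(2) by (intro psd_form_onD(3)[OF c(1)] subspace_add subspace_mul)
  also have "\<dots> = c x x - (c x y)\<^sup>2 / c y y"
    unfolding psd_form_on_line[OF c x y] using pos by (simp add: s_def field_simps power2_eq_square)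
  finally show ?thesis using pos by (simp add: field_simps)
qed

text \<open>An orthonormal family for a semidefinite form, complete up to null vectors.\<close>

definition orthonormal_frame ::
    "'v::real_vector set \<Rightarrow> ('v \<Rightarrow> 'v \<Rightarrow> real) \<Rightarrow> nat \<Rightarrow> (nat \<Rightarrow> 'v) \<Rightarrow> bool" where
  "orthonormal_frame U c n e \<longleftrightarrow> (\<forall>i<n. e i \<in> U) \<and>
     (\<forall>i<n. \<forall>j<n. c (e i) (e j) = (if i = j then 1 else 0)) \<and>
     (\<forall>x\<in>U. c (x - (\<Sum>i<n. c x (e i) *\<^sub>R e i)) (x - (\<Sum>i<n. c x (e i) *\<^sub>R e i)) = 0)"

lemma orthonormal_frameD:
  assumes "orthonormal_frame U c n e"
  shows "i < n \<Longrightarrow> e i \<in> U"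
    "i < n \<Longrightarrow> j < n \<Longrightarrow> c (e i) (e j) = (if i = j then 1 else 0)"
    "x \<in> U \<Longrightarrow> c (x - (\<Sum>i<n. c x (e i) *\<^sub>R e i)) (x - (\<Sum>i<n. c x (e i) *\<^sub>R e i)) = 0"
  using assms unfolding orthonormal_frame_def by blast+

text \<open>The Gram-Schmidt step for two forms at once: as long as each subspace on which \<open>c\<close> does not
  vanish contains a \<open>c\<close>-unit vector whose \<open>c\<close>-orthogonal complement is also \<open>m\<close>-orthogonal to it,
  such vectors can be split off one after the other. The complement in a span is
  the span of fewer vectors, so the process ends.\<close>

lemma orthonormal_frame_from_unit_vectors:
  fixes c m :: "'v::real_vector \<Rightarrow> 'v \<Rightarrow> real"
  assumes "finite S" "psd_form_on (span S) c" "psd_form_on (span S) m"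
    and "\<And>S'. finite S' \<Longrightarrow> span S' \<subseteq> span S \<Longrightarrow> \<exists>x\<in>span S'. c x x \<noteq> 0 \<Longrightarrow>
           \<exists>e\<in>span S'. c e e = 1 \<and> (\<forall>v\<in>span S'. c e v = 0 \<longrightarrow> m e v = 0)"
  shows "\<exists>n e. orthonormal_frame (span S) c n e \<and> (\<forall>i<n. \<forall>j<n. i \<noteq> j \<longrightarrow> m (e i) (e j) = 0)"
  using assms
proof (induction "card S" arbitrary: S rule: less_induct)
  case less
  note c = less.prems(2) and m = less.prems(3)
  show ?case
  proof (cases "\<exists>x\<in>span S. c x x \<noteq> 0")
    case False
    then show ?thesis by (intro exI[of _ 0]) (simp add: orthonormal_frame_def)
  next
    case True
    obtain e where e: "e \<in> span S" "c e e = 1" and em: "\<And>v. v \<in> span S \<Longrightarrow> c e v = 0 \<Longrightarrow> m e v = 0"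
      using less.prems(4)[OF less.prems(1) order_refl True] by blast
    note le = psd_form_onD(1)[OF c e(1)]
    have "\<exists>s\<in>S. c e s \<noteq> 0"
    proof (rule ccontr)
      assume *: "\<not> ?thesis"
      have "c e v = 0" if "v \<in> span S" for v
        using linear_form_on_zero_span[OF le subspace_span _ _ that] * span_superset by blast
      then show False using e by auto
    qed
    then obtain s where s: "s \<in> S" "c e s \<noteq> 0" by blast
    note s_span = span_base[OF s(1)]
    \<comment> \<open>each generator other than \<open>s\<close> is moved along \<open>s\<close> into the complement of \<open>e\<close>\<close>
    define S' where "S' = (\<lambda>t. t - (c e t / c e s) *\<^sub>R s) ` (S - {s})"
    have fin': "finite S'" using less.prems(1) by (simp add: S'_def)
    have "card S' \<le> card (S - {s})" unfolding S'_def using less.prems(1) by (intro card_image_le) simp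
    also have "\<dots> < card S" using s less.prems(1) by (intro card_Diff1_less)
    finally have card: "card S' < card S" .
    have S'_sub: "S' \<subseteq> span S"
      unfolding S'_def using s_span span_base[of _ S] by (auto intro!: span_diff span_scale)
    then have sub: "span S' \<subseteq> span S" by (simp add: span_minimal)
    have zero_S': "c e v = 0" if v: "v \<in> S'" for v
    proof -
      obtain t where t: "t \<in> S" "v = t - (c e t / c e s) *\<^sub>R s" using v by (auto simp: S'_def)
      show ?thesis
        using linear_form_onD[OF le span_base[OF t(1)] s_span, of 1 "- (c e t / c e s)"] t s by simp
    qed
    have zero: "c e v = 0" if "v \<in> span S'" for v
      using linear_form_on_zero_span[OF le subspace_span S'_sub zero_S' that] .
    have complement: "v \<in> span S'" if v: "v \<in> span S" "c e v = 0" for v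
    proof -
      have "S \<subseteq> span (insert s S')"
      proof
        fix t assume t: "t \<in> S"
        show "t \<in> span (insert s S')"
        proof (cases "t = s")
          case False
          then have "t - (c e t / c e s) *\<^sub>R s \<in> span S'"
            using t by (intro span_base) (auto simp: S'_def)
          then show ?thesis unfolding span_breakdown_eq by blast
        qed (simp add: span_base)
      qed
      then have "v \<in> span (insert s S')"
        using v span_minimal[OF _ subspace_span] by blast
      then obtain k where k: "v - k *\<^sub>R s \<in> span S'" by (auto simp: span_breakdown_eq)
      then have "0 = c e (v - k *\<^sub>R s)" using zero by simp
      also have "\<dots> = - k * c e s"
        using linear_form_onD[OF le v(1) s_span, of 1 "-k"] v by simp
      finally have "k = 0" using s by simp
      then show ?thesis using k by simp
    qed
    obtain n f where frame: "orthonormal_frame (span S') c n f"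
      and mf: "\<forall>i<n. \<forall>j<n. i \<noteq> j \<longrightarrow> m (f i) (f j) = 0"
      using less.hyps[OF card fin' psd_form_on_subset[OF c sub] psd_form_on_subset[OF m sub]
          less.prems(4)] sub by blast
    note f = orthonormal_frameD(1)[OF frame] and cf = orthonormal_frameD(2)[OF frame]
      and rf = orthonormal_frameD(3)[OF frame]
    have f_span: "f i \<in> span S" if "i < n" for i using f[OF that] sub by blast
    have cef: "c e (f i) = 0" "c (f i) e = 0" "m e (f i) = 0" "m (f i) e = 0" if "i < n" for i
    proof -
      show 1: "c e (f i) = 0" using zero[OF f[OF that]] .
      then show "m e (f i) = 0" using em[OF f_span[OF that]] by simp
      then show "c (f i) e = 0" "m (f i) e = 0"
        using psd_form_onD(2)[OF c e(1) f_span[OF that]] psd_form_onD(2)[OF m e(1) f_span[OF that]] 1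
        by simp_all
    qed
    define g where "g = (\<lambda>i. if i < n then f i else e)"
    have res: "c (x - (\<Sum>i<Suc n. c x (g i) *\<^sub>R g i)) (x - (\<Sum>i<Suc n. c x (g i) *\<^sub>R g i)) = 0"
      if x: "x \<in> span S" for x
    proof -
      define y where "y = x - c x e *\<^sub>R e"
      have "y \<in> span S" using x e unfolding y_def by (intro span_diff span_scale)
      moreover have "c e y = 0"
        using linear_form_onD[OF le x e(1), of 1 "- c x e"] psd_form_onD(2)[OF c x e(1)] e
        by (simp add: y_def)
      ultimately have y: "y \<in> span S'" by (rule complement)
      have "c y (f i) = c x (f i)" if "i < n" for i
        using linear_form_onD[OF psd_form_on_linear_left[OF c subspace_span f_span[OF that]] x e(1), of 1 "- c x e"]
          cef[OF that] by (simp add: y_def)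
      then have "(\<Sum>i<Suc n. c x (g i) *\<^sub>R g i) = (\<Sum>i<n. c y (f i) *\<^sub>R f i) + c x e *\<^sub>R e"
        by (simp add: g_def)
      then have "x - (\<Sum>i<Suc n. c x (g i) *\<^sub>R g i) = y - (\<Sum>i<n. c y (f i) *\<^sub>R f i)"
        by (simp add: y_def algebra_simps)
      then show ?thesis using rf[OF y] by simp
    qed
    have "g i \<in> span S" "c (g i) (g j) = (if i = j then 1 else 0)" "i \<noteq> j \<Longrightarrow> m (g i) (g j) = 0"
      if "i < Suc n" "j < Suc n" for i j
      using that f_span cf mf cef e by (auto simp: g_def less_Suc_eq)
    then have "orthonormal_frame (span S) c (Suc n) g \<and>
        (\<forall>i<Suc n. \<forall>j<Suc n. i \<noteq> j \<longrightarrow> m (g i) (g j) = 0)"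
      unfolding orthonormal_frame_def using res by blast
    then show ?thesis by blast
  qed
qed

lemma orthonormal_frame_exists:
  fixes c :: "'v::real_vector \<Rightarrow> 'v \<Rightarrow> real"
  assumes "finite S" "psd_form_on (span S) c"
  shows "\<exists>n e. orthonormal_frame (span S) c n e"
proof -
  have ex: "\<exists>e\<in>span S'. c e e = 1 \<and> (\<forall>v\<in>span S'. c e v = 0 \<longrightarrow> (0::real) = 0)"
    if "span S' \<subseteq> span S" "\<exists>x\<in>span S'. c x x \<noteq> 0" for S'
  proof -
    obtain x where x: "x \<in> span S'" "c x x \<noteq> 0" using \<open>\<exists>x\<in>span S'. _\<close> by blast
    have xS: "x \<in> span S" using x that by blast
    have pos: "0 < c x x" using psd_form_onD(3)[OF assms(2) xS] x by simp
    have "c (0 + (1 / sqrt (c x x)) *\<^sub>R x) (0 + (1 / sqrt (c x x)) *\<^sub>R x) = 1"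
      using psd_form_on_line[OF assms(2) subspace_span span_zero xS, of "1 / sqrt (c x x)"] pos
        linear_form_on_zero[OF psd_form_onD(1)[OF assms(2) span_zero] subspace_span]
        linear_form_on_zero[OF psd_form_on_linear_left[OF assms(2) subspace_span xS] subspace_span]
      by (simp add: power_divide)
    then show ?thesis using x(1) by (intro bexI[of _ "(1 / sqrt (c x x)) *\<^sub>R x"]) (auto intro: span_scale)
  qed
  have 0: "psd_form_on (span S) (\<lambda>_ _. 0)" by (simp add: psd_form_on_def linear_form_on_def)
  show ?thesis
    using orthonormal_frame_from_unit_vectors[OF assms 0] ex by blast
qed

lemma orthonormal_combination:
  fixes c :: "'v::real_vector \<Rightarrow> 'v \<Rightarrow> real"
  assumes c: "psd_form_on U c" "subspace U" and e: "\<And>i::nat. i < n \<Longrightarrow> e i \<in> U"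
  shows "(\<Sum>i<n. x i *\<^sub>R e i) \<in> U"
    "v \<in> U \<Longrightarrow> c (\<Sum>i<n. x i *\<^sub>R e i) v = (\<Sum>i<n. x i * c (e i) v)"
    "v \<in> U \<Longrightarrow> c v (\<Sum>i<n. x i *\<^sub>R e i) = (\<Sum>i<n. x i * c v (e i))"
    "c (\<Sum>i<n. x i *\<^sub>R e i) (\<Sum>i<n. y i *\<^sub>R e i) = (\<Sum>i<n. \<Sum>j<n. x i * y j * c (e i) (e j))"
proof -
  show in_U: "(\<Sum>i<n. x i *\<^sub>R e i) \<in> U" for x
    using e c(2) by (intro subspace_sum subspace_mul) auto
  show left: "c (\<Sum>i<n. x i *\<^sub>R e i) v = (\<Sum>i<n. x i * c (e i) v)" if "v \<in> U" for v
    by (rule linear_form_on_sum[OF psd_form_on_linear_left[OF c that] c(2)]) (use e in auto)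
  show right: "c v (\<Sum>i<n. x i *\<^sub>R e i) = (\<Sum>i<n. x i * c v (e i))" if "v \<in> U" for v x
    by (rule linear_form_on_sum[OF psd_form_onD(1)[OF c(1) that] c(2)]) (use e in auto)
  show "c (\<Sum>i<n. x i *\<^sub>R e i) (\<Sum>i<n. y i *\<^sub>R e i) = (\<Sum>i<n. \<Sum>j<n. x i * y j * c (e i) (e j))"
    using e by (subst sum.swap) (simp add: left in_U right sum_distrib_left mult_ac)
qed

lemma psd_form_on_minus_null:
  assumes c: "psd_form_on U c" "subspace U" and v: "v \<in> U" and w: "w \<in> U" "c (v - w) (v - w) = 0"
    and u: "u \<in> U"
  shows "c v u = c w u"
proof -
  have "c (v - w) u = 0"
    using psd_form_on_null[OF c _ w(2) u] v w(1) c(2) by (simp add: subspace_diff)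
  then show ?thesis
    using linear_form_on_simps(2)[OF psd_form_on_linear_left[OF c u] v w(1)] by simp
qed

text \<open>Some unit vector maximizes the Rayleigh quotient of \<open>m\<close> with respect to \<open>c\<close>, by compactness of
  the unit sphere in coordinates. If \<open>\<mu>\<close> is the maximum, then \<open>\<mu> c - m\<close> is positive semidefinite and
  the maximizer is a null vector of it.\<close>

lemma rayleigh_maximizer:
  fixes c m :: "'v::real_vector \<Rightarrow> 'v \<Rightarrow> real"
  assumes S: "finite S" and c: "psd_form_on (span S) c" and m: "psd_form_on (span S) m"
    and le: "\<And>x. x \<in> span S \<Longrightarrow> m x x \<le> c x x" and ex: "\<exists>x\<in>span S. c x x \<noteq> 0"
  shows "\<exists>e\<in>span S. c e e = 1 \<and> (\<forall>v\<in>span S. c e v = 0 \<longrightarrow> m e v = 0)"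
proof -
  note sp = subspace_span[of S]
  obtain n b where frame: "orthonormal_frame (span S) c n b"
    using orthonormal_frame_exists[OF S c] by blast
  note b = orthonormal_frameD(1)[OF frame] and cb = orthonormal_frameD(2)[OF frame]
    and rb = orthonormal_frameD(3)[OF frame]
  define comb where "comb = (\<lambda>x::nat \<Rightarrow> real. \<Sum>i<n. x i *\<^sub>R b i)"
  have comb: "comb x \<in> span S" for x unfolding comb_def using orthonormal_combination(1)[OF c sp b] .
  have quadratic: "q (comb x) (comb x) = (\<Sum>i<n. \<Sum>j<n. x i * x j * q (b i) (b j))"
    if "psd_form_on (span S) q" for q x
    unfolding comb_def by (rule orthonormal_combination(4)[OF that sp b])
  have c_comb: "c (comb x) (comb x) = (\<Sum>i<n. (x i)\<^sup>2)" for x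
  proof -
    have "(\<Sum>j<n. x i * x j * c (b i) (b j)) = (x i)\<^sup>2" if "i < n" for i
    proof -
      have "(\<Sum>j<n. x i * x j * c (b i) (b j)) = (\<Sum>j<n. if j = i then x i * x j else 0)"
        using that by (intro sum.cong) (auto simp: cb)
      then show ?thesis using that by (simp add: power2_eq_square)
    qed
    then show ?thesis by (simp add: quadratic[OF c])
  qed
  define coord where "coord = (\<lambda>v i. if i < n then c v (b i) else 0)"
  have coord: "c v u = c (comb (coord v)) u" "m v u = m (comb (coord v)) u"
    if "v \<in> span S" "u \<in> span S" for v u
  proof -
    have eq: "comb (coord v) = (\<Sum>i<n. c v (b i) *\<^sub>R b i)" by (simp add: comb_def coord_def)
    have r: "c (v - comb (coord v)) (v - comb (coord v)) = 0" using rb[OF that(1)] by (simp add: eq)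
    have d: "v - comb (coord v) \<in> span S" using that comb by (simp add: span_diff)
    then have "m (v - comb (coord v)) (v - comb (coord v)) = 0"
      using le[OF d] r psd_form_onD(3)[OF m d] by simp
    then show "c v u = c (comb (coord v)) u" "m v u = m (comb (coord v)) u"
      using psd_form_on_minus_null[OF c sp that(1) comb _ that(2)]
        psd_form_on_minus_null[OF m sp that(1) comb _ that(2)] r by auto
  qed
  have coord_sq: "c v v = (\<Sum>i<n. (coord v i)\<^sup>2)" "m v v = m (comb (coord v)) (comb (coord v))"
    if "v \<in> span S" for v
  proof -
    have "c v v = c (comb (coord v)) v" using coord(1)[OF that that] .
    also have "\<dots> = c v (comb (coord v))" using psd_form_onD(2)[OF c that comb] by simp
    also have "\<dots> = (\<Sum>i<n. (coord v i)\<^sup>2)" using coord(1)[OF that comb] c_comb by simp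
    finally show "c v v = (\<Sum>i<n. (coord v i)\<^sup>2)" .
    have "m v v = m v (comb (coord v))"
      using coord(2)[OF that that] psd_form_onD(2)[OF m that comb] by simp
    then show "m v v = m (comb (coord v)) (comb (coord v))" using coord(2)[OF that comb] by simp
  qed
  \<comment> \<open>Setting the coordinates from \<open>n\<close> on to zero makes the unit sphere a compact set of sequences.\<close>
  define K where "K = PiE UNIV (\<lambda>i::nat. if i < n then {-1..1} else {0::real}) \<inter> {x. (\<Sum>i<n. (x i)\<^sup>2) = 1}"
  have "compact (PiE UNIV (\<lambda>i::nat. if i < n then {-1..1} else {0::real}))"
  proof -
    have "compactin (product_topology (\<lambda>i::nat. euclidean :: real topology) UNIV)
            (PiE UNIV (\<lambda>i. if i < n then {-1..1} else {0}))"
      unfolding compactin_PiE by auto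
    then show ?thesis by (simp add: euclidean_product_topology)
  qed
  moreover have "closed {x. (\<Sum>i<n. (x i)\<^sup>2) = (1::real)}"
    by (intro closed_Collect_eq continuous_intros continuous_on_product_coordinates)
  ultimately have "compact K" unfolding K_def by (rule compact_Int_closed)
  have in_K: "coord v \<in> K" if "v \<in> span S" "c v v = 1" for v
  proof -
    have one: "(\<Sum>i<n. (coord v i)\<^sup>2) = 1" using coord_sq(1)[OF that(1)] that by simp
    have "\<bar>coord v i\<bar> \<le> 1" if "i < n" for i
    proof -
      have "(coord v i)\<^sup>2 \<le> (\<Sum>i<n. (coord v i)\<^sup>2)" using that by (intro member_le_sum) auto
      then show ?thesis using one by (simp add: abs_square_le_1)
    qed
    then show ?thesis using one by (auto simp: K_def coord_def abs_le_iff)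
  qed
  obtain x0 where x0: "x0 \<in> span S" "c x0 x0 \<noteq> 0" using ex by blast
  have normalize: "c (r *\<^sub>R v) (r *\<^sub>R v) = r\<^sup>2 * c v v" "m (r *\<^sub>R v) (r *\<^sub>R v) = r\<^sup>2 * m v v"
    if "v \<in> span S" for r v
    using psd_form_on_line[OF c sp span_zero that, of r] psd_form_on_line[OF m sp span_zero that, of r]
      linear_form_on_zero[OF psd_form_onD(1)[OF c span_zero] sp] linear_form_on_zero[OF psd_form_onD(1)[OF m span_zero] sp]
      linear_form_on_zero[OF psd_form_on_linear_left[OF c sp that] sp]
      linear_form_on_zero[OF psd_form_on_linear_left[OF m sp that] sp]
    by simp_all
  have unit: "(1 / sqrt (c v v)) *\<^sub>R v \<in> span S" "c ((1 / sqrt (c v v)) *\<^sub>R v) ((1 / sqrt (c v v)) *\<^sub>R v) = 1"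
    if "v \<in> span S" "c v v \<noteq> 0" for v
    using that normalize(1)[OF that(1)] psd_form_onD(3)[OF c that(1)]
    by (auto simp: span_scale power_divide)
  have "K \<noteq> {}" using in_K[OF unit[OF x0]] by blast
  have cont: "continuous_on K (\<lambda>x. m (comb x) (comb x))"
    unfolding quadratic[OF m]
    by (intro continuous_intros continuous_on_subset[OF continuous_on_product_coordinates]) auto
  obtain x where x: "x \<in> K" and max: "\<And>y. y \<in> K \<Longrightarrow> m (comb y) (comb y) \<le> m (comb x) (comb x)"
    using continuous_attains_sup[OF \<open>compact K\<close> \<open>K \<noteq> {}\<close> cont] by blast
  define e where "e = comb x"
  define \<mu> where "\<mu> = m e e"
  have e: "e \<in> span S" "c e e = 1" using x by (auto simp: e_def comb c_comb K_def)
  have bound: "m v v \<le> \<mu> * c v v" if v: "v \<in> span S" for v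
  proof (cases "c v v = 0")
    case True
    then show ?thesis using le[OF v] by simp
  next
    case False
    define w where "w = (1 / sqrt (c v v)) *\<^sub>R v"
    have "m w w \<le> \<mu>"
      using coord_sq(2)[OF unit(1)[OF v False]] max[OF in_K[OF unit[OF v False]]]
      by (simp add: w_def \<mu>_def e_def)
    moreover have "m w w = m v v / c v v"
      using normalize(2)[OF v] psd_form_onD(3)[OF c v] by (simp add: w_def power_divide)
    ultimately show ?thesis using False psd_form_onD(3)[OF c v] by (simp add: divide_le_eq)
  qed
  have "psd_form_on (span S) (\<lambda>x y. \<mu> * c x y - m x y)"
    using c m bound unfolding psd_form_on_def linear_form_on_def
    by (auto simp: algebra_simps)
  from psd_form_on_null[OF this sp e(1)] e have "\<mu> * c e v - m e v = 0" if "v \<in> span S" for v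
    using that by (simp add: \<mu>_def)
  then have "m e v = 0" if "v \<in> span S" "c e v = 0" for v
    using that by fastforce
  then show ?thesis using e by blast
qed

text \<open>The spectral theorem for a pencil of two forms, both of which may be degenerate: maximizers of
  the Rayleigh quotient are split off until only null vectors are left.\<close>

lemma simultaneous_diagonalization:
  fixes c m :: "'v::real_vector \<Rightarrow> 'v \<Rightarrow> real"
  assumes S: "finite S" and c: "psd_form_on (span S) c" and m: "psd_form_on (span S) m"
    and le: "\<And>x. x \<in> span S \<Longrightarrow> m x x \<le> c x x"
  shows "\<exists>n e. orthonormal_frame (span S) c n e \<and> (\<forall>i<n. \<forall>j<n. i \<noteq> j \<longrightarrow> m (e i) (e j) = 0)"
proof -
  have ex: "\<exists>e\<in>span S'. c e e = 1 \<and> (\<forall>v\<in>span S'. c e v = 0 \<longrightarrow> m e v = 0)"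
    if "finite S'" "span S' \<subseteq> span S" "\<exists>x\<in>span S'. c x x \<noteq> 0" for S'
    using rayleigh_maximizer[OF that(1) psd_form_on_subset[OF c that(2)] psd_form_on_subset[OF m that(2)]]
      le that(2,3) by blast
  show ?thesis
    by (rule orthonormal_frame_from_unit_vectors[OF S c m ex])
qed

text \<open>The representing vector has the values of the functional as coordinates in an orthonormal
  family.\<close>

lemma riesz_finite_dimensional:
  fixes c :: "'v::real_vector \<Rightarrow> 'v \<Rightarrow> real"
  assumes S: "finite S" and c: "psd_form_on (span S) c"
    and pos: "\<And>x. x \<in> span S \<Longrightarrow> c x x = 0 \<Longrightarrow> x = 0" and l: "linear_form_on (span S) l"
  shows "\<exists>!p. p \<in> span S \<and> (\<forall>q\<in>span S. c p q = l q)"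
proof -
  note sp = subspace_span[of S]
  obtain n e where frame: "orthonormal_frame (span S) c n e"
    using orthonormal_frame_exists[OF S c] by blast
  note e = orthonormal_frameD(1)[OF frame] and re = orthonormal_frameD(3)[OF frame]
  define p where "p = (\<Sum>i<n. l (e i) *\<^sub>R e i)"
  have p: "p \<in> span S" unfolding p_def using orthonormal_combination(1)[OF c sp e] .
  have "c p q = l q" if q: "q \<in> span S" for q
  proof -
    have "q - (\<Sum>i<n. c q (e i) *\<^sub>R e i) \<in> span S"
      using q orthonormal_combination(1)[OF c sp e] by (intro span_diff)
    from pos[OF this re[OF q]] have "q = (\<Sum>i<n. c q (e i) *\<^sub>R e i)" by simp
    then have "l q = l (\<Sum>i<n. c q (e i) *\<^sub>R e i)" by simp
    also have "\<dots> = (\<Sum>i<n. c q (e i) * l (e i))"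
      by (rule linear_form_on_sum[OF l sp]) (use e in auto)
    also have "\<dots> = (\<Sum>i<n. l (e i) * c (e i) q)"
      using psd_form_onD(2)[OF c q] e by (intro sum.cong) auto
    also have "\<dots> = c p q" unfolding p_def using orthonormal_combination(2)[OF c sp e q] by simp
    finally show ?thesis by simp
  qed
  moreover have "p' = p" if p': "p' \<in> span S" "\<And>q. q \<in> span S \<Longrightarrow> c p' q = l q" for p'
  proof -
    have d: "p' - p \<in> span S" using p p' by (simp add: span_diff)
    have "c (p' - p) (p' - p) = c p' (p' - p) - c p (p' - p)"
      using linear_form_on_simps(2)[OF psd_form_on_linear_left[OF c sp d] p'(1) p] .
    also have "\<dots> = 0" using p'(2)[OF d] calculation \<open>\<And>q. q \<in> span S \<Longrightarrow> c p q = l q\<close>[OF d] by simp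
    finally show ?thesis using pos[OF d] by simp
  qed
  ultimately show ?thesis using p by blast
qed

section \<open>Square integrable functions\<close>

lemma L2_funD:
  assumes "L2_fun M g"
  shows "g \<in> borel_measurable M" "integrable M (\<lambda>x. (g x)\<^sup>2)"
  using assms by (auto simp: L2_fun_def)

lemma L2_fun_mult_integrable:
  assumes "L2_fun M f" "L2_fun M g"
  shows "integrable M (\<lambda>x. f x * g x)"
proof (rule Bochner_Integration.integrable_bound)
  show "integrable M (\<lambda>x. (f x)\<^sup>2 + (g x)\<^sup>2)"
    using assms by (intro Bochner_Integration.integrable_add L2_funD)
  show "(\<lambda>x. f x * g x) \<in> borel_measurable M"
    using assms by (intro borel_measurable_times L2_funD)
  have "\<bar>a * b\<bar> \<le> a\<^sup>2 + b\<^sup>2" for a b :: real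
    using sum_squares_bound[of "\<bar>a\<bar>" "\<bar>b\<bar>"] mult_nonneg_nonneg[OF abs_ge_zero[of a] abs_ge_zero[of b]]
    unfolding abs_mult by (simp only: mult.assoc power2_abs)
  then show "AE x in M. norm (f x * g x) \<le> norm ((f x)\<^sup>2 + (g x)\<^sup>2)"
    by (intro AE_I2) simp
qed

lemma L2_fun_zero: "L2_fun M (\<lambda>x. 0)"
  by (simp add: L2_fun_def)

lemma L2_fun_scale: "L2_fun M f \<Longrightarrow> L2_fun M (\<lambda>x. c * f x)"
  by (auto simp: L2_fun_def power_mult_distrib)

lemma L2_fun_add:
  assumes "L2_fun M f" "L2_fun M g"
  shows "L2_fun M (\<lambda>x. f x + g x)"
proof -
  have "integrable M (\<lambda>x. (f x)\<^sup>2 + (g x)\<^sup>2 + 2 * (f x * g x))"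
    using assms by (intro Bochner_Integration.integrable_add integrable_mult_right L2_fun_mult_integrable L2_funD)
  then show ?thesis
    using assms by (auto simp: L2_fun_def power2_sum mult.assoc)
qed

lemma L2_fun_diff: "L2_fun M f \<Longrightarrow> L2_fun M g \<Longrightarrow> L2_fun M (\<lambda>x. f x - g x)"
  using L2_fun_add[of M f "\<lambda>x. (-1) * g x"] L2_fun_scale[of M g "-1"] by simp

lemma L2_fun_sum: "(\<And>i. i \<in> I \<Longrightarrow> L2_fun M (f i)) \<Longrightarrow> L2_fun M (\<lambda>x. \<Sum>i\<in>I. f i x)"
proof (induction I rule: infinite_finite_induct)
  case (insert i I)
  then show ?case using L2_fun_add[of M "f i" "\<lambda>x. \<Sum>i\<in>I. f i x"] by simp
qed (simp_all add: L2_fun_zero)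

lemma L2_fun_bound:
  assumes "L2_fun M f" "g \<in> borel_measurable M" "AE x in M. \<bar>g x\<bar> \<le> \<bar>f x\<bar>"
  shows "L2_fun M g"
  unfolding L2_fun_def
proof
  show "integrable M (\<lambda>x. (g x)\<^sup>2)"
    by (rule Bochner_Integration.integrable_bound[OF L2_funD(2)[OF assms(1)]])
      (use assms in \<open>auto simp: abs_le_square_iff\<close>)
qed fact

lemma L2_fun_finite_measure:
  assumes "finite_measure M" "f \<in> borel_measurable M" "AE x in M. \<bar>f x\<bar> \<le> B"
  shows "L2_fun M f"
proof (rule L2_fun_bound[OF _ assms(2)])
  show "L2_fun M (\<lambda>x. B)"
    using assms(1) by (auto simp: L2_fun_def finite_measure.integrable_const)
  show "AE x in M. \<bar>f x\<bar> \<le> \<bar>B\<bar>" using assms(3) by auto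
qed

lemma subspace_L2: "subspace {f. L2_fun M f}"
  by (simp add: subspace_def plus_fun_def scaleR_fun_def zero_fun_def L2_fun_zero L2_fun_add L2_fun_scale)

lemma psd_form_L2: "psd_form_on {f. L2_fun M f} (\<lambda>f g. LINT x|M. f x * g x)"
proof -
  have "(LINT x|M. f x * (r * g x + s * h x)) = r * (LINT x|M. f x * g x) + s * (LINT x|M. f x * h x)"
    if "L2_fun M f" "L2_fun M g" "L2_fun M h" for f g h r s
    using L2_fun_mult_integrable[OF that(1,2)] L2_fun_mult_integrable[OF that(1,3)]
    by (simp add: distrib_left mult.left_commute)
  then show ?thesis
    unfolding psd_form_on_def linear_form_on_def by (auto simp: mult.commute)
qed

lemma L2_norm_nonneg: "0 \<le> L2_norm M f"
  by (simp add: L2_norm_def)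

lemma L2_norm_square: "(L2_norm M f)\<^sup>2 = (LINT x|M. (f x)\<^sup>2)"
  by (simp add: L2_norm_def)

lemma L2_Cauchy_Schwarz:
  assumes "L2_fun M f" "L2_fun M g"
  shows "\<bar>LINT x|M. f x * g x\<bar> \<le> L2_norm M f * L2_norm M g"
proof -
  have "(LINT x|M. f x * g x)\<^sup>2 \<le> (LINT x|M. f x * f x) * (LINT x|M. g x * g x)"
    using psd_form_on_Cauchy_Schwarz[OF psd_form_L2 subspace_L2] assms by simp
  also have "\<dots> = (L2_norm M f * L2_norm M g)\<^sup>2"
    by (simp add: power_mult_distrib L2_norm_square power2_eq_square[symmetric])
  finally have "\<bar>LINT x|M. f x * g x\<bar> \<le> \<bar>L2_norm M f * L2_norm M g\<bar>"
    by (simp add: abs_le_square_iff)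
  then show ?thesis by (simp add: L2_norm_nonneg)
qed

lemma square_diff_bound: "(a - b)\<^sup>2 \<le> 2 * (a - c)\<^sup>2 + 2 * (b - c)\<^sup>2" for a b c :: real
proof -
  have "2 * (a - c)\<^sup>2 + 2 * (b - c)\<^sup>2 - (a - b)\<^sup>2 = (a + b - 2 * c)\<^sup>2"
    by (simp add: power2_eq_square algebra_simps)
  then show ?thesis by (metis diff_ge_0_iff_ge zero_le_power2)
qed

text \<open>A sequence that is Cauchy in mean square has a subsequence whose consecutive differences
  \<open>d\<^sub>k\<close> satisfy \<open>\<Sum>\<^sub>k 4\<^sup>k \<integral> d\<^sub>k\<^sup>2 < \<infinity>\<close>. Hence \<open>\<bar>d\<^sub>k\<bar> \<le> 2\<^sup>-\<^sup>k\<close> eventually, almost everywhere, so that the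
  subsequence converges almost everywhere; Fatou's lemma carries the Cauchy condition to the limit.\<close>

lemma L2_complete:
  assumes f: "\<And>n. L2_fun M (f n)"
    and Cauchy: "\<And>\<epsilon>. 0 < \<epsilon> \<Longrightarrow> \<exists>N::nat. \<forall>i\<ge>N. \<forall>j\<ge>N. (LINT x|M. (f i x - f j x)\<^sup>2) \<le> \<epsilon>"
  shows "\<exists>g. L2_fun M g \<and> (\<lambda>n. L2_norm M (\<lambda>x. f n x - g x)) \<longlonglongrightarrow> 0"
proof -
  note [measurable] = L2_funD(1)[OF f]
  have int: "integrable M (\<lambda>x. (f i x - f j x)\<^sup>2)" for i j
    using L2_funD(2)[OF L2_fun_diff[OF f f]] .
  have "\<exists>N. \<forall>k::nat. \<forall>i\<ge>N k. \<forall>j\<ge>N k. (LINT x|M. (f i x - f j x)\<^sup>2) \<le> (1/8)^k"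
    by (intro choice allI Cauchy) simp
  then obtain N :: "nat \<Rightarrow> nat" where
    N: "\<And>k i j. N k \<le> i \<Longrightarrow> N k \<le> j \<Longrightarrow> (LINT x|M. (f i x - f j x)\<^sup>2) \<le> (1/8)^k"
    by blast
  \<comment> \<open>an increasing sequence that dominates both \<open>N\<close> and the identity\<close>
  define r where "r k = (\<Sum>l\<le>k. N l) + k" for k
  have r: "N k \<le> r k" "r k \<le> r (Suc k)" "k \<le> r k" for k
    using member_le_sum[of k "{..k}" N] by (auto simp: r_def)
  define d where "d k x = f (r (Suc k)) x - f (r k) x" for k x
  have [measurable]: "d k \<in> borel_measurable M" for k unfolding d_def by measurable
  have d_le: "(\<integral>\<^sup>+x. ennreal (4^k * (d k x)\<^sup>2) \<partial>M) \<le> ennreal ((1/2)^k)" for k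
  proof -
    have "(\<integral>\<^sup>+x. ennreal (4^k * (d k x)\<^sup>2) \<partial>M) = ennreal (LINT x|M. 4^k * (d k x)\<^sup>2)"
      using int by (intro nn_integral_eq_integral) (auto simp: d_def)
    also have "(LINT x|M. 4^k * (d k x)\<^sup>2) \<le> 4^k * (1/8)^k"
      using N[of k "r (Suc k)" "r k"] r(1,2)[of k] by (simp add: d_def)
    also have "4^k * (1/8)^k = (4 * (1/8) :: real)^k" by (rule power_mult_distrib[symmetric])
    also have "4 * (1/8) = (1/2::real)" by simp
    finally show ?thesis by (simp add: ennreal_leI)
  qed
  have "(\<integral>\<^sup>+x. (\<Sum>k. ennreal (4^k * (d k x)\<^sup>2)) \<partial>M) = (\<Sum>k. \<integral>\<^sup>+x. ennreal (4^k * (d k x)\<^sup>2) \<partial>M)"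
    by (intro nn_integral_suminf) measurable
  also have "\<dots> \<le> (\<Sum>k. ennreal ((1/2)^k))"
    by (intro suminf_le d_le) auto
  also have "\<dots> = ennreal (\<Sum>k. (1/2)^k)"
    by (intro suminf_ennreal2) (auto intro: summable_geometric)
  also have "\<dots> < \<infinity>" by simp
  finally have "AE x in M. (\<Sum>k. ennreal (4^k * (d k x)\<^sup>2)) \<noteq> \<infinity>"
    by (intro nn_integral_PInf_AE) auto
  then have conv: "AE x in M. convergent (\<lambda>k. f (r k) x)"
  proof (eventually_elim)
    fix x assume "(\<Sum>k. ennreal (4^k * (d k x)\<^sup>2)) \<noteq> \<infinity>"
    then have "summable (\<lambda>k. 4^k * (d k x)\<^sup>2)"
      by (intro summable_suminf_not_top) (auto simp: top_ennreal.rep_eq)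
    then have "(\<lambda>k. 4^k * (d k x)\<^sup>2) \<longlonglongrightarrow> 0" by (rule summable_LIMSEQ_zero)
    then have "eventually (\<lambda>k. 4^k * (d k x)\<^sup>2 < 1) sequentially"
      by (rule order_tendstoD) simp
    then have "eventually (\<lambda>k. norm (d k x) \<le> (1/2)^k) sequentially"
    proof eventually_elim
      case (elim k)
      have "(d k x)\<^sup>2 \<le> 1 / 4^k" using elim by (simp add: pos_le_divide_eq mult.commute)
      also have "1 / 4^k = (((1/2)\<^sup>2)^k::real)" by (simp add: power_divide)
      also have "\<dots> = ((1/2)^k)\<^sup>2" by (simp only: power_mult[symmetric] mult.commute)
      finally have "\<bar>d k x\<bar>\<^sup>2 \<le> ((1/2)^k)\<^sup>2" by simp
      then show ?case unfolding real_norm_def by (rule power2_le_imp_le) simp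
    qed
    then have "summable (\<lambda>k. d k x)"
      by (rule summable_comparison_test_ev) (simp add: summable_geometric)
    then have "convergent (\<lambda>n. \<Sum>k<n. d k x)" by (simp add: summable_iff_convergent)
    moreover have "(\<Sum>k<n. d k x) = f (r n) x - f (r 0) x" for n
      unfolding d_def by (rule sum_lessThan_telescope)
    ultimately have "convergent (\<lambda>n. f (r n) x - f (r 0) x + f (r 0) x)"
      by (intro convergent_add convergent_const) simp
    then show "convergent (\<lambda>k. f (r k) x)" by simp
  qed
  define g where "g x = lim (\<lambda>k. f (r k) x)" for x
  have [measurable]: "g \<in> borel_measurable M" unfolding g_def by measurable
  have lim: "AE x in M. (\<lambda>k. f (r k) x) \<longlonglongrightarrow> g x"
    using conv by eventually_elim (simp add: g_def convergent_LIMSEQ_iff)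
  have bound: "(\<integral>\<^sup>+x. ennreal ((f n x - g x)\<^sup>2) \<partial>M) \<le> ennreal \<epsilon>"
    if "\<And>j. j \<ge> K \<Longrightarrow> (LINT x|M. (f n x - f j x)\<^sup>2) \<le> \<epsilon>" for n \<epsilon> K
  proof -
    have "AE x in M. ennreal ((f n x - g x)\<^sup>2) = liminf (\<lambda>k. ennreal ((f n x - f (r k) x)\<^sup>2))"
      using lim
    proof eventually_elim
      case (elim x)
      have "(\<lambda>k. ennreal ((f n x - f (r k) x)\<^sup>2)) \<longlonglongrightarrow> ennreal ((f n x - g x)\<^sup>2)"
        by (intro tendsto_ennrealI tendsto_intros elim)
      then show ?case by (intro lim_imp_Liminf[symmetric]) auto
    qed
    then have "(\<integral>\<^sup>+x. ennreal ((f n x - g x)\<^sup>2) \<partial>M) = (\<integral>\<^sup>+x. liminf (\<lambda>k. ennreal ((f n x - f (r k) x)\<^sup>2)) \<partial>M)"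
      by (rule nn_integral_cong_AE)
    also have "\<dots> \<le> liminf (\<lambda>k. \<integral>\<^sup>+x. ennreal ((f n x - f (r k) x)\<^sup>2) \<partial>M)"
      by (intro nn_integral_liminf) measurable
    also have "\<dots> \<le> ennreal \<epsilon>"
    proof (rule Liminf_le)
      show "eventually (\<lambda>k. (\<integral>\<^sup>+x. ennreal ((f n x - f (r k) x)\<^sup>2) \<partial>M) \<le> ennreal \<epsilon>) sequentially"
        using eventually_ge_at_top[of K]
      proof eventually_elim
        case (elim k)
        have "(\<integral>\<^sup>+x. ennreal ((f n x - f (r k) x)\<^sup>2) \<partial>M) = ennreal (LINT x|M. (f n x - f (r k) x)\<^sup>2)"
          using int by (intro nn_integral_eq_integral) auto
        then show ?case using that[of "r k"] elim r(3)[of k] by (simp add: ennreal_leI)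
      qed
    qed simp
    finally show ?thesis .
  qed
  have diff_L2: "L2_fun M (\<lambda>x. f n x - g x)" and diff_le: "(LINT x|M. (f n x - g x)\<^sup>2) \<le> \<epsilon>"
    if *: "\<And>j. j \<ge> K \<Longrightarrow> (LINT x|M. (f n x - f j x)\<^sup>2) \<le> \<epsilon>" "0 < \<epsilon>" for n \<epsilon> K
  proof -
    have i: "integrable M (\<lambda>x. (f n x - g x)\<^sup>2)"
      using bound[where K = K, OF *(1)] by (intro integrableI_nonneg) (auto intro: le_less_trans)
    then show "L2_fun M (\<lambda>x. f n x - g x)" by (simp add: L2_fun_def)
    have "ennreal (LINT x|M. (f n x - g x)\<^sup>2) \<le> ennreal \<epsilon>"
      using bound[where K = K, OF *(1)] i by (simp add: nn_integral_eq_integral)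
    then show "(LINT x|M. (f n x - g x)\<^sup>2) \<le> \<epsilon>" using *(2) by simp
  qed
  have "L2_fun M g"
  proof -
    obtain K where "\<forall>i\<ge>K. \<forall>j\<ge>K. (LINT x|M. (f i x - f j x)\<^sup>2) \<le> 1" using Cauchy[of 1] by auto
    then have "L2_fun M (\<lambda>x. f K x - g x)" by (intro diff_L2[of K _ 1]) auto
    from L2_fun_diff[OF f[of K] this] show ?thesis by simp
  qed
  moreover have "(\<lambda>n. L2_norm M (\<lambda>x. f n x - g x)) \<longlonglongrightarrow> 0"
  proof (rule LIMSEQ_I)
    fix \<epsilon> :: real assume "0 < \<epsilon>"
    obtain K where K: "\<forall>i\<ge>K. \<forall>j\<ge>K. (LINT x|M. (f i x - f j x)\<^sup>2) \<le> (\<epsilon>/2)\<^sup>2"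
      using Cauchy[of "(\<epsilon>/2)\<^sup>2"] \<open>0 < \<epsilon>\<close> by auto
    have "L2_norm M (\<lambda>x. f n x - g x) \<le> \<epsilon>/2" if "n \<ge> K" for n
      unfolding L2_norm_def
      by (rule real_le_lsqrt) (use diff_le[of K n "(\<epsilon>/2)\<^sup>2"] that K \<open>0 < \<epsilon>\<close> in auto)
    then show "\<exists>no. \<forall>n\<ge>no. norm (L2_norm M (\<lambda>x. f n x - g x) - 0) < \<epsilon>"
    proof (intro exI[of _ K] allI impI)
      fix n assume "K \<le> n"
      then have "L2_norm M (\<lambda>x. f n x - g x) \<le> \<epsilon>/2" by fact
      then show "norm (L2_norm M (\<lambda>x. f n x - g x) - 0) < \<epsilon>"
        using L2_norm_nonneg[of M "\<lambda>x. f n x - g x"] \<open>0 < \<epsilon>\<close> by simp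
    qed
  qed
  ultimately show ?thesis by blast
qed

lemma L2_proj_exists_unique:
  assumes S: "finite S" and L2: "\<And>q. q \<in> span S \<Longrightarrow> L2_fun M q"
    and definite: "\<And>q. q \<in> span S \<Longrightarrow> (LINT x|M. (q x)\<^sup>2) = 0 \<Longrightarrow> q = 0" and g: "L2_fun M g"
  shows "\<exists>!p. p \<in> span S \<and> (\<forall>q\<in>span S. (LINT x|M. (g x - p x) * q x) = 0)"
proof -
  have sub: "span S \<subseteq> {f. L2_fun M f}" using L2 by blast
  have "\<exists>!p. p \<in> span S \<and> (\<forall>q\<in>span S. (LINT x|M. p x * q x) = (LINT x|M. g x * q x))"
  proof (rule riesz_finite_dimensional[OF S psd_form_on_subset[OF psd_form_L2 sub]])
    show "q = 0" if "q \<in> span S" "(LINT x|M. q x * q x) = 0" for q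
      using definite that by (simp add: power2_eq_square)
    show "linear_form_on (span S) (\<lambda>q. LINT x|M. g x * q x)"
      using linear_form_on_subset[OF psd_form_onD(1)[OF psd_form_L2] sub] g by auto
  qed
  moreover have diff: "(LINT x|M. (g x - p x) * q x) = (LINT x|M. g x * q x) - (LINT x|M. p x * q x)"
    if "p \<in> span S" "q \<in> span S" for p q
    using L2_fun_mult_integrable[OF g L2[OF that(2)]] L2_fun_mult_integrable[OF L2 L2, OF that]
    by (simp add: left_diff_distrib)
  ultimately have eq: "(p \<in> span S \<and> (\<forall>q\<in>span S. (LINT x|M. (g x - p x) * q x) = 0)) \<longleftrightarrow>
      (p \<in> span S \<and> (\<forall>q\<in>span S. (LINT x|M. p x * q x) = (LINT x|M. g x * q x)))" for p
    by (intro conj_cong ball_cong refl) (simp only: diff, auto)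
  show ?thesis unfolding eq by fact
qed

lemma L2_proj_in_span:
  assumes "finite S" "\<And>q. q \<in> span S \<Longrightarrow> L2_fun M q"
    "\<And>q. q \<in> span S \<Longrightarrow> (LINT x|M. (q x)\<^sup>2) = 0 \<Longrightarrow> q = 0" "L2_fun M g"
  shows "L2_proj M (span S) g \<in> span S"
  unfolding L2_proj_def using theI'[OF L2_proj_exists_unique[OF assms]] by (rule conjunct1)

lemma L2_proj_null:
  assumes "finite S" "\<And>q. q \<in> span S \<Longrightarrow> L2_fun M q"
    "\<And>q. q \<in> span S \<Longrightarrow> (LINT x|M. (q x)\<^sup>2) = 0 \<Longrightarrow> q = 0" "L2_fun M g" "AE x in M. g x = 0"
  shows "L2_proj M (span S) g = 0"
proof -
  have "(LINT x|M. (g x - 0 x) * q x) = 0" if "q \<in> span S" for q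
  proof -
    have "(LINT x|M. (g x - 0 x) * q x) = (LINT x|M. 0)"
      using assms(5) L2_funD(1)[OF assms(4)] L2_funD(1)[OF assms(2)[OF that]]
      by (intro integral_cong_AE) auto
    then show ?thesis by simp
  qed
  then have "0 \<in> span S \<and> (\<forall>q\<in>span S. (LINT x|M. (g x - 0 x) * q x) = 0)"
    by (simp add: span_zero)
  then show ?thesis
    unfolding L2_proj_def by (intro the1_equality L2_proj_exists_unique assms(1-4))
qed

section \<open>Polynomials\<close>

lemma partial_eq: "(f has_derivative D) (at x) \<Longrightarrow> partial b f x = D b"
  unfolding partial_def using frechet_derivative_at[of f D x] by simp

lemma partial_linear:
  assumes "f differentiable at x" "g differentiable at x"
  shows "partial b (\<lambda>x. r * f x + s * g x) x = r * partial b f x + s * partial b g x"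
proof -
  have "((\<lambda>x. r * f x + s * g x) has_derivative
      (\<lambda>y. r * frechet_derivative f (at x) y + s * frechet_derivative g (at x) y)) (at x)"
    using assms by (auto intro!: derivative_intros simp: frechet_derivative_works)
  from partial_eq[OF this] show ?thesis by (simp add: partial_def)
qed

lemma partial_diff:
  assumes "f differentiable at x" "g differentiable at x"
  shows "partial b (\<lambda>x. f x - g x) x = partial b f x - partial b g x"
  using partial_linear[OF assms, of b 1 "-1"] by simp

lemma real_polynomial_function_partial:
  fixes p :: "'a::euclidean_space \<Rightarrow> real"
  assumes "real_polynomial_function p"
  shows "p differentiable at x" "real_polynomial_function (partial b p)"
proof -
  have "(\<forall>x. p differentiable at x) \<and> real_polynomial_function (partial b p)"
    using assms
  proof induction
    case (linear f)
    have "(f has_derivative f) (at x)" for x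
      using linear bounded_linear_imp_has_derivative by blast
    then have "partial b f = (\<lambda>x. f b)" "\<forall>x. f differentiable at x"
      by (auto simp: partial_eq fun_eq_iff differentiable_def)
    then show ?case by auto
  next
    case (const c)
    have "partial b (\<lambda>x::'a. c) x = 0" for x
      by (rule partial_eq[OF has_derivative_const])
    then have "partial b (\<lambda>x::'a. c) = (\<lambda>x. 0)" by blast
    then show ?case by (auto intro: real_polynomial_function.intros)
  next
    case (add f g)
    have "partial b (\<lambda>x. f x + g x) = (\<lambda>x. partial b f x + partial b g x)"
      using partial_linear[of f _ g b 1 1] add by (simp add: fun_eq_iff)
    then show ?case using add by auto
  next
    case (mult f g)
    have "partial b (\<lambda>x. f x * g x) x = f x * partial b g x + partial b f x * g x" for x
    proof -
      have "(f has_derivative frechet_derivative f (at x)) (at x)"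
        "(g has_derivative frechet_derivative g (at x)) (at x)"
        using mult by (auto simp: frechet_derivative_works)
      from partial_eq[OF has_derivative_mult[OF this]] show ?thesis by (simp add: partial_def)
    qed
    then have "partial b (\<lambda>x. f x * g x) = (\<lambda>x. f x * partial b g x + partial b f x * g x)" by blast
    then show ?case using mult by auto
  qed
  then show "p differentiable at x" "real_polynomial_function (partial b p)" by auto
qed

lemma continuous_on_real_polynomial_function:
  fixes p :: "'a::euclidean_space \<Rightarrow> real"
  assumes "real_polynomial_function p"
  shows "continuous_on A p"
proof -
  have "p differentiable (at x within A)" for x
    using real_polynomial_function_partial(1)[OF assms] by (rule differentiable_at_withinI)
  then have "p differentiable_on A" by (simp add: differentiable_on_def)
  then show ?thesis by (rule differentiable_imp_continuous_on)
qed

lemma laplacian_polynomial: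
  fixes p q :: "'a::euclidean_space \<Rightarrow> real"
  assumes "real_polynomial_function p" "real_polynomial_function q"
  shows "real_polynomial_function (laplacian p)"
    "laplacian (\<lambda>x. r * p x + s * q x) x = r * laplacian p x + s * laplacian q x"
proof -
  have lap: "laplacian f x = (\<Sum>b\<in>Basis. partial b (partial b f) x)" for f and x :: 'a
    by (simp add: laplacian_def iter_partial_def)
  note P = real_polynomial_function_partial
  have "laplacian p = (\<lambda>x. \<Sum>b\<in>Basis. partial b (partial b p) x)" by (auto simp: lap)
  moreover have "real_polynomial_function (\<lambda>x. \<Sum>b\<in>Basis. partial b (partial b p) x)"
    using P(2)[OF P(2)[OF assms(1)]] by (intro real_polynomial_function_sum) auto
  ultimately show "real_polynomial_function (laplacian p)" by simp
  have 1: "partial b (\<lambda>x. r * p x + s * q x) = (\<lambda>x. r * partial b p x + s * partial b q x)" for b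
    using partial_linear P(1) assms by blast
  have "partial b (partial b (\<lambda>x. r * p x + s * q x)) x =
      r * partial b (partial b p) x + s * partial b (partial b q) x" for b
    unfolding 1 using partial_linear P assms by blast
  then show "laplacian (\<lambda>x. r * p x + s * q x) x = r * laplacian p x + s * laplacian q x"
    by (simp add: lap sum.distrib sum_distrib_left)
qed

lemma gradient_polynomial:
  fixes p q :: "'a::euclidean_space \<Rightarrow> real"
  assumes "real_polynomial_function p" "real_polynomial_function q"
  shows "real_polynomial_function (\<lambda>x. gradient p x \<bullet> n)"
    "gradient (\<lambda>x. r * p x + s * q x) x = r *\<^sub>R gradient p x + s *\<^sub>R gradient q x"
proof -
  note P = real_polynomial_function_partial
  have "(\<lambda>x. gradient p x \<bullet> n) = (\<lambda>x. \<Sum>b\<in>Basis. partial b p x * (b \<bullet> n))"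
    by (simp add: gradient_def inner_sum_left)
  moreover have "real_polynomial_function (\<lambda>x. \<Sum>b\<in>Basis. partial b p x * (b \<bullet> n))"
    using P(2)[OF assms(1)] by (intro real_polynomial_function_sum real_polynomial_function.intros(4)) auto
  ultimately show "real_polynomial_function (\<lambda>x. gradient p x \<bullet> n)" by simp
  have "partial b (\<lambda>x. r * p x + s * q x) x = r * partial b p x + s * partial b q x" for b
    using partial_linear P(1) assms by blast
  then show "gradient (\<lambda>x. r * p x + s * q x) x = r *\<^sub>R gradient p x + s *\<^sub>R gradient q x"
    by (simp add: gradient_def scaleR_left_distrib sum.distrib scaleR_sum_right)
qed

text \<open>On every line through a point of the open set, the polynomial is a univariate polynomial with
  infinitely many zeros.\<close>

lemma real_polynomial_function_zero_if_zero_on_open: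
  fixes p :: "'a::euclidean_space \<Rightarrow> real"
  assumes p: "real_polynomial_function p" and S: "open S" "S \<noteq> {}" and zero: "\<And>x. x \<in> S \<Longrightarrow> p x = 0"
  shows "p = (\<lambda>x. 0)"
proof
  fix y
  obtain x where "x \<in> S" using S by blast
  then obtain \<epsilon> where \<epsilon>: "0 < \<epsilon>" "ball x \<epsilon> \<subseteq> S" using S(1) openE by blast
  have "polynomial_function (\<lambda>t::real. x + t *\<^sub>R (y - x))"
    by (intro polynomial_function_add polynomial_function_const polynomial_function_mult[of "\<lambda>t. t" "\<lambda>_. y - x", simplified])
  then have "real_polynomial_function (p \<circ> (\<lambda>t. x + t *\<^sub>R (y - x)))"
    using p by (rule real_polynomial_function_compose)
  then obtain a n where a: "p \<circ> (\<lambda>t. x + t *\<^sub>R (y - x)) = (\<lambda>t. \<Sum>i\<le>n. a i * t ^ i)"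
    by (auto simp: real_polynomial_function_iff_sum)
  \<comment> \<open>adding 1 avoids a division by zero if \<open>y = x\<close>\<close>
  define \<delta> where "\<delta> = \<epsilon> / (1 + norm (y - x))"
  have "0 < \<delta>" using \<epsilon> by (simp add: \<delta>_def add_pos_nonneg)
  have "(\<Sum>i\<le>n. a i * t ^ i) = 0" if "t \<in> {0<..<\<delta>}" for t
  proof -
    have "t * norm (y - x) \<le> t * (1 + norm (y - x))" using that by (intro mult_left_mono) auto
    also have "\<dots> < \<epsilon>" using that by (simp add: \<delta>_def pos_less_divide_eq add_pos_nonneg)
    finally have "x + t *\<^sub>R (y - x) \<in> ball x \<epsilon>" using that by (simp add: dist_norm)
    then show ?thesis using zero \<epsilon> fun_cong[OF a, of t] by auto
  qed
  then have "{0<..<\<delta>} \<subseteq> {t. (\<Sum>i\<le>n. a i * t ^ i) = 0}" by blast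
  moreover have "infinite {0<..<\<delta>}" using \<open>0 < \<delta>\<close> by (simp add: infinite_Ioo)
  ultimately have "infinite {t. (\<Sum>i\<le>n. a i * t ^ i) = 0}" using finite_subset by blast
  then have "\<forall>i\<le>n. a i = 0" using polyfun_rootbound_finite by (metis polyfun_finite_roots)
  then have "(p \<circ> (\<lambda>t. x + t *\<^sub>R (y - x))) 1 = 0" unfolding a by simp
  then show "p y = 0" by simp
qed

definition monomial_functions :: "nat \<Rightarrow> ('a::euclidean_space \<Rightarrow> real) set" where
  "monomial_functions k =
     (\<lambda>\<alpha> x. \<Prod>b\<in>Basis. (x \<bullet> b) ^ \<alpha> b) ` {\<alpha> \<in> Basis \<rightarrow>\<^sub>E {..k}. sum \<alpha> Basis \<le> k}"

lemma finite_exponents: "finite {\<alpha> \<in> (Basis :: 'a::euclidean_space set) \<rightarrow>\<^sub>E {..k}. sum \<alpha> Basis \<le> (k::nat)}"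
proof (rule finite_subset)
  show "finite ((Basis :: 'a set) \<rightarrow>\<^sub>E {..k})" by (intro finite_PiE) auto
qed blast

lemma finite_monomial_functions: "finite (monomial_functions k)"
  unfolding monomial_functions_def by (intro finite_imageI finite_exponents)

lemma poly_space_eq_span: "poly_space k = span (monomial_functions k)"
proof
  define I :: "('a \<Rightarrow> nat) set" where "I = {\<alpha> \<in> Basis \<rightarrow>\<^sub>E {..k}. sum \<alpha> Basis \<le> k}"
  define mon :: "('a \<Rightarrow> nat) \<Rightarrow> 'a \<Rightarrow> real" where "mon \<alpha> x = (\<Prod>b\<in>Basis. (x \<bullet> b) ^ \<alpha> b)" for \<alpha> x
  have I: "finite I" unfolding I_def by (rule finite_exponents)
  have monomials: "monomial_functions k = mon ` I"
    by (simp add: monomial_functions_def I_def mon_def[abs_def])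
  have poly: "poly_space k = {(\<lambda>x. \<Sum>\<alpha>\<in>I. c \<alpha> * mon \<alpha> x) | c. True}"
    by (simp add: poly_space_def I_def mon_def)
  show "poly_space k \<subseteq> span (monomial_functions k :: ('a \<Rightarrow> real) set)"
  proof
    fix p :: "'a \<Rightarrow> real" assume "p \<in> poly_space k"
    then obtain c where "p = (\<lambda>x. \<Sum>\<alpha>\<in>I. c \<alpha> * mon \<alpha> x)" by (auto simp: poly)
    then have "p = (\<Sum>\<alpha>\<in>I. c \<alpha> *\<^sub>R mon \<alpha>)" by (simp add: sum_fun_apply fun_eq_iff)
    also have "\<dots> \<in> span (monomial_functions k)"
      unfolding monomials by (intro span_sum span_scale span_base imageI)
    finally show "p \<in> span (monomial_functions k)" .
  qed
  have "subspace (poly_space k :: ('a \<Rightarrow> real) set)"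
  proof (rule subspaceI)
    show "0 \<in> (poly_space k :: ('a \<Rightarrow> real) set)"
      by (auto simp: poly zero_fun_def intro!: exI[of _ "\<lambda>_. 0"])
  next
    fix p q :: "'a \<Rightarrow> real" assume "p \<in> poly_space k" "q \<in> poly_space k"
    then obtain c d where "p = (\<lambda>x. \<Sum>\<alpha>\<in>I. c \<alpha> * mon \<alpha> x)" "q = (\<lambda>x. \<Sum>\<alpha>\<in>I. d \<alpha> * mon \<alpha> x)"
      by (auto simp: poly)
    then show "p + q \<in> poly_space k"
      by (auto simp: poly plus_fun_def sum.distrib distrib_right intro!: exI[of _ "\<lambda>\<alpha>. c \<alpha> + d \<alpha>"])
  next
    fix p :: "'a \<Rightarrow> real" and r :: real assume "p \<in> poly_space k"
    then obtain c where "p = (\<lambda>x. \<Sum>\<alpha>\<in>I. c \<alpha> * mon \<alpha> x)" by (auto simp: poly)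
    then show "r *\<^sub>R p \<in> poly_space k"
      by (auto simp: poly scaleR_fun_def sum_distrib_left mult.assoc intro!: exI[of _ "\<lambda>\<alpha>. r * c \<alpha>"])
  qed
  moreover have "mon \<beta> \<in> poly_space k" if "\<beta> \<in> I" for \<beta>
  proof -
    have "(\<Sum>\<alpha>\<in>I. (if \<alpha> = \<beta> then 1 else 0) * mon \<alpha> x) = (\<Sum>\<alpha>\<in>I. if \<alpha> = \<beta> then mon \<alpha> x else 0)" for x
      by (intro sum.cong) auto
    then have "mon \<beta> = (\<lambda>x. \<Sum>\<alpha>\<in>I. (if \<alpha> = \<beta> then 1 else 0) * mon \<alpha> x)"
      using that I by (simp add: sum.delta)
    then show ?thesis
      unfolding poly by (intro CollectI exI[of _ "\<lambda>\<alpha>. if \<alpha> = \<beta> then 1 else 0"]) simp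
  qed
  ultimately show "span (monomial_functions k :: ('a \<Rightarrow> real) set) \<subseteq> poly_space k"
    unfolding monomials by (intro span_minimal) auto
qed

lemma poly_space_real_polynomial_function:
  fixes p :: "'a::euclidean_space \<Rightarrow> real"
  shows "p \<in> poly_space k \<Longrightarrow> real_polynomial_function p"
proof -
  assume "p \<in> poly_space k"
  then obtain c where p: "p = (\<lambda>x. \<Sum>\<alpha> | \<alpha> \<in> Basis \<rightarrow>\<^sub>E {..k} \<and> sum \<alpha> Basis \<le> k. c \<alpha> * (\<Prod>b\<in>Basis. (x \<bullet> b) ^ \<alpha> b))"
    by (auto simp: poly_space_def)
  have lin: "real_polynomial_function (\<lambda>x::'a. x \<bullet> b)" for b
    by (intro real_polynomial_function.intros(1) bounded_linear_inner_left)
  have "real_polynomial_function (\<lambda>x::'a. \<Prod>b\<in>Basis. (x \<bullet> b) ^ \<alpha> b)" for \<alpha>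
    using lin by (intro real_polynomial_function_prod real_polynomial_function_power) auto
  then show "real_polynomial_function p"
    unfolding p by (intro real_polynomial_function_sum finite_exponents real_polynomial_function.intros(2,4))
qed

text \<open>Restriction to a face is made a function of its own because, being linear, it maps generators of
  the polynomials to generators of the polynomials on the face.\<close>

definition restrict_fun :: "'a set \<Rightarrow> ('a \<Rightarrow> real) \<Rightarrow> 'a \<Rightarrow> real" where
  "restrict_fun e p = (\<lambda>x. if x \<in> e then p x else 0)"

lemma face_poly_space_eq_span:
  "face_poly_space k e = span (restrict_fun e ` monomial_functions k)"
proof -
  have "linear (restrict_fun e)"
    by (rule linearI) (auto simp: restrict_fun_def fun_eq_iff)
  then have "span (restrict_fun e ` monomial_functions k) = restrict_fun e ` poly_space k"
    by (simp add: linear_span_image poly_space_eq_span)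
  then show ?thesis by (auto simp: face_poly_space_def restrict_fun_def)
qed

lemma continuous_L2_on_compact:
  fixes g :: "'a::euclidean_space \<Rightarrow> real"
  assumes "compact T" "continuous_on T g"
  shows "L2_fun (lebesgue_on T) g"
proof -
  obtain B where B: "\<And>x. x \<in> T \<Longrightarrow> \<bar>g x\<bar> \<le> B"
    using compact_imp_bounded[OF compact_continuous_image[OF assms(2,1)]] by (auto simp: bounded_iff)
  show ?thesis
  proof (rule L2_fun_finite_measure)
    show "finite_measure (lebesgue_on T)"
      using assms(1) by (intro finite_measure_lebesgue_on lmeasurable_compact)
    show "g \<in> borel_measurable (lebesgue_on T)"
      using assms lmeasurable_compact[OF assms(1)] by (intro continuous_imp_measurable_on_sets_lebesgue) auto
    show "AE x in lebesgue_on T. \<bar>g x\<bar> \<le> B" by (intro AE_I2) (simp add: B)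
  qed
qed

lemma polynomial_L2: "compact T \<Longrightarrow> p \<in> poly_space k \<Longrightarrow> L2_fun (lebesgue_on T) p"
  using continuous_L2_on_compact continuous_on_real_polynomial_function poly_space_real_polynomial_function by blast

text \<open>The set of interior points where the polynomial does not vanish is open and null.\<close>

lemma polynomial_L2_definite:
  assumes T: "compact T" "interior T \<noteq> {}" and p: "p \<in> poly_space k"
    and zero: "(LINT x|lebesgue_on T. (p x)\<^sup>2) = 0"
  shows "p = 0"
proof -
  note poly = poly_space_real_polynomial_function[OF p]
  have T_sets: "T \<in> sets lebesgue" using lmeasurable_compact[OF T(1)] by auto
  have "AE x in lebesgue_on T. (p x)\<^sup>2 = 0"
    using zero L2_funD(2)[OF polynomial_L2[OF T(1) p]] by (subst (asm) integral_nonneg_eq_0_iff_AE) auto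
  then have ae: "AE x in lebesgue. x \<in> T \<longrightarrow> p x = 0"
    using T_sets by (subst (asm) AE_restrict_space_iff) auto
  define U where "U = interior T \<inter> {x. p x \<noteq> 0}"
  have U: "open U"
    unfolding U_def using continuous_on_real_polynomial_function[OF poly]
    by (intro open_Int open_interior open_Collect_neq continuous_intros) auto
  have "AE x in lebesgue. x \<notin> U"
    using ae interior_subset[of T] by (auto simp: U_def elim!: eventually_mono)
  then have "U \<in> null_sets lebesgue"
    using U by (subst AE_iff_null_sets) auto
  then have "U = {}" using U open_not_negligible negligible_iff_null_sets by blast
  then have "p = (\<lambda>x. 0)"
    using T(2) by (intro real_polynomial_function_zero_if_zero_on_open[OF poly open_interior[of T]]) (auto simp: U_def)
  then show ?thesis by (simp add: zero_fun_def)
qed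

section \<open>The measure on a face\<close>

definition slab :: "'a::euclidean_space \<Rightarrow> 'a \<Rightarrow> 'a set" where
  "slab n a = {x. 0 \<le> n \<bullet> (x - a) \<and> n \<bullet> (x - a) \<le> 1}"

definition hyperplane_proj :: "'a::euclidean_space \<Rightarrow> 'a \<Rightarrow> 'a \<Rightarrow> 'a" where
  "hyperplane_proj n a x = x - (n \<bullet> (x - a)) *\<^sub>R n"

text \<open>The measure on a face, with the chosen normal and base point as parameters.\<close>

definition prism_measure :: "'a::euclidean_space \<Rightarrow> 'a \<Rightarrow> 'a set \<Rightarrow> 'a measure" where
  "prism_measure n a e =
     restrict_space (distr (restrict_space lborel (slab n a)) borel (hyperplane_proj n a)) e"

lemma face_measure_is_prism_measure:
  assumes "is_unit_normal n0 e" "e \<noteq> {}"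
  obtains n a where "norm n = 1" "a \<in> e" "\<And>x. x \<in> e \<Longrightarrow> n \<bullet> (x - a) = 0"
    "face_measure e = prism_measure n a e"
proof
  define n where "n = (SOME n. is_unit_normal n e)"
  define a where "a = (SOME a. a \<in> e)"
  have n: "is_unit_normal n e" unfolding n_def using assms(1) by (rule someI)
  show a: "a \<in> e" unfolding a_def using assms(2) by (simp add: some_in_eq)
  show "norm n = 1" "\<And>x. x \<in> e \<Longrightarrow> n \<bullet> (x - a) = 0"
    using n a by (auto simp: is_unit_normal_def)
  show "face_measure e = prism_measure n a e"
    by (simp add: face_measure_def prism_measure_def slab_def hyperplane_proj_def[abs_def] n_def a_def Let_def)
qed

lemma slab_measurable [measurable]: "slab n a \<in> sets borel"
  unfolding slab_def by measurable

lemma hyperplane_proj_measurable [measurable]: "hyperplane_proj n a \<in> borel_measurable borel"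
  unfolding hyperplane_proj_def[abs_def] by measurable

lemma space_prism_measure: "space (prism_measure n a e) = e"
  by (simp add: prism_measure_def space_restrict_space)

lemma sets_prism_measure: "sets (prism_measure n a e) = sets (restrict_space borel e)"
  unfolding prism_measure_def by (intro sets_restrict_space_cong) simp

lemma nn_integral_prism_measure:
  fixes h :: "'a::euclidean_space \<Rightarrow> ennreal"
  assumes [measurable]: "h \<in> borel_measurable borel" "e \<in> sets borel"
  shows "(\<integral>\<^sup>+x. h x \<partial>prism_measure n a e) =
    (\<integral>\<^sup>+x. h (hyperplane_proj n a x) * indicator e (hyperplane_proj n a x) * indicator (slab n a) x \<partial>lborel)"
proof -
  have [measurable]: "hyperplane_proj n a \<in> restrict_space lborel (slab n a) \<rightarrow>\<^sub>M borel"
    by (intro measurable_restrict_space1) simp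
  have "(\<integral>\<^sup>+x. h x \<partial>prism_measure n a e) =
    (\<integral>\<^sup>+x. h x * indicator e x \<partial>distr (restrict_space lborel (slab n a)) borel (hyperplane_proj n a))"
    unfolding prism_measure_def by (subst nn_integral_restrict_space) simp_all
  also have "\<dots> = (\<integral>\<^sup>+x. h (hyperplane_proj n a x) * indicator e (hyperplane_proj n a x) \<partial>restrict_space lborel (slab n a))"
    by (subst nn_integral_distr) simp_all
  also have "\<dots> = (\<integral>\<^sup>+x. h (hyperplane_proj n a x) * indicator e (hyperplane_proj n a x) * indicator (slab n a) x \<partial>lborel)"
    by (subst nn_integral_restrict_space) simp_all
  finally show ?thesis .
qed

text \<open>The prism of height 1 over a bounded face is bounded.\<close>

lemma finite_prism_measure:
  fixes n a :: "'a::euclidean_space"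
  assumes "norm n = 1" "compact e"
  shows "finite_measure (prism_measure n a e)"
proof (rule finite_measureI)
  have [measurable]: "e \<in> sets borel" using assms(2) compact_imp_closed borel_closed by blast
  obtain B where B: "\<And>x. x \<in> e \<Longrightarrow> norm x \<le> B"
    using compact_imp_bounded[OF assms(2)] by (auto simp: bounded_iff)
  have "emeasure (prism_measure n a e) (space (prism_measure n a e)) = (\<integral>\<^sup>+x. 1 \<partial>prism_measure n a e)"
    by simp
  also have "\<dots> = (\<integral>\<^sup>+x. indicator e (hyperplane_proj n a x) * indicator (slab n a) x \<partial>lborel)"
    by (subst nn_integral_prism_measure) simp_all
  also have "\<dots> \<le> (\<integral>\<^sup>+x. indicator (cball (0::'a) (B + 1)) x \<partial>lborel)"
  proof (intro nn_integral_mono)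
    fix x :: 'a
    have "norm x \<le> B + 1" if "hyperplane_proj n a x \<in> e" "x \<in> slab n a"
    proof -
      have "x = hyperplane_proj n a x + (n \<bullet> (x - a)) *\<^sub>R n" by (simp add: hyperplane_proj_def)
      then have "norm x \<le> norm (hyperplane_proj n a x) + norm ((n \<bullet> (x - a)) *\<^sub>R n)"
        by (metis norm_triangle_ineq)
      also have "norm ((n \<bullet> (x - a)) *\<^sub>R n) \<le> 1" using that assms(1) by (simp add: slab_def)
      finally show ?thesis using B[OF that(1)] by simp
    qed
    then show "(indicator e (hyperplane_proj n a x) * indicator (slab n a) x :: ennreal) \<le> indicator (cball 0 (B + 1)) x"
      by (auto simp: indicator_def)
  qed
  also have "\<dots> = emeasure lborel (cball (0::'a) (B + 1))" by simp
  also have "\<dots> < \<infinity>" using emeasure_lborel_cball_finite[of "0::'a" "B + 1"] by simp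
  finally show "emeasure (prism_measure n a e) (space (prism_measure n a e)) \<noteq> \<infinity>" by simp
qed

lemma continuous_L2_on_prism:
  fixes n a :: "'a::euclidean_space"
  assumes "norm n = 1" "compact e" "continuous_on e g"
  shows "L2_fun (prism_measure n a e) g"
proof -
  obtain B where B: "\<And>x. x \<in> e \<Longrightarrow> \<bar>g x\<bar> \<le> B"
    using compact_imp_bounded[OF compact_continuous_image[OF assms(3,2)]] by (auto simp: bounded_iff)
  show ?thesis
  proof (rule L2_fun_finite_measure[OF finite_prism_measure[OF assms(1,2)]])
    show "g \<in> borel_measurable (prism_measure n a e)"
      using borel_measurable_continuous_on_restrict[OF assms(3)]
      by (simp add: measurable_cong_sets[OF sets_prism_measure refl])
    show "AE x in prism_measure n a e. \<bar>g x\<bar> \<le> B"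
      by (intro AE_I2) (simp add: B space_prism_measure)
  qed
qed

text \<open>Over a relatively open part of the face where the function does not vanish there is a nonempty
  open part of the prism.\<close>

lemma prism_measure_zero_on_polytope:
  fixes n a :: "'a::euclidean_space" and p :: "'a \<Rightarrow> real"
  assumes n: "norm n = 1" "a \<in> e" "\<And>x. x \<in> e \<Longrightarrow> n \<bullet> (x - a) = 0" and e: "compact e"
    and q: "polytope q" "aff_dim q = int DIM('a) - 1" "q \<subseteq> e"
    and p: "continuous_on UNIV p" "(LINT x|prism_measure n a e. (p x)\<^sup>2) = 0" and z: "z \<in> q"
  shows "p z = 0"
proof -
  have [measurable]: "e \<in> sets borel" using e compact_imp_closed borel_closed by blast
  have [measurable]: "p \<in> borel_measurable borel" using p(1) by (rule borel_measurable_continuous_onI)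
  have L2: "L2_fun (prism_measure n a e) p"
    using continuous_on_subset[OF p(1)] by (intro continuous_L2_on_prism n e) auto
  have "(\<integral>\<^sup>+x. ennreal ((p x)\<^sup>2) \<partial>prism_measure n a e) = 0"
    using p(2) nn_integral_eq_integral[OF L2_funD(2)[OF L2]] by simp
  then have "(\<integral>\<^sup>+x. ennreal ((p (hyperplane_proj n a x))\<^sup>2) * indicator e (hyperplane_proj n a x) * indicator (slab n a) x \<partial>lborel) = 0"
    by (subst (asm) nn_integral_prism_measure) simp_all
  then have ae: "AE x in lborel. ennreal ((p (hyperplane_proj n a x))\<^sup>2) * indicator e (hyperplane_proj n a x) * indicator (slab n a) x = 0"
    by (subst (asm) nn_integral_0_iff_AE) simp_all
  have q_sub: "q \<subseteq> {x. n \<bullet> x = n \<bullet> a}" using n(3) q(3) by (auto simp: inner_diff_right)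
  have "q \<noteq> {}" using z by blast
  have "n \<noteq> 0" using n(1) by auto
  have hull: "affine hull q = {x. n \<bullet> x = n \<bullet> a}"
  proof (rule affine_dim_equal)
    show "affine hull q \<subseteq> {x. n \<bullet> x = n \<bullet> a}"
      using q_sub by (intro hull_minimal affine_hyperplane)
    show "aff_dim (affine hull q) = aff_dim {x. n \<bullet> x = n \<bullet> a}"
      using q(2) \<open>n \<noteq> 0\<close> by (simp add: aff_dim_hyperplane)
  qed (use \<open>q \<noteq> {}\<close> affine_hyperplane in auto)
  have zero: "p y = 0" if y: "y \<in> rel_interior q" for y
  proof (rule ccontr)
    assume "p y \<noteq> 0"
    obtain \<epsilon> where \<epsilon>: "0 < \<epsilon>" "ball y \<epsilon> \<inter> affine hull q \<subseteq> q"
      using y by (auto simp: mem_rel_interior_ball)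
    \<comment> \<open>the part of the open prism over the points near \<open>y\<close> where \<open>p\<close> is not zero\<close>
    define W where "W = {x. hyperplane_proj n a x \<in> ball y \<epsilon> \<and> p (hyperplane_proj n a x) \<noteq> 0 \<and>
      0 < n \<bullet> (x - a) \<and> n \<bullet> (x - a) < 1}"
    have cont: "continuous_on UNIV (hyperplane_proj n a)"
      unfolding hyperplane_proj_def[abs_def] by (intro continuous_intros)
    have "W = (hyperplane_proj n a -` ball y \<epsilon>) \<inter> {x. p (hyperplane_proj n a x) \<noteq> 0} \<inter>
        {x. 0 < n \<bullet> (x - a)} \<inter> {x. n \<bullet> (x - a) < 1}"
      by (auto simp: W_def)
    then have "open W"
      by (simp only:) (intro open_Int open_vimage open_Collect_neq open_Collect_less cont
          continuous_on_compose2[OF p(1) cont] continuous_intros; simp)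
    have "y \<in> q" using y rel_interior_subset by blast
    then have ny: "n \<bullet> (y - a) = 0" using n(3) q(3) by blast
    have nn: "n \<bullet> n = 1" using n(1) by (simp add: norm_eq_1)
    have s: "n \<bullet> (y + (1/2) *\<^sub>R n - a) = 1/2"
      using ny nn by (simp add: inner_diff_right inner_add_right)
    have "hyperplane_proj n a (y + (1/2) *\<^sub>R n) = y"
      unfolding hyperplane_proj_def s by simp
    then have "y + (1/2) *\<^sub>R n \<in> W"
      using s \<open>p y \<noteq> 0\<close> \<epsilon> by (simp add: W_def)
    have "AE x in lborel. x \<notin> W"
      using ae
    proof eventually_elim
      case (elim x)
      show ?case
      proof
        assume x: "x \<in> W"
        have "n \<bullet> hyperplane_proj n a x = n \<bullet> a"
          using nn by (simp add: hyperplane_proj_def inner_diff_right)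
        then have "hyperplane_proj n a x \<in> q" using x \<epsilon>(2) hull by (auto simp: W_def)
        then show False using elim x q(3) by (auto simp: W_def slab_def)
      qed
    qed
    then have "W \<in> null_sets lborel"
      using \<open>open W\<close> by (subst AE_iff_null_sets) auto
    then have "negligible W" by (simp add: negligible_iff_null_sets null_sets_completionI)
    then show False using open_not_negligible[OF \<open>open W\<close>] \<open>y + (1/2) *\<^sub>R n \<in> W\<close> by blast
  qed
  have "closed {x. p x = 0}" using p(1) by (intro closed_Collect_eq) auto
  then have "closure (rel_interior q) \<subseteq> {x. p x = 0}" using zero by (intro closure_minimal) auto
  moreover have "closure (rel_interior q) = q"
    using q(1) by (simp add: convex_closure_rel_interior polytope_imp_convex polytope_imp_closed)
  ultimately show ?thesis using z by blast
qed

section \<open>The trace inequality\<close>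

text \<open>This is the Cauchy-Schwarz inequality on \<open>[0,s]\<close> together with \<open>s \<le> 1\<close>; extended real values
  spare the integrability of the right-hand side when it is inserted into Tonelli's theorem.\<close>

lemma square_increment_le_integral:
  fixes F f :: "real \<Rightarrow> real"
  assumes der: "\<And>t. (F has_real_derivative f t) (at t)" and cont: "continuous_on UNIV f" and s: "0 \<le> s" "s \<le> 1"
  shows "ennreal ((F s - F 0)\<^sup>2) \<le> (\<integral>\<^sup>+t. ennreal ((f t)\<^sup>2) * indicator {0..1} t \<partial>lborel)"
proof -
  have [measurable]: "f \<in> borel_measurable borel" using cont by (rule borel_measurable_continuous_onI)
  define u v where "u = (indicator {0..s} :: real \<Rightarrow> real)" and "v = (\<lambda>t. f t * indicator {0..1} t)"
  have u: "L2_fun lborel u"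
    using s by (auto simp: L2_fun_def u_def power2_eq_square indicator_inter_arith[symmetric])
  have "set_integrable lborel {0..1} (\<lambda>t. (f t)\<^sup>2)"
    using cont by (intro borel_integrable_atLeastAtMost' continuous_intros) (auto intro: continuous_on_subset)
  moreover have "(v t)\<^sup>2 = indicator {0..1} t *\<^sub>R (f t)\<^sup>2" for t
    by (simp add: v_def power_mult_distrib indicator_def)
  ultimately have v: "L2_fun lborel v"
    unfolding L2_fun_def set_integrable_def by (simp add: v_def)
  have "(LINT t|lborel. f t * indicator {0..s} t) = F s - F 0"
    using s cont der by (intro integral_FTC_Icc_real) (auto simp: continuous_on_eq_continuous_at)
  also have "(\<lambda>t. f t * indicator {0..s} t) = (\<lambda>t. u t * v t)"
    using s by (auto simp: u_def v_def indicator_def fun_eq_iff)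
  finally have eq: "(LINT t|lborel. u t * v t) = F s - F 0" .
  have "(F s - F 0)\<^sup>2 \<le> (LINT t|lborel. u t * u t) * (LINT t|lborel. v t * v t)"
    using psd_form_on_Cauchy_Schwarz[OF psd_form_L2 subspace_L2] u v unfolding eq[symmetric] by simp
  also have "(LINT t|lborel. u t * u t) = s"
    using s by (simp add: u_def indicator_inter_arith[symmetric])
  also have "s * (LINT t|lborel. v t * v t) \<le> 1 * (LINT t|lborel. v t * v t)"
    using s by (intro mult_right_mono integral_nonneg_AE) auto
  finally have "ennreal ((F s - F 0)\<^sup>2) \<le> ennreal (LINT t|lborel. (v t)\<^sup>2)"
    by (intro ennreal_leI) (simp add: power2_eq_square)
  also have "\<dots> = (\<integral>\<^sup>+t. ennreal ((v t)\<^sup>2) \<partial>lborel)"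
    using L2_funD(2)[OF v] by (intro nn_integral_eq_integral[symmetric]) auto
  also have "\<dots> = (\<integral>\<^sup>+t. ennreal ((f t)\<^sup>2) * indicator {0..1} t \<partial>lborel)"
    by (intro nn_integral_cong) (auto simp: v_def indicator_def)
  finally show ?thesis .
qed

lemma nn_integral_lborel_translate:
  fixes h :: "'a::euclidean_space \<Rightarrow> ennreal"
  assumes [measurable]: "h \<in> borel_measurable borel"
  shows "(\<integral>\<^sup>+x. h (c + x) \<partial>lborel) = (\<integral>\<^sup>+x. h x \<partial>lborel)"
proof -
  have "(\<integral>\<^sup>+x. h x \<partial>lborel) = (\<integral>\<^sup>+x. h x \<partial>distr lborel borel ((+) c))"
    by (simp add: lborel_distr_plus)
  also have "\<dots> = (\<integral>\<^sup>+x. h (c + x) \<partial>lborel)"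
    by (subst nn_integral_distr) simp_all
  finally show ?thesis by simp
qed

text \<open>The normal segment through \<open>x\<close> consists of points \<open>x + t n\<close>. After an exchange of the integrals
  and a translation by \<open>t n\<close> the inner integral is the length of a unit interval. In this way the
  translation invariance of the Lebesgue measure and Tonelli's theorem replace coordinates adapted
  to the hyperplane.\<close>

lemma nn_integral_slab_average:
  fixes n a :: "'a::euclidean_space" and h :: "'a \<Rightarrow> ennreal"
  assumes [measurable]: "h \<in> borel_measurable borel" and n: "norm n = 1"
  shows "(\<integral>\<^sup>+x. (\<integral>\<^sup>+t. h (hyperplane_proj n a x + t *\<^sub>R n) * indicator {0..1} t \<partial>lborel) * indicator (slab n a) x \<partial>lborel)
    = (\<integral>\<^sup>+x. h x * indicator (slab n a) x \<partial>lborel)"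
proof -
  define s where "s x = n \<bullet> (x - a)" for x
  have [measurable]: "s \<in> borel_measurable borel" unfolding s_def[abs_def] by measurable
  have nn: "n \<bullet> n = 1" using n by (simp add: norm_eq_1)
  have slab: "indicator (slab n a) x = (indicator {0..1} (s x) :: ennreal)" for x
    by (auto simp: slab_def s_def indicator_def)
  have inner: "(\<integral>\<^sup>+t. h (hyperplane_proj n a x + t *\<^sub>R n) * indicator {0..1} t \<partial>lborel)
    = (\<integral>\<^sup>+t. h (x + t *\<^sub>R n) * indicator {0..1} (s x + t) \<partial>lborel)" for x
    by (subst nn_integral_lborel_translate[where c = "s x", symmetric])
      (simp_all add: hyperplane_proj_def s_def scaleR_left_distrib)
  have "(\<integral>\<^sup>+x. (\<integral>\<^sup>+t. h (hyperplane_proj n a x + t *\<^sub>R n) * indicator {0..1} t \<partial>lborel) * indicator (slab n a) x \<partial>lborel)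
    = (\<integral>\<^sup>+x. (\<integral>\<^sup>+t. h (x + t *\<^sub>R n) * indicator {0..1} (s x + t) * indicator {0..1} (s x) \<partial>lborel) \<partial>lborel)"
    unfolding inner slab by (intro nn_integral_cong nn_integral_multc[symmetric]) simp
  also have "\<dots> = (\<integral>\<^sup>+t. (\<integral>\<^sup>+x. h (x + t *\<^sub>R n) * indicator {0..1} (s x + t) * indicator {0..1} (s x) \<partial>lborel) \<partial>lborel)"
    by (rule lborel_pair.Fubini') measurable
  also have "\<dots> = (\<integral>\<^sup>+t. (\<integral>\<^sup>+x. h x * indicator {0..1} (s x) * indicator {0..1} (s x - t) \<partial>lborel) \<partial>lborel)"
  proof (rule nn_integral_cong)
    fix t :: real
    have "s (- (t *\<^sub>R n) + x) = s x - t" for x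
      using nn by (simp add: s_def inner_diff_right inner_add_right)
    then show "(\<integral>\<^sup>+x. h (x + t *\<^sub>R n) * indicator {0..1} (s x + t) * indicator {0..1} (s x) \<partial>lborel)
      = (\<integral>\<^sup>+x. h x * indicator {0..1} (s x) * indicator {0..1} (s x - t) \<partial>lborel)"
      by (subst nn_integral_lborel_translate[where c = "- (t *\<^sub>R n)", symmetric]) simp_all
  qed
  also have "\<dots> = (\<integral>\<^sup>+x. (\<integral>\<^sup>+t. h x * indicator {0..1} (s x) * indicator {0..1} (s x - t) \<partial>lborel) \<partial>lborel)"
    by (rule lborel_pair.Fubini'[symmetric]) measurable
  also have "\<dots> = (\<integral>\<^sup>+x. h x * indicator {0..1} (s x) \<partial>lborel)"
  proof (rule nn_integral_cong)
    fix x :: 'a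
    have "(\<integral>\<^sup>+t. indicator {0..1} (s x - t) \<partial>lborel) = (\<integral>\<^sup>+t. indicator {s x - 1..s x} t \<partial>lborel)"
      by (intro nn_integral_cong) (auto simp: indicator_def)
    also have "\<dots> = 1" by simp
    finally show "(\<integral>\<^sup>+t. h x * indicator {0..1} (s x) * indicator {0..1} (s x - t) \<partial>lborel) = h x * indicator {0..1} (s x)"
      by (subst nn_integral_cmult) simp_all
  qed
  finally show ?thesis by (simp add: slab)
qed

text \<open>Along the normal segment over a point \<open>z\<close> of the face, \<open>g(z)\<close> differs from the value of \<open>g\<close> at
  any other point of the segment by the integral of its normal derivative. Squaring this and averaging
  over the segments leaves integrals over the slab only.\<close>

lemma trace_inequality:
  fixes n a :: "'a::euclidean_space"
  assumes g: "\<And>x. g differentiable at x" "\<And>b. b \<in> Basis \<Longrightarrow> continuous_on UNIV (partial b g)"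
    and n: "norm n = 1" and [measurable]: "e \<in> sets borel"
  shows "(\<integral>\<^sup>+x. ennreal ((g x)\<^sup>2) \<partial>prism_measure n a e) \<le>
    2 * (\<integral>\<^sup>+x. ennreal ((g x)\<^sup>2) \<partial>lborel) + 2 * (\<Sum>b\<in>Basis. \<integral>\<^sup>+x. ennreal ((partial b g x)\<^sup>2) \<partial>lborel)"
proof -
  have "continuous_on UNIV g"
    using g(1) by (intro differentiable_imp_continuous_on) (simp add: differentiable_on_def)
  then have [measurable]: "g \<in> borel_measurable borel" by (rule borel_measurable_continuous_onI)
  have [measurable]: "partial b g \<in> borel_measurable borel" if "b \<in> Basis" for b
    using g(2)[OF that] by (rule borel_measurable_continuous_onI)
  define D where "D x = (\<Sum>b\<in>Basis. partial b g x * (n \<bullet> b))" for x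
  have D_cont: "continuous_on UNIV D" unfolding D_def[abs_def] using g(2) by (intro continuous_intros)
  then have [measurable]: "D \<in> borel_measurable borel" by (rule borel_measurable_continuous_onI)
  have D: "frechet_derivative g (at x) n = D x" for x
  proof -
    have lin: "linear (frechet_derivative g (at x))"
      using g(1) frechet_derivative_works has_derivative_linear by blast
    have "frechet_derivative g (at x) n = frechet_derivative g (at x) (\<Sum>b\<in>Basis. (n \<bullet> b) *\<^sub>R b)"
      by (simp add: euclidean_representation)
    then show ?thesis
      by (simp add: linear_sum[OF lin] linear_cmul[OF lin] D_def partial_def mult.commute)
  qed
  have D_le: "(D x)\<^sup>2 \<le> (\<Sum>b\<in>Basis. (partial b g x)\<^sup>2)" for x
  proof -
    have "(D x)\<^sup>2 \<le> (\<Sum>b\<in>Basis. (partial b g x)\<^sup>2) * (\<Sum>b\<in>Basis. (n \<bullet> b)\<^sup>2)"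
      unfolding D_def by (rule Cauchy_Schwarz_ineq_sum)
    also have "(\<Sum>b\<in>Basis. (n \<bullet> b)\<^sup>2) = 1"
      using n by (simp add: power2_eq_square euclidean_inner[symmetric] norm_eq_1)
    finally show ?thesis by simp
  qed
  have along: "ennreal ((g (hyperplane_proj n a x))\<^sup>2) \<le> 2 * ennreal ((g x)\<^sup>2) +
      2 * (\<integral>\<^sup>+t. ennreal ((D (hyperplane_proj n a x + t *\<^sub>R n))\<^sup>2) * indicator {0..1} t \<partial>lborel)"
    if x: "x \<in> slab n a" for x
  proof -
    define z where "z = hyperplane_proj n a x"
    define s where "s = n \<bullet> (x - a)"
    have s: "0 \<le> s" "s \<le> 1" using x by (auto simp: slab_def s_def)
    have zx: "x = z + s *\<^sub>R n" by (simp add: z_def s_def hyperplane_proj_def)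
    have der: "((\<lambda>t. g (z + t *\<^sub>R n)) has_real_derivative D (z + t *\<^sub>R n)) (at t)" for t
    proof -
      have "((\<lambda>t. z + t *\<^sub>R n) has_derivative (\<lambda>t. t *\<^sub>R n)) (at t)"
        by (auto intro!: derivative_eq_intros)
      moreover have "(g has_derivative frechet_derivative g (at (z + t *\<^sub>R n))) (at (z + t *\<^sub>R n))"
        using g(1) frechet_derivative_works by blast
      ultimately have "(g \<circ> (\<lambda>t. z + t *\<^sub>R n) has_derivative
          frechet_derivative g (at (z + t *\<^sub>R n)) \<circ> (\<lambda>t. t *\<^sub>R n)) (at t)"
        by (rule diff_chain_at)
      moreover have "frechet_derivative g (at (z + t *\<^sub>R n)) (r *\<^sub>R n) = D (z + t *\<^sub>R n) * r" for r
        using linear_cmul[OF has_derivative_linear, OF frechet_derivative_works[THEN iffD1, OF g(1)]]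
        by (simp add: D mult.commute)
      ultimately show ?thesis
        by (simp add: has_field_derivative_def o_def)
    qed
    have "continuous_on UNIV (\<lambda>t. D (z + t *\<^sub>R n))"
      by (intro continuous_on_compose2[OF D_cont] continuous_intros) auto
    from square_increment_le_integral[OF der this s]
    have incr: "ennreal ((g x - g z)\<^sup>2) \<le> (\<integral>\<^sup>+t. ennreal ((D (z + t *\<^sub>R n))\<^sup>2) * indicator {0..1} t \<partial>lborel)"
      by (simp add: zx)
    have "(g z)\<^sup>2 \<le> 2 * (g x)\<^sup>2 + 2 * (g x - g z)\<^sup>2"
      using square_diff_bound[of "g z" 0 "g x"] by (simp add: power2_commute)
    then have "ennreal ((g z)\<^sup>2) \<le> ennreal (2 * (g x)\<^sup>2 + 2 * (g x - g z)\<^sup>2)" by (rule ennreal_leI)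
    also have "\<dots> = 2 * ennreal ((g x)\<^sup>2) + 2 * ennreal ((g x - g z)\<^sup>2)"
      by (simp add: ennreal_plus ennreal_mult)
    also have "\<dots> \<le> 2 * ennreal ((g x)\<^sup>2) +
        2 * (\<integral>\<^sup>+t. ennreal ((D (z + t *\<^sub>R n))\<^sup>2) * indicator {0..1} t \<partial>lborel)"
      by (intro add_left_mono mult_left_mono incr) simp
    finally show ?thesis by (simp add: z_def)
  qed
  have "(\<integral>\<^sup>+x. ennreal ((g x)\<^sup>2) \<partial>prism_measure n a e) =
    (\<integral>\<^sup>+x. ennreal ((g (hyperplane_proj n a x))\<^sup>2) * indicator e (hyperplane_proj n a x) * indicator (slab n a) x \<partial>lborel)"
    by (subst nn_integral_prism_measure) simp_all
  also have "\<dots> \<le> (\<integral>\<^sup>+x. 2 * ennreal ((g x)\<^sup>2) +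
      2 * ((\<integral>\<^sup>+t. ennreal ((D (hyperplane_proj n a x + t *\<^sub>R n))\<^sup>2) * indicator {0..1} t \<partial>lborel) * indicator (slab n a) x) \<partial>lborel)"
    using along by (intro nn_integral_mono) (auto simp: indicator_def)
  also have "\<dots> = 2 * (\<integral>\<^sup>+x. ennreal ((g x)\<^sup>2) \<partial>lborel) +
      2 * (\<integral>\<^sup>+x. (\<integral>\<^sup>+t. ennreal ((D (hyperplane_proj n a x + t *\<^sub>R n))\<^sup>2) * indicator {0..1} t \<partial>lborel) * indicator (slab n a) x \<partial>lborel)"
    by (subst nn_integral_add) (simp_all add: nn_integral_cmult)
  also have "(\<integral>\<^sup>+x. (\<integral>\<^sup>+t. ennreal ((D (hyperplane_proj n a x + t *\<^sub>R n))\<^sup>2) * indicator {0..1} t \<partial>lborel) * indicator (slab n a) x \<partial>lborel)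
      = (\<integral>\<^sup>+x. ennreal ((D x)\<^sup>2) * indicator (slab n a) x \<partial>lborel)"
    by (rule nn_integral_slab_average[OF _ n]) measurable
  also have "\<dots> \<le> (\<integral>\<^sup>+x. (\<Sum>b\<in>Basis. ennreal ((partial b g x)\<^sup>2)) \<partial>lborel)"
    using D_le by (intro nn_integral_mono) (auto simp: indicator_def sum_ennreal intro: ennreal_leI)
  also have "\<dots> = (\<Sum>b\<in>Basis. \<integral>\<^sup>+x. ennreal ((partial b g x)\<^sup>2) \<partial>lborel)"
    by (rule nn_integral_sum) simp
  finally show ?thesis by (simp add: add_left_mono mult_left_mono)
qed

section \<open>Traces on faces\<close>

lemma iter_partial_Cons: "iter_partial (b # bs) f = partial b (iter_partial bs f)"
  by (simp add: iter_partial_def)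

lemma iter_partial_Nil: "iter_partial [] f = f"
  by (simp add: iter_partial_def)

lemma test_function_smooth:
  assumes "test_function S \<phi>" "set bs \<subseteq> Basis"
  shows "iter_partial bs \<phi> differentiable at x" "continuous_on A (iter_partial bs \<phi>)"
proof -
  have *: "iter_partial bs \<phi> differentiable_on UNIV" using assms by (auto simp: test_function_def)
  then show "iter_partial bs \<phi> differentiable at x" by (simp add: differentiable_on_def)
  show "continuous_on A (iter_partial bs \<phi>)"
    using differentiable_imp_continuous_on[OF *] continuous_on_subset by blast
qed

lemma test_function_support:
  assumes "test_function S \<phi>"
  obtains K where "compact K" "K \<subseteq> S" "\<And>bs x. x \<notin> K \<Longrightarrow> iter_partial bs \<phi> x = 0"
proof -
  obtain K where K: "compact K" "K \<subseteq> S" "\<And>x. x \<notin> K \<Longrightarrow> \<phi> x = 0"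
    using assms by (auto simp: test_function_def)
  have "\<forall>x. x \<notin> K \<longrightarrow> iter_partial bs \<phi> x = 0" for bs
  proof (induction bs)
    case Nil then show ?case using K by (simp add: iter_partial_Nil)
  next
    case (Cons b bs)
    show ?case
    proof (intro allI impI)
      fix x assume "x \<notin> K"
      have "((\<lambda>x. 0::real) has_derivative (\<lambda>_. 0)) (at x)" by simp
      then have "(iter_partial bs \<phi> has_derivative (\<lambda>_. 0)) (at x)"
        by (rule has_derivative_transform_within_open[of _ _ _ _ "- K"])
          (use K(1) Cons \<open>x \<notin> K\<close> compact_imp_closed in auto)
      then show "iter_partial (b # bs) \<phi> x = 0" by (simp add: iter_partial_Cons partial_eq)
    qed
  qed
  then show thesis using that K by blast
qed

text \<open>Convergence of test functions is measured over the domain, the trace inequality integrates over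
  the whole space; for functions supported in the domain both integrals agree.\<close>

lemma compactly_supported_square_integral:
  fixes g :: "'a::euclidean_space \<Rightarrow> real"
  assumes g: "continuous_on UNIV g" and K: "compact K" "K \<subseteq> S" "\<And>x. x \<notin> K \<Longrightarrow> g x = 0"
    and S: "S \<in> sets lebesgue"
  shows "L2_fun (lebesgue_on S) g"
    "(\<integral>\<^sup>+x. ennreal ((g x)\<^sup>2) \<partial>lborel) = ennreal (LINT x|lebesgue_on S. (g x)\<^sup>2)"
proof -
  have K_sets: "K \<in> sets lebesgue" using lmeasurable_compact[OF K(1)] by auto
  have [measurable]: "g \<in> borel_measurable borel" using g by (rule borel_measurable_continuous_onI)
  have "integrable (lebesgue_on K) (\<lambda>x. (g x)\<^sup>2)"
    using continuous_L2_on_compact[OF K(1) continuous_on_subset[OF g]] by (auto simp: L2_fun_def)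
  then have "integrable lebesgue (\<lambda>x. indicator K x *\<^sub>R (g x)\<^sup>2)"
    using K_sets by (subst (asm) integrable_restrict_space) auto
  also have "(\<lambda>x. indicator K x *\<^sub>R (g x)\<^sup>2) = (\<lambda>x. indicator S x *\<^sub>R (g x)\<^sup>2)"
    using K by (auto simp: fun_eq_iff indicator_def)
  finally have int: "integrable (lebesgue_on S) (\<lambda>x. (g x)\<^sup>2)"
    using S by (subst integrable_restrict_space) auto
  moreover have "g \<in> borel_measurable (lebesgue_on S)"
    by (intro measurable_restrict_space1 measurable_completion) simp
  ultimately show "L2_fun (lebesgue_on S) g" by (simp add: L2_fun_def)
  have "(\<integral>\<^sup>+x. ennreal ((g x)\<^sup>2) \<partial>lborel) = (\<integral>\<^sup>+x. ennreal ((g x)\<^sup>2) \<partial>lebesgue)"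
    by (simp add: nn_integral_completion)
  also have "\<dots> = (\<integral>\<^sup>+x. ennreal ((g x)\<^sup>2) * indicator S x \<partial>lebesgue)"
    using K by (intro nn_integral_cong) (auto simp: indicator_def)
  also have "\<dots> = (\<integral>\<^sup>+x. ennreal ((g x)\<^sup>2) \<partial>lebesgue_on S)"
    using S by (subst nn_integral_restrict_space) auto
  also have "\<dots> = ennreal (LINT x|lebesgue_on S. (g x)\<^sup>2)"
    using int by (intro nn_integral_eq_integral) auto
  finally show "(\<integral>\<^sup>+x. ennreal ((g x)\<^sup>2) \<partial>lborel) = ennreal (LINT x|lebesgue_on S. (g x)\<^sup>2)" .
qed

lemma L2_norm_square_diff_bound:
  assumes "L2_fun M f" "L2_fun M g" "L2_fun M h"
  shows "(LINT x|M. (f x - g x)\<^sup>2) \<le> 2 * (L2_norm M (\<lambda>x. f x - h x))\<^sup>2 + 2 * (L2_norm M (\<lambda>x. g x - h x))\<^sup>2"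
proof -
  note int = L2_funD(2)[OF L2_fun_diff[OF assms(1,2)]] L2_funD(2)[OF L2_fun_diff[OF assms(1,3)]]
    L2_funD(2)[OF L2_fun_diff[OF assms(2,3)]]
  have "(LINT x|M. (f x - g x)\<^sup>2) \<le> (LINT x|M. 2 * (f x - h x)\<^sup>2 + 2 * (g x - h x)\<^sup>2)"
    using int square_diff_bound by (intro integral_mono) auto
  also have "\<dots> = 2 * (L2_norm M (\<lambda>x. f x - h x))\<^sup>2 + 2 * (L2_norm M (\<lambda>x. g x - h x))\<^sup>2"
    using int by (simp add: L2_norm_square)
  finally show ?thesis .
qed

text \<open>By the trace inequality, test functions that converge in \<open>H\<^sup>1\<close> are Cauchy sequences in the
  mean square over the face.\<close>

lemma trace_limit_exists:
  fixes n a :: "'a::euclidean_space"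
  assumes S: "open S" and \<phi>: "\<And>j. test_function S (\<phi> j)" and bs: "set bs \<subseteq> Basis"
    and conv: "\<And>cs. cs = bs \<or> (\<exists>b\<in>Basis. cs = b # bs) \<Longrightarrow> \<exists>h. L2_fun (lebesgue_on S) h \<and>
      (\<lambda>j. L2_norm (lebesgue_on S) (\<lambda>x. iter_partial cs (\<phi> j) x - h x)) \<longlonglongrightarrow> 0"
    and n: "norm n = 1" and e: "compact e"
  shows "\<exists>g. L2_fun (prism_measure n a e) g \<and>
    (\<lambda>j. L2_norm (prism_measure n a e) (\<lambda>x. iter_partial bs (\<phi> j) x - g x)) \<longlonglongrightarrow> 0"
proof (rule L2_complete)
  let ?F = "prism_measure n a e"
  have S_sets: "S \<in> sets lebesgue" using S by auto
  have e_sets: "e \<in> sets borel" using e compact_imp_closed borel_closed by blast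
  define C where "C = {bs} \<union> {b # bs | b. b \<in> (Basis :: 'a set)}"
  have C: "set cs \<subseteq> Basis" if "cs \<in> C" for cs using that bs by (auto simp: C_def)
  have "\<exists>h. \<forall>cs\<in>C. L2_fun (lebesgue_on S) (h cs) \<and>
      (\<lambda>j. L2_norm (lebesgue_on S) (\<lambda>x. iter_partial cs (\<phi> j) x - h cs x)) \<longlonglongrightarrow> 0"
    by (intro bchoice ballI conv) (auto simp: C_def)
  then obtain h where h: "\<And>cs. cs \<in> C \<Longrightarrow> L2_fun (lebesgue_on S) (h cs)"
    "\<And>cs. cs \<in> C \<Longrightarrow> (\<lambda>j. L2_norm (lebesgue_on S) (\<lambda>x. iter_partial cs (\<phi> j) x - h cs x)) \<longlonglongrightarrow> 0"
    by blast
  define \<alpha> where "\<alpha> cs j = (L2_norm (lebesgue_on S) (\<lambda>x. iter_partial cs (\<phi> j) x - h cs x))\<^sup>2" for cs j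
  have \<alpha>: "\<alpha> cs \<longlonglongrightarrow> 0" if "cs \<in> C" for cs
    unfolding \<alpha>_def using tendsto_power[OF h(2)[OF that], of 2] by simp
  have L2: "L2_fun (lebesgue_on S) (iter_partial cs (\<phi> j))" if "set cs \<subseteq> Basis" for cs j
  proof -
    obtain K where "compact K" "K \<subseteq> S" "\<And>bs x. x \<notin> K \<Longrightarrow> iter_partial bs (\<phi> j) x = 0"
      using test_function_support[OF \<phi>] by blast
    then show ?thesis
      using test_function_smooth(2)[OF \<phi> that] S_sets by (intro compactly_supported_square_integral(1)) auto
  qed
  show prism_L2: "L2_fun (?F) (iter_partial bs (\<phi> j))" for j
    using test_function_smooth(2)[OF \<phi> bs] by (intro continuous_L2_on_prism n e)
  define c where "c j = 4 * \<alpha> bs j + 4 * (\<Sum>b\<in>Basis. \<alpha> (b # bs) j)" for j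
  have "c \<longlonglongrightarrow> 4 * 0 + 4 * (\<Sum>b\<in>(Basis::'a set). 0)"
    unfolding c_def by (intro tendsto_intros \<alpha>) (auto simp: C_def)
  then have c: "c \<longlonglongrightarrow> 0" by simp
  have diff_le: "(LINT x|?F. (iter_partial bs (\<phi> i) x - iter_partial bs (\<phi> j) x)\<^sup>2) \<le> c i + c j" for i j
  proof -
    define d where "d cs x = iter_partial cs (\<phi> i) x - iter_partial cs (\<phi> j) x" for cs x
    obtain K1 where K1: "compact K1" "K1 \<subseteq> S" "\<And>bs x. x \<notin> K1 \<Longrightarrow> iter_partial bs (\<phi> i) x = 0"
      using test_function_support[OF \<phi>] by blast
    obtain K2 where K2: "compact K2" "K2 \<subseteq> S" "\<And>bs x. x \<notin> K2 \<Longrightarrow> iter_partial bs (\<phi> j) x = 0"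
      using test_function_support[OF \<phi>] by blast
    have d_cont: "continuous_on UNIV (d cs)" if "set cs \<subseteq> Basis" for cs
      unfolding d_def[abs_def] using test_function_smooth(2)[OF \<phi> that] by (intro continuous_on_diff)
    have nn_d: "(\<integral>\<^sup>+x. ennreal ((d cs x)\<^sup>2) \<partial>lborel) \<le> ennreal (2 * \<alpha> cs i + 2 * \<alpha> cs j)" if "cs \<in> C" for cs
    proof -
      have "(\<integral>\<^sup>+x. ennreal ((d cs x)\<^sup>2) \<partial>lborel) = ennreal (LINT x|lebesgue_on S. (d cs x)\<^sup>2)"
        using K1 K2 d_cont[OF C[OF that]] S_sets
        by (intro compactly_supported_square_integral(2)[of _ "K1 \<union> K2"]) (auto simp: d_def)
      also have "\<dots> \<le> ennreal (2 * \<alpha> cs i + 2 * \<alpha> cs j)"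
        unfolding d_def \<alpha>_def using L2[OF C[OF that]] h(1)[OF that]
        by (intro ennreal_leI L2_norm_square_diff_bound)
      finally show ?thesis .
    qed
    have \<alpha>_nonneg: "0 \<le> \<alpha> cs j" for cs j by (simp add: \<alpha>_def)
    have partial_d: "partial b (d bs) = d (b # bs)" for b
      unfolding d_def[abs_def] iter_partial_Cons
      using partial_diff test_function_smooth(1)[OF \<phi> bs] by blast
    have "(\<integral>\<^sup>+x. ennreal ((d bs x)\<^sup>2) \<partial>?F) \<le>
      2 * (\<integral>\<^sup>+x. ennreal ((d bs x)\<^sup>2) \<partial>lborel) + 2 * (\<Sum>b\<in>Basis. \<integral>\<^sup>+x. ennreal ((partial b (d bs) x)\<^sup>2) \<partial>lborel)"
    proof (rule trace_inequality[OF _ _ n e_sets])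
      show "d bs differentiable at x" for x
        unfolding d_def[abs_def] using test_function_smooth(1)[OF \<phi> bs] by (intro differentiable_diff)
      show "continuous_on UNIV (partial b (d bs))" if "b \<in> Basis" for b
        unfolding partial_d using d_cont that bs by simp
    qed
    also have "\<dots> \<le> 2 * ennreal (2 * \<alpha> bs i + 2 * \<alpha> bs j) +
        2 * (\<Sum>b\<in>(Basis::'a set). ennreal (2 * \<alpha> (b # bs) i + 2 * \<alpha> (b # bs) j))"
      unfolding partial_d by (intro add_mono mult_left_mono sum_mono nn_d) (auto simp: C_def)
    also have "\<dots> = ennreal (2 * (2 * \<alpha> bs i + 2 * \<alpha> bs j) +
        2 * (\<Sum>b\<in>(Basis::'a set). 2 * \<alpha> (b # bs) i + 2 * \<alpha> (b # bs) j))"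
    proof -
      have en: "2 * ennreal x + 2 * (\<Sum>b\<in>(Basis::'a set). ennreal (y b)) = ennreal (2 * x + 2 * (\<Sum>b\<in>(Basis::'a set). y b))"
        if "0 \<le> x" "\<And>b. 0 \<le> y b" for x y
        using that by (simp add: sum_ennreal ennreal_plus ennreal_mult sum_nonneg)
      show ?thesis by (rule en) (use \<alpha>_nonneg in auto)
    qed
    also have "2 * (2 * \<alpha> bs i + 2 * \<alpha> bs j) + 2 * (\<Sum>b\<in>(Basis::'a set). 2 * \<alpha> (b # bs) i + 2 * \<alpha> (b # bs) j) = c i + c j"
      by (simp add: c_def sum.distrib sum_distrib_left[symmetric])
    finally have "(\<integral>\<^sup>+x. ennreal ((d bs x)\<^sup>2) \<partial>?F) \<le> ennreal (c i + c j)" .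
    moreover have "(\<integral>\<^sup>+x. ennreal ((d bs x)\<^sup>2) \<partial>?F) = ennreal (LINT x|?F. (d bs x)\<^sup>2)"
      using L2_funD(2)[OF L2_fun_diff[OF prism_L2 prism_L2, of i j]]
      by (intro nn_integral_eq_integral) (auto simp: d_def)
    moreover have "0 \<le> c i + c j" using \<alpha>_nonneg by (simp add: c_def sum_nonneg)
    ultimately show ?thesis by (simp add: d_def)
  qed
  fix \<epsilon> :: real assume "0 < \<epsilon>"
  then have "eventually (\<lambda>j. c j < \<epsilon>/2) sequentially" using order_tendstoD(2)[OF c, of "\<epsilon>/2"] by simp
  then obtain N where N: "\<And>j. j \<ge> N \<Longrightarrow> c j < \<epsilon>/2" by (auto simp: eventually_sequentially)
  show "\<exists>N::nat. \<forall>i\<ge>N. \<forall>j\<ge>N. (LINT x|?F. (iter_partial bs (\<phi> i) x - iter_partial bs (\<phi> j) x)\<^sup>2) \<le> \<epsilon>"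
  proof (intro exI[of _ N] allI impI)
    fix i j assume "N \<le> i" "N \<le> j"
    then show "(LINT x|?F. (iter_partial bs (\<phi> i) x - iter_partial bs (\<phi> j) x)\<^sup>2) \<le> \<epsilon>"
      using diff_le[of i j] N[of i] N[of j] by simp
  qed
qed

lemma L2_null_sequence_add:
  assumes u: "\<And>j. L2_fun M (u j)" "(\<lambda>j. L2_norm M (u j)) \<longlonglongrightarrow> 0"
    and v: "\<And>j. L2_fun M (v j)" "(\<lambda>j. L2_norm M (v j)) \<longlonglongrightarrow> 0"
  shows "(\<lambda>j. L2_norm M (\<lambda>x. u j x + r * v j x)) \<longlonglongrightarrow> 0"
proof -
  have bound: "(LINT x|M. (u j x + r * v j x)\<^sup>2) \<le> 2 * (L2_norm M (u j))\<^sup>2 + 2 * r\<^sup>2 * (L2_norm M (v j))\<^sup>2" for j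
  proof -
    have "(LINT x|M. (u j x - (- r) * v j x)\<^sup>2) \<le>
        2 * (L2_norm M (\<lambda>x. u j x - 0))\<^sup>2 + 2 * (L2_norm M (\<lambda>x. (- r) * v j x - 0))\<^sup>2"
      by (rule L2_norm_square_diff_bound[OF u(1) L2_fun_scale[OF v(1)] L2_fun_zero])
    moreover have "(L2_norm M (\<lambda>x. (- r) * v j x))\<^sup>2 = r\<^sup>2 * (L2_norm M (v j))\<^sup>2"
      unfolding L2_norm_square power_mult_distrib by simp
    ultimately show ?thesis by simp
  qed
  define B where "B j = 2 * (L2_norm M (u j))\<^sup>2 + 2 * r\<^sup>2 * (L2_norm M (v j))\<^sup>2" for j
  have "B \<longlonglongrightarrow> 2 * 0\<^sup>2 + 2 * r\<^sup>2 * 0\<^sup>2"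
    unfolding B_def[abs_def] by (intro tendsto_add tendsto_mult tendsto_power tendsto_const u(2) v(2))
  then have B: "B \<longlonglongrightarrow> 0" by simp
  have "norm (LINT x|M. (u j x + r * v j x)\<^sup>2) \<le> B j" for j
  proof -
    have "0 \<le> (LINT x|M. (u j x + r * v j x)\<^sup>2)" by (intro integral_nonneg_AE AE_I2) simp
    then show ?thesis using bound[of j] by (simp add: B_def)
  qed
  then have "(\<lambda>j. LINT x|M. (u j x + r * v j x)\<^sup>2) \<longlonglongrightarrow> 0"
    by (intro Lim_null_comparison[OF always_eventually B]) blast
  then have "(\<lambda>j. sqrt (LINT x|M. (u j x + r * v j x)\<^sup>2)) \<longlonglongrightarrow> sqrt 0" by (rule tendsto_real_sqrt)
  then show ?thesis by (simp add: L2_norm_def)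
qed

lemma L2_null_sequence_sum:
  assumes "finite I" "\<And>i j. i \<in> I \<Longrightarrow> L2_fun M (u i j)" "\<And>i. i \<in> I \<Longrightarrow> (\<lambda>j. L2_norm M (u i j)) \<longlonglongrightarrow> 0"
  shows "(\<lambda>j. L2_norm M (\<lambda>x. \<Sum>i\<in>I. r i * u i j x)) \<longlonglongrightarrow> 0"
  using assms
proof (induction I)
  case empty
  then show ?case by (simp add: L2_norm_def)
next
  case (insert i I)
  have "(\<lambda>j. L2_norm M (\<lambda>x. (\<Sum>i\<in>I. r i * u i j x) + r i * u i j x)) \<longlonglongrightarrow> 0"
  proof (rule L2_null_sequence_add)
    show "L2_fun M (\<lambda>x. \<Sum>i\<in>I. r i * u i j x)" for j
      using insert.prems(1) by (intro L2_fun_sum L2_fun_scale) simp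
    show "(\<lambda>j. L2_norm M (\<lambda>x. \<Sum>i\<in>I. r i * u i j x)) \<longlonglongrightarrow> 0"
      using insert.prems by (intro insert.IH) simp_all
  qed (use insert.prems in simp_all)
  then show ?case using insert.hyps by (simp add: add.commute)
qed

text \<open>The normal derivative is a combination of first derivatives, and these converge in \<open>H\<^sup>1\<close> when
  the functions converge in \<open>H\<^sup>2\<close>.\<close>

lemma traces_exist:
  fixes \<Omega> :: "'a::euclidean_space set"
  assumes \<Omega>: "open \<Omega>" and \<psi>: "\<psi> \<in> H0m \<Omega> 2" and n: "is_unit_normal n e" and e: "compact e" "e \<noteq> {}"
  shows "\<exists>g. is_trace \<Omega> e \<psi> g" "\<exists>g. is_normal_trace \<Omega> e n \<psi> g"
proof -
  obtain \<phi> where \<phi>: "\<And>j. test_function \<Omega> (\<phi> j)" "Hm_tendsto \<Omega> 2 \<phi> \<psi>"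
    using \<psi> by (auto simp: H0m_def)
  obtain n' a where n': "norm n' = 1" and fm: "face_measure e = prism_measure n' a e"
    using face_measure_is_prism_measure[OF n e(2)] by metis
  have conv: "\<exists>h. L2_fun (lebesgue_on \<Omega>) h \<and>
      (\<lambda>j. L2_norm (lebesgue_on \<Omega>) (\<lambda>x. iter_partial cs (\<phi> j) x - h x)) \<longlonglongrightarrow> 0"
    if "set cs \<subseteq> Basis" "length cs \<le> 2" for cs
    using \<phi>(2) that unfolding Hm_tendsto_def by blast
  have lim: "\<exists>g. L2_fun (face_measure e) g \<and>
      (\<lambda>j. L2_norm (face_measure e) (\<lambda>x. iter_partial bs (\<phi> j) x - g x)) \<longlonglongrightarrow> 0"
    if "set bs \<subseteq> Basis" "length bs \<le> 1" for bs
    unfolding fm using that by (intro trace_limit_exists[OF \<Omega> \<phi>(1) that(1) conv n' e(1)]) auto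
  show "\<exists>g. is_trace \<Omega> e \<psi> g"
  proof -
    obtain g where "L2_fun (face_measure e) g"
      "(\<lambda>j. L2_norm (face_measure e) (\<lambda>x. \<phi> j x - g x)) \<longlonglongrightarrow> 0"
      using lim[of "[]"] by (auto simp: iter_partial_Nil)
    then show ?thesis unfolding is_trace_def using \<phi> by blast
  qed
  have "\<exists>g. \<forall>b\<in>Basis. L2_fun (face_measure e) (g b) \<and>
      (\<lambda>j. L2_norm (face_measure e) (\<lambda>x. iter_partial [b] (\<phi> j) x - g b x)) \<longlonglongrightarrow> 0"
    by (intro bchoice ballI lim) auto
  then obtain g where g: "\<And>b. b \<in> Basis \<Longrightarrow> L2_fun (face_measure e) (g b)"
    "\<And>b. b \<in> Basis \<Longrightarrow> (\<lambda>j. L2_norm (face_measure e) (\<lambda>x. iter_partial [b] (\<phi> j) x - g b x)) \<longlonglongrightarrow> 0"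
    by blast
  have L2: "L2_fun (face_measure e) (\<lambda>x. iter_partial [b] (\<phi> j) x - g b x)" if "b \<in> Basis" for b j
  proof (rule L2_fun_diff)
    show "L2_fun (face_measure e) (iter_partial [b] (\<phi> j))"
      unfolding fm using test_function_smooth(2)[OF \<phi>(1), of "[b]"] that
      by (intro continuous_L2_on_prism n' e) auto
  qed (rule g(1)[OF that])
  have "gradient (\<phi> j) x \<bullet> n - (\<Sum>b\<in>Basis. (b \<bullet> n) * g b x) = (\<Sum>b\<in>Basis. (b \<bullet> n) * (iter_partial [b] (\<phi> j) x - g b x))" for j x
    by (simp add: gradient_def inner_sum_left iter_partial_Cons iter_partial_Nil right_diff_distrib sum_subtractf mult.commute)
  moreover have "(\<lambda>j. L2_norm (face_measure e) (\<lambda>x. \<Sum>b\<in>Basis. (b \<bullet> n) * (iter_partial [b] (\<phi> j) x - g b x))) \<longlonglongrightarrow> 0"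
    by (intro L2_null_sequence_sum L2 g(2)) auto
  ultimately have "(\<lambda>j. L2_norm (face_measure e) (\<lambda>x. gradient (\<phi> j) x \<bullet> n - (\<Sum>b\<in>Basis. (b \<bullet> n) * g b x))) \<longlonglongrightarrow> 0"
    by simp
  moreover have "L2_fun (face_measure e) (\<lambda>x. \<Sum>b\<in>Basis. (b \<bullet> n) * g b x)"
    using g(1) by (intro L2_fun_sum L2_fun_scale)
  ultimately have "is_normal_trace \<Omega> e n \<psi> (\<lambda>x. \<Sum>b\<in>Basis. (b \<bullet> n) * g b x)"
    unfolding is_normal_trace_def using \<phi> by blast
  then show "\<exists>g. is_normal_trace \<Omega> e n \<psi> g" by blast
qed

text \<open>Test functions vanish near the boundary.\<close>

lemma traces_vanish_on_boundary:
  assumes \<Omega>: "open \<Omega>" and e: "e \<subseteq> frontier \<Omega>" "space (face_measure e) = e"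
  shows "is_trace \<Omega> e \<psi> g \<Longrightarrow> AE x in face_measure e. g x = 0"
    "is_normal_trace \<Omega> e n \<psi> g \<Longrightarrow> AE x in face_measure e. g x = 0"
proof -
  have disj: "x \<notin> \<Omega>" if "x \<in> e" for x
    using that e(1) \<Omega> by (auto simp: frontier_def interior_open)
  have zero: "iter_partial bs \<phi> x = 0" if \<phi>: "test_function \<Omega> \<phi>" and "x \<in> e" for bs \<phi> x
  proof -
    obtain K where K: "compact K" "K \<subseteq> \<Omega>" "\<And>bs x. x \<notin> K \<Longrightarrow> iter_partial bs \<phi> x = 0"
      by (rule test_function_support[OF \<phi>]) (rule that)
    show ?thesis using disj[OF \<open>x \<in> e\<close>] K(2) by (intro K(3)) blast
  qed
  have AE_zero: "AE x in face_measure e. g x = 0"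
    if g: "L2_fun (face_measure e) g" and lim: "(\<lambda>j. L2_norm (face_measure e) (\<lambda>x. \<eta> j x - g x)) \<longlonglongrightarrow> 0"
      and \<eta>: "\<And>j x. x \<in> e \<Longrightarrow> \<eta> j x = 0" for \<eta> :: "nat \<Rightarrow> _ \<Rightarrow> real" and g
  proof -
    have "L2_norm (face_measure e) (\<lambda>x. \<eta> j x - g x) = L2_norm (face_measure e) g" for j
      unfolding L2_norm_def using \<eta> e(2) by (intro arg_cong[of _ _ sqrt] Bochner_Integration.integral_cong) auto
    then have "L2_norm (face_measure e) g = 0" using lim by (simp only: LIMSEQ_const_iff)
    then have "(LINT x|face_measure e. (g x)\<^sup>2) = 0" by (simp add: L2_norm_def)
    then show ?thesis using L2_funD(2)[OF g] by (subst (asm) integral_nonneg_eq_0_iff_AE) auto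
  qed
  show "AE x in face_measure e. g x = 0" if tr: "is_trace \<Omega> e \<psi> g"
  proof -
    obtain \<phi> where "\<And>j. test_function \<Omega> (\<phi> j)" "L2_fun (face_measure e) g"
      "(\<lambda>j. L2_norm (face_measure e) (\<lambda>x. \<phi> j x - g x)) \<longlonglongrightarrow> 0"
      using tr unfolding is_trace_def by blast
    moreover have "\<phi> j x = 0" if "x \<in> e" for j x
      using zero[OF calculation(1) that, of "[]" j] by (simp add: iter_partial_Nil)
    ultimately show ?thesis by (intro AE_zero[of g \<phi>])
  qed
  show "AE x in face_measure e. g x = 0" if tr: "is_normal_trace \<Omega> e n \<psi> g"
  proof -
    obtain \<phi> where \<phi>: "\<And>j. test_function \<Omega> (\<phi> j)" "L2_fun (face_measure e) g"
      "(\<lambda>j. L2_norm (face_measure e) (\<lambda>x. gradient (\<phi> j) x \<bullet> n - g x)) \<longlonglongrightarrow> 0"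
      using tr unfolding is_normal_trace_def by blast
    have "gradient (\<phi> j) x = 0" if "x \<in> e" for j x
    proof -
      have "partial b (\<phi> j) x = 0" for b
        using zero[OF \<phi>(1) that, of "[b]" j] by (simp add: iter_partial_Cons iter_partial_Nil)
      then show ?thesis by (simp add: gradient_def)
    qed
    then have "gradient (\<phi> j) x \<bullet> n = 0" if "x \<in> e" for j x using that by simp
    then show ?thesis by (intro AE_zero[OF \<phi>(2,3)])
  qed
qed

section \<open>Cells, faces and projections\<close>

lemma polyhedral_piece_compact:
  assumes "polyhedral_piece m S" shows "compact S"
proof -
  obtain P where "finite P" "\<forall>p\<in>P. polytope p" "S = \<Union>P" using assms by (auto simp: polyhedral_piece_def)
  then show ?thesis by (auto intro: compact_Union polytope_imp_compact)
qed

lemma polyhedral_piece_nonempty: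
  assumes "polyhedral_piece m S" "0 \<le> m" shows "S \<noteq> {}"
  using assms by (auto simp: polyhedral_piece_def)

lemma polyhedral_piece_interior:
  fixes T :: "'a::euclidean_space set"
  assumes "polyhedral_piece (int DIM('a)) T" shows "interior T \<noteq> {}"
proof -
  obtain P where P: "\<forall>p\<in>P. polytope p \<and> aff_dim p = int DIM('a)" "T = \<Union>P"
    using assms by (auto simp: polyhedral_piece_def)
  have "T \<noteq> {}" using polyhedral_piece_nonempty[OF assms] by simp
  then obtain p where p: "p \<in> P" "p \<noteq> {}" using P(2) by blast
  then have poly: "polytope p" "aff_dim p = int DIM('a)" using P(1) by auto
  then have "affine hull p = UNIV" by (simp add: aff_dim_eq_full)
  then have "rel_interior p = interior p" by (rule rel_interior_interior)
  moreover have "rel_interior p \<noteq> {}"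
    using p poly(1) by (simp add: rel_interior_eq_empty polytope_imp_convex)
  moreover have "interior p \<subseteq> interior T" using p P(2) by (intro interior_mono) auto
  ultimately show ?thesis by blast
qed

definition is_face :: "'a::euclidean_space set \<Rightarrow> bool" where
  "is_face e \<longleftrightarrow> polyhedral_piece (int DIM('a) - 1) e \<and> (\<exists>n. is_unit_normal n e)"

lemma is_face_compact: "is_face e \<Longrightarrow> compact e"
  unfolding is_face_def by (blast intro: polyhedral_piece_compact)

lemma is_face_nonempty:
  fixes e :: "'a::euclidean_space set"
  assumes "is_face e" shows "e \<noteq> {}"
proof (rule polyhedral_piece_nonempty)
  show "polyhedral_piece (int DIM('a) - 1) e" using assms by (simp add: is_face_def)
  show "0 \<le> int DIM('a) - 1" using DIM_positive[where 'a = 'a] by linarith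
qed

lemma is_face_prism_measure:
  fixes e :: "'a::euclidean_space set"
  assumes "is_face e"
  obtains n a where "norm n = 1" "a \<in> e" "\<And>x. x \<in> e \<Longrightarrow> n \<bullet> (x - a) = 0" "face_measure e = prism_measure n a e"
proof -
  obtain n0 where "is_unit_normal n0 e" using assms by (auto simp: is_face_def)
  then show thesis by (rule face_measure_is_prism_measure[OF _ is_face_nonempty[OF assms]]) (rule that)
qed

lemma space_face_measure:
  assumes "is_face e" shows "space (face_measure e) = e"
  by (rule is_face_prism_measure[OF assms]) (simp add: space_prism_measure)

lemma continuous_L2_on_face:
  assumes "is_face e" "continuous_on e g" shows "L2_fun (face_measure e) g"
  by (rule is_face_prism_measure[OF assms(1)])
    (simp add: continuous_L2_on_prism is_face_compact assms)

lemma face_poly_space_continuous: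
  fixes e :: "'a::euclidean_space set"
  assumes "p \<in> face_poly_space k e" shows "continuous_on e p"
proof -
  obtain q where q: "q \<in> poly_space k" "p = (\<lambda>x. if x \<in> e then q x else 0)"
    using assms by (auto simp: face_poly_space_def)
  have "continuous_on e q"
    by (intro continuous_on_real_polynomial_function poly_space_real_polynomial_function[OF q(1)])
  then show ?thesis by (rule continuous_on_eq) (simp add: q(2))
qed

lemma face_poly_space_L2: "is_face e \<Longrightarrow> p \<in> face_poly_space k e \<Longrightarrow> L2_fun (face_measure e) p"
  by (intro continuous_L2_on_face face_poly_space_continuous)

lemma face_poly_space_definite:
  fixes e :: "'a::euclidean_space set"
  assumes e: "is_face e" and p: "p \<in> face_poly_space k e" and zero: "(LINT x|face_measure e. (p x)\<^sup>2) = 0"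
  shows "p = 0"
proof -
  obtain q where q: "q \<in> poly_space k" "p = (\<lambda>x. if x \<in> e then q x else 0)"
    using p by (auto simp: face_poly_space_def)
  obtain n a where n: "norm n = 1" "a \<in> e" "\<And>x. x \<in> e \<Longrightarrow> n \<bullet> (x - a) = 0"
    and fm: "face_measure e = prism_measure n a e"
    using e by (rule is_face_prism_measure) (rule that)
  obtain P where P: "\<forall>p\<in>P. polytope p \<and> aff_dim p = int DIM('a) - 1" "e = \<Union>P"
    using e by (auto simp: is_face_def polyhedral_piece_def)
  have "(LINT x|face_measure e. (q x)\<^sup>2) = (LINT x|face_measure e. (p x)\<^sup>2)"
    using space_face_measure[OF e] q(2) by (intro Bochner_Integration.integral_cong) auto
  then have q0: "(LINT x|prism_measure n a e. (q x)\<^sup>2) = 0" using zero fm by simp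
  have cont: "continuous_on UNIV q"
    by (intro continuous_on_real_polynomial_function poly_space_real_polynomial_function[OF q(1)])
  have "q z = 0" if z: "z \<in> e" for z
  proof -
    obtain s where s: "s \<in> P" "z \<in> s" using z P(2) by blast
    then show ?thesis
      using P by (intro prism_measure_zero_on_polytope[OF n is_face_compact[OF e] _ _ _ cont q0]) auto
  qed
  then show ?thesis using q(2) by (auto simp: fun_eq_iff)
qed

text \<open>A boundary point of the domain lies on the frontier of one of the finitely many polytopes whose
  union is the closure. With this null set out of the way, square integrability over the domain gives
  square integrability over the closed cells.\<close>

lemma polyhedral_domain_null_boundary:
  assumes "polyhedral_domain \<Omega>"
  shows "negligible (closure \<Omega> - \<Omega>)"
proof -
  obtain P where P: "finite P" "\<forall>p\<in>P. polytope p" "closure \<Omega> = \<Union>P"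
    using assms by (auto simp: polyhedral_domain_def polyhedral_piece_def)
  have "closure \<Omega> - \<Omega> \<subseteq> (\<Union>p\<in>P. frontier p)"
  proof
    fix x assume x: "x \<in> closure \<Omega> - \<Omega>"
    then obtain p where p: "p \<in> P" "x \<in> p" using P(3) by blast
    have "interior p \<subseteq> interior (closure \<Omega>)" using p(1) P(3) by (intro interior_mono) auto
    also have "\<dots> = \<Omega>" using assms by (simp add: polyhedral_domain_def)
    finally have "x \<notin> interior p" using x by blast
    then show "x \<in> (\<Union>p\<in>P. frontier p)" using p closure_subset[of p] by (auto simp: frontier_def)
  qed
  moreover have "negligible (\<Union>p\<in>P. frontier p)"
    using P by (intro negligible_Union finite_imageI) (auto intro: negligible_convex_frontier polytope_imp_convex)
  ultimately show ?thesis by (rule negligible_subset[rotated])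
qed

lemma L2_fun_subset_closure:
  fixes \<Omega> T :: "'a::euclidean_space set"
  assumes \<Omega>: "\<Omega> \<in> sets lebesgue" "negligible (closure \<Omega> - \<Omega>)" and T: "T \<in> sets lebesgue" "T \<subseteq> closure \<Omega>"
    and g: "L2_fun (lebesgue_on \<Omega>) g"
  shows "L2_fun (lebesgue_on T) g" "(LINT x|lebesgue_on T. (g x)\<^sup>2) \<le> (LINT x|lebesgue_on \<Omega>. (g x)\<^sup>2)"
proof -
  have meas: "g \<in> borel_measurable (lebesgue_on T)"
  proof (rule measurableI)
    fix A :: "real set" assume "A \<in> sets borel"
    then have "g -` A \<inter> \<Omega> \<in> sets (lebesgue_on \<Omega>)"
      using measurable_sets[OF L2_funD(1)[OF g], of A] by (simp add: space_restrict_space)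
    then have 1: "g -` A \<inter> \<Omega> \<in> sets lebesgue" using \<Omega>(1) by (simp add: sets_restrict_space_iff)
    have "negligible (g -` A \<inter> T \<inter> (closure \<Omega> - \<Omega>))"
      by (rule negligible_subset[OF \<Omega>(2)]) blast
    then have 2: "g -` A \<inter> T \<inter> (closure \<Omega> - \<Omega>) \<in> sets lebesgue" by (rule negligible_imp_sets)
    \<comment> \<open>Nothing is known about \<open>g\<close> on the boundary of the domain, but the Lebesgue measure is complete.\<close>
    have "g -` A \<inter> space (lebesgue_on T) = (g -` A \<inter> \<Omega> \<inter> T) \<union> (g -` A \<inter> T \<inter> (closure \<Omega> - \<Omega>))"
      using T(2) by (auto simp: space_restrict_space)
    also have "\<dots> \<in> sets lebesgue" by (intro sets.Un sets.Int 1 2 T(1))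
    finally show "g -` A \<inter> space (lebesgue_on T) \<in> sets (lebesgue_on T)"
      using T(1) by (simp add: sets_restrict_space_iff space_restrict_space)
  qed simp
  have int\<Omega>: "integrable lebesgue (\<lambda>x. indicator \<Omega> x *\<^sub>R (g x)\<^sup>2)"
    using L2_funD(2)[OF g] \<Omega>(1) by (subst (asm) integrable_restrict_space) auto
  have "AE x in lebesgue. x \<notin> closure \<Omega> - \<Omega>"
    using \<Omega>(2) unfolding negligible_iff_null_sets by (rule AE_not_in)
  then have le: "AE x in lebesgue. indicator T x *\<^sub>R (g x)\<^sup>2 \<le> indicator \<Omega> x *\<^sub>R (g x)\<^sup>2"
  proof eventually_elim
    case (elim x)
    then have "x \<in> T \<Longrightarrow> x \<in> \<Omega>" using T(2) by blast
    then show ?case by (cases "x \<in> T") simp_all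
  qed
  have intT: "integrable lebesgue (\<lambda>x. indicator T x *\<^sub>R (g x)\<^sup>2)"
  proof (rule Bochner_Integration.integrable_bound[OF int\<Omega>])
    have "(\<lambda>x. (g x)\<^sup>2) \<in> borel_measurable (lebesgue_on T)" using meas by simp
    then show "(\<lambda>x. indicator T x *\<^sub>R (g x)\<^sup>2) \<in> borel_measurable lebesgue"
      using T(1) by (subst (asm) borel_measurable_restrict_space_iff) auto
    show "AE x in lebesgue. norm (indicator T x *\<^sub>R (g x)\<^sup>2) \<le> norm (indicator \<Omega> x *\<^sub>R (g x)\<^sup>2)"
      using le
    proof eventually_elim
      case (elim x)
      then show ?case by (cases "x \<in> T"; cases "x \<in> \<Omega>") simp_all
    qed
  qed
  then show "L2_fun (lebesgue_on T) g"
    using meas T(1) unfolding L2_fun_def by (subst integrable_restrict_space) auto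
  have "(LINT x|lebesgue_on T. (g x)\<^sup>2) = (LINT x|lebesgue. indicator T x *\<^sub>R (g x)\<^sup>2)"
    using T(1) by (subst integral_restrict_space) auto
  also have "\<dots> \<le> (LINT x|lebesgue. indicator \<Omega> x *\<^sub>R (g x)\<^sup>2)"
    by (rule integral_mono_AE[OF intT int\<Omega> le])
  also have "\<dots> = (LINT x|lebesgue_on \<Omega>. (g x)\<^sup>2)"
    using \<Omega>(1) by (subst integral_restrict_space) auto
  finally show "(LINT x|lebesgue_on T. (g x)\<^sup>2) \<le> (LINT x|lebesgue_on \<Omega>. (g x)\<^sup>2)" .
qed

lemma cell_L2_proj:
  assumes "compact T" "interior T \<noteq> {}" "L2_fun (lebesgue_on T) g"
  shows "L2_proj (lebesgue_on T) (poly_space k) g \<in> poly_space k"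
  unfolding poly_space_eq_span
proof (rule L2_proj_in_span[OF finite_monomial_functions _ _ assms(3)])
  fix q :: "'a \<Rightarrow> real" assume q: "q \<in> span (monomial_functions k)"
  then have q': "q \<in> poly_space k" by (simp add: poly_space_eq_span)
  show "L2_fun (lebesgue_on T) q" by (rule polynomial_L2[OF assms(1) q'])
  show "q = 0" if "(LINT x|lebesgue_on T. (q x)\<^sup>2) = 0" using polynomial_L2_definite[OF assms(1,2) q' that] .
qed

lemma face_L2_proj:
  assumes e: "is_face e" and g: "L2_fun (face_measure e) g"
  shows "L2_proj (face_measure e) (face_poly_space k e) g \<in> face_poly_space k e"
    "AE x in face_measure e. g x = 0 \<Longrightarrow> L2_proj (face_measure e) (face_poly_space k e) g = 0"
proof -
  have fin: "finite (restrict_fun e ` monomial_functions k)"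
    by (intro finite_imageI finite_monomial_functions)
  have L2: "L2_fun (face_measure e) q" if "q \<in> span (restrict_fun e ` monomial_functions k)" for q
    using face_poly_space_L2[OF e] that by (simp add: face_poly_space_eq_span)
  have definite: "q = 0" if "q \<in> span (restrict_fun e ` monomial_functions k)"
    "(LINT x|face_measure e. (q x)\<^sup>2) = 0" for q
    using face_poly_space_definite[OF e _ that(2)] that(1) by (simp add: face_poly_space_eq_span)
  show "L2_proj (face_measure e) (face_poly_space k e) g \<in> face_poly_space k e"
    unfolding face_poly_space_eq_span by (rule L2_proj_in_span[OF fin L2 definite g])
  show "L2_proj (face_measure e) (face_poly_space k e) g = 0" if "AE x in face_measure e. g x = 0"
    unfolding face_poly_space_eq_span by (rule L2_proj_null[OF fin L2 definite g that])
qed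

lemma mesh_cell:
  fixes \<Omega> :: "'a::euclidean_space set"
  assumes "is_mesh \<Omega> Th Eh" "T \<in> Th"
  shows "compact T" "interior T \<noteq> {}" "T \<subseteq> closure \<Omega>" "T \<in> sets lebesgue"
proof -
  have piece: "polyhedral_piece (int DIM('a)) T" and un: "\<Union>Th = closure \<Omega>"
    using assms by (simp_all add: is_mesh_def)
  show "compact T" using piece by (rule polyhedral_piece_compact)
  then show "T \<in> sets lebesgue" using lmeasurable_compact by blast
  show "interior T \<noteq> {}" using piece by (rule polyhedral_piece_interior)
  show "T \<subseteq> closure \<Omega>" using un assms(2) by blast
qed

lemma mesh_face:
  fixes \<Omega> :: "'a::euclidean_space set"
  assumes "is_mesh \<Omega> Th Eh" "\<forall>e\<in>Eh. is_unit_normal (ne e) e" "e \<in> Eh"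
  shows "is_face e"
proof -
  have "polyhedral_piece (int DIM('a) - 1) e" using assms(1,3) by (simp add: is_mesh_def)
  then show ?thesis unfolding is_face_def using assms(2,3) by blast
qed

lemma mesh_finite:
  assumes "is_mesh \<Omega> Th Eh" shows "finite Th" "finite Eh" "finite (faces_of Eh T)"
  using assms by (auto simp: is_mesh_def faces_of_def)

lemma domain_L2_on_cell:
  assumes "polyhedral_domain \<Omega>" "is_mesh \<Omega> Th Eh" "T \<in> Th" "L2_fun (lebesgue_on \<Omega>) g"
  shows "L2_fun (lebesgue_on T) g" "L2_norm (lebesgue_on T) g \<le> L2_norm (lebesgue_on \<Omega>) g"
proof -
  have \<Omega>: "\<Omega> \<in> sets lebesgue" using assms(1) by (simp add: polyhedral_domain_def)
  note * = L2_fun_subset_closure[OF \<Omega> polyhedral_domain_null_boundary[OF assms(1)]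
      mesh_cell(4,3)[OF assms(2,3)] assms(4)]
  show "L2_fun (lebesgue_on T) g" by (rule *(1))
  show "L2_norm (lebesgue_on T) g \<le> L2_norm (lebesgue_on \<Omega>) g"
    unfolding L2_norm_def using *(2) by simp
qed

text \<open>Existence of the traces makes the projections onto polynomials on the faces meaningful, and
  the boundary conditions hold because the traces vanish on boundary faces.\<close>

lemma Qh_in_Vh0:
  fixes \<Omega> :: "'a::euclidean_space set"
  assumes \<Omega>: "polyhedral_domain \<Omega>" and mesh: "is_mesh \<Omega> Th Eh"
    and ne: "\<forall>e\<in>Eh. is_unit_normal (ne e) e" and \<psi>: "\<psi> \<in> H0m \<Omega> 2"
  shows "Qh \<Omega> Th Eh ne k \<psi> \<in> Vh0 \<Omega> Th Eh k"
proof -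
  have op: "open \<Omega>" using \<Omega> by (simp add: polyhedral_domain_def)
  have \<psi>_L2: "L2_fun (lebesgue_on \<Omega>) \<psi>" using \<psi> by (auto simp: H0m_def Hm_tendsto_def)
  have cell: "L2_proj (lebesgue_on T) (poly_space k) \<psi> \<in> poly_space k" if "T \<in> Th" for T
    by (rule cell_L2_proj[OF mesh_cell(1,2)[OF mesh that] domain_L2_on_cell(1)[OF \<Omega> mesh that \<psi>_L2]])
  define g where "g e = (SOME g. is_trace \<Omega> e \<psi> g)" for e
  define gn where "gn e = (SOME g. is_normal_trace \<Omega> e (ne e) \<psi> g)" for e
  have tr: "is_trace \<Omega> e \<psi> (g e)" "is_normal_trace \<Omega> e (ne e) \<psi> (gn e)" if e: "e \<in> Eh" for e
  proof -
    note face = mesh_face[OF mesh ne e]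
    note ex = traces_exist[OF op \<psi> bspec[OF ne e] is_face_compact[OF face] is_face_nonempty[OF face]]
    show "is_trace \<Omega> e \<psi> (g e)" unfolding g_def using ex(1) by (rule someI_ex)
    show "is_normal_trace \<Omega> e (ne e) \<psi> (gn e)" unfolding gn_def using ex(2) by (rule someI_ex)
  qed
  have L2: "L2_fun (face_measure e) (g e)" "L2_fun (face_measure e) (gn e)" if "e \<in> Eh" for e
    using tr[OF that] by (auto simp: is_trace_def is_normal_trace_def)
  have face: "L2_proj (face_measure e) (face_poly_space k e) (g e) \<in> face_poly_space k e"
    "L2_proj (face_measure e) (face_poly_space (k - 1) e) (gn e) \<in> face_poly_space (k - 1) e" if "e \<in> Eh" for e
    using face_L2_proj(1)[OF mesh_face[OF mesh ne that]] L2[OF that] by blast+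
  have bd: "L2_proj (face_measure e) (face_poly_space k e) (g e) = 0"
    "L2_proj (face_measure e) (face_poly_space (k - 1) e) (gn e) = 0"
    if e: "e \<in> Eh" "e \<subseteq> frontier \<Omega>" for e
  proof -
    note f = mesh_face[OF mesh ne e(1)]
    note vanish = traces_vanish_on_boundary[OF op e(2) space_face_measure[OF f]]
    show "L2_proj (face_measure e) (face_poly_space k e) (g e) = 0"
      by (rule face_L2_proj(2)[OF f L2(1)[OF e(1)] vanish(1)[OF tr(1)[OF e(1)]]])
    show "L2_proj (face_measure e) (face_poly_space (k - 1) e) (gn e) = 0"
      by (rule face_L2_proj(2)[OF f L2(2)[OF e(1)] vanish(2)[OF tr(2)[OF e(1)]]])
  qed
  show ?thesis
    unfolding Vh0_def Vh_def Qh_def g_def[symmetric] gn_def[symmetric] using cell face bd by simp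
qed

section \<open>The weak Laplacian\<close>

lemma polynomial_L2_on_face:
  fixes p :: "'a::euclidean_space \<Rightarrow> real"
  shows "real_polynomial_function p \<Longrightarrow> is_face e \<Longrightarrow> L2_fun (face_measure e) p"
  by (intro continuous_L2_on_face continuous_on_real_polynomial_function)

text \<open>The right-hand side in the definition of the weak Laplacian; as a constant of its own, its
  linearity in \<open>\<phi>\<close> and in \<open>v\<close> can be stated.\<close>

definition weak_laplacian_functional ::
    "'a::euclidean_space set set \<Rightarrow> ('a set \<Rightarrow> 'a) \<Rightarrow> 'a weak_function \<Rightarrow> 'a set \<Rightarrow> ('a \<Rightarrow> real) \<Rightarrow> real" where
  "weak_laplacian_functional Eh ne v T \<phi> =
     (LINT x|lebesgue_on T. cell_part v T x * laplacian \<phi> x)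
       - (\<Sum>e\<in>faces_of Eh T.
            LINT x|face_measure e. face_part v e x * (gradient \<phi> x \<bullet> outward_normal T e))
       + (\<Sum>e\<in>faces_of Eh T.
            LINT x|face_measure e. normal_part v e x * (ne e \<bullet> outward_normal T e) * \<phi> x)"

lemma weak_laplacian_summands_integrable:
  fixes \<Omega> :: "'a::euclidean_space set"
  assumes mesh: "is_mesh \<Omega> Th Eh" and ne: "\<forall>e\<in>Eh. is_unit_normal (ne e) e"
    and v: "v \<in> Vh Th Eh k" and T: "T \<in> Th" and \<phi>: "real_polynomial_function \<phi>"
  shows "integrable (lebesgue_on T) (\<lambda>x. cell_part v T x * laplacian \<phi> x)"
    "e \<in> faces_of Eh T \<Longrightarrow> integrable (face_measure e) (\<lambda>x. face_part v e x * (gradient \<phi> x \<bullet> outward_normal T e))"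
    "e \<in> faces_of Eh T \<Longrightarrow> integrable (face_measure e) (\<lambda>x. normal_part v e x * (ne e \<bullet> outward_normal T e) * \<phi> x)"
proof -
  show "integrable (lebesgue_on T) (\<lambda>x. cell_part v T x * laplacian \<phi> x)"
  proof (rule L2_fun_mult_integrable)
    show "L2_fun (lebesgue_on T) (cell_part v T)"
      using v T by (intro polynomial_L2[OF mesh_cell(1)[OF mesh T]]) (auto simp: Vh_def)
    show "L2_fun (lebesgue_on T) (laplacian \<phi>)"
      by (intro continuous_L2_on_compact mesh_cell(1)[OF mesh T] continuous_on_real_polynomial_function
          laplacian_polynomial(1)[OF \<phi> \<phi>])
  qed
  assume "e \<in> faces_of Eh T"
  then have e: "e \<in> Eh" by (simp add: faces_of_def)
  note face = mesh_face[OF mesh ne e]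
  show "integrable (face_measure e) (\<lambda>x. face_part v e x * (gradient \<phi> x \<bullet> outward_normal T e))"
    using v e by (intro L2_fun_mult_integrable face_poly_space_L2[OF face]
        polynomial_L2_on_face[OF _ face] gradient_polynomial(1)[OF \<phi> \<phi>]) (auto simp: Vh_def)
  have "L2_fun (face_measure e) (normal_part v e)"
    using v e by (intro face_poly_space_L2[OF face]) (auto simp: Vh_def)
  from L2_fun_mult_integrable[OF L2_fun_scale[OF this, of "ne e \<bullet> outward_normal T e"]
      polynomial_L2_on_face[OF \<phi> face]]
  show "integrable (face_measure e) (\<lambda>x. normal_part v e x * (ne e \<bullet> outward_normal T e) * \<phi> x)"
    by (simp add: mult.commute)
qed

lemma sum_of_integrals_linear:
  fixes p q h :: "'i \<Rightarrow> 'b \<Rightarrow> real"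
  assumes "\<And>i. i \<in> I \<Longrightarrow> integrable (M i) (p i)" "\<And>i. i \<in> I \<Longrightarrow> integrable (M i) (q i)"
    and "\<And>i x. h i x = a * p i x + b * q i x"
  shows "(\<Sum>i\<in>I. LINT x|M i. h i x) = a * (\<Sum>i\<in>I. LINT x|M i. p i x) + b * (\<Sum>i\<in>I. LINT x|M i. q i x)"
proof -
  have "(LINT x|M i. h i x) = a * (LINT x|M i. p i x) + b * (LINT x|M i. q i x)" if "i \<in> I" for i
    using assms(1,2)[OF that] by (simp add: assms(3))
  then show ?thesis by (simp add: sum.distrib sum_distrib_left)
qed

lemma weak_laplacian_functional_linear:
  fixes \<Omega> :: "'a::euclidean_space set"
  assumes mesh: "is_mesh \<Omega> Th Eh" and ne: "\<forall>e\<in>Eh. is_unit_normal (ne e) e"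
    and v: "v \<in> Vh Th Eh k" and T: "T \<in> Th"
    and \<phi>: "real_polynomial_function \<phi>" and \<eta>: "real_polynomial_function \<eta>"
  shows "weak_laplacian_functional Eh ne v T (\<lambda>x. r * \<phi> x + s * \<eta> x) =
    r * weak_laplacian_functional Eh ne v T \<phi> + s * weak_laplacian_functional Eh ne v T \<eta>"
proof -
  note i\<phi> = weak_laplacian_summands_integrable[OF mesh ne v T \<phi>]
  note i\<eta> = weak_laplacian_summands_integrable[OF mesh ne v T \<eta>]
  let ?A = "\<lambda>\<phi>. LINT x|lebesgue_on T. cell_part v T x * laplacian \<phi> x"
  let ?B = "\<lambda>\<phi>. \<Sum>e\<in>faces_of Eh T. LINT x|face_measure e. face_part v e x * (gradient \<phi> x \<bullet> outward_normal T e)"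
  let ?C = "\<lambda>\<phi>. \<Sum>e\<in>faces_of Eh T. LINT x|face_measure e. normal_part v e x * (ne e \<bullet> outward_normal T e) * \<phi> x"
  let ?z = "\<lambda>x. r * \<phi> x + s * \<eta> x"
  have "?A ?z = r * ?A \<phi> + s * ?A \<eta>"
    using i\<phi>(1) i\<eta>(1) by (simp add: laplacian_polynomial(2)[OF \<phi> \<eta>] distrib_left mult.left_commute)
  moreover have "?B ?z = r * ?B \<phi> + s * ?B \<eta>"
    by (rule sum_of_integrals_linear[OF i\<phi>(2) i\<eta>(2)])
      (simp_all add: gradient_polynomial(2)[OF \<phi> \<eta>] inner_add_left distrib_left mult.left_commute)
  moreover have "?C ?z = r * ?C \<phi> + s * ?C \<eta>"
    by (rule sum_of_integrals_linear[OF i\<phi>(3) i\<eta>(3)]) (simp_all add: distrib_left mult.left_commute)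
  ultimately show ?thesis unfolding weak_laplacian_functional_def by (simp add: algebra_simps)
qed

text \<open>The inner product of \<open>L\<^sup>2(T)\<close> is definite on polynomials since a cell has interior points, so the
  functional is represented by exactly one polynomial.\<close>

lemma weak_laplacian_exists_unique:
  fixes \<Omega> :: "'a::euclidean_space set"
  assumes mesh: "is_mesh \<Omega> Th Eh" and ne: "\<forall>e\<in>Eh. is_unit_normal (ne e) e"
    and v: "v \<in> Vh Th Eh k" and T: "T \<in> Th"
  shows "\<exists>!p. p \<in> poly_space r \<and> (\<forall>\<phi>\<in>poly_space r.
    (LINT x|lebesgue_on T. p x * \<phi> x) = weak_laplacian_functional Eh ne v T \<phi>)"
  unfolding poly_space_eq_span
proof (rule riesz_finite_dimensional[OF finite_monomial_functions])
  have sub: "span (monomial_functions r) \<subseteq> {f. L2_fun (lebesgue_on T) f}"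
    using polynomial_L2[OF mesh_cell(1)[OF mesh T]] by (auto simp: poly_space_eq_span[symmetric])
  show "psd_form_on (span (monomial_functions r)) (\<lambda>p q. LINT x|lebesgue_on T. p x * q x)"
    by (rule psd_form_on_subset[OF psd_form_L2 sub])
  show "x = 0" if "x \<in> span (monomial_functions r)" "(LINT y|lebesgue_on T. x y * x y) = 0" for x
    using polynomial_L2_definite[OF mesh_cell(1,2)[OF mesh T], of x r] that
    by (simp add: poly_space_eq_span power2_eq_square)
  show "linear_form_on (span (monomial_functions r)) (weak_laplacian_functional Eh ne v T)"
    unfolding linear_form_on_def poly_space_eq_span[symmetric] scaleR_fun_def plus_fun_def real_scaleR_def
    by (intro ballI allI weak_laplacian_functional_linear[OF mesh ne v T] poly_space_real_polynomial_function)
qed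

lemma weak_laplacian_properties:
  fixes \<Omega> :: "'a::euclidean_space set"
  assumes mesh: "is_mesh \<Omega> Th Eh" and ne: "\<forall>e\<in>Eh. is_unit_normal (ne e) e"
    and v: "v \<in> Vh Th Eh k" and T: "T \<in> Th"
  shows "weak_laplacian Eh ne r v T \<in> poly_space r"
    "\<phi> \<in> poly_space r \<Longrightarrow> (LINT x|lebesgue_on T. weak_laplacian Eh ne r v T x * \<phi> x) = weak_laplacian_functional Eh ne v T \<phi>"
    "p \<in> poly_space r \<Longrightarrow> (\<And>\<phi>. \<phi> \<in> poly_space r \<Longrightarrow>
       (LINT x|lebesgue_on T. p x * \<phi> x) = weak_laplacian_functional Eh ne v T \<phi>) \<Longrightarrow> weak_laplacian Eh ne r v T = p"
proof -
  have eq: "weak_laplacian Eh ne r v T = (THE p. p \<in> poly_space r \<and> (\<forall>\<phi>\<in>poly_space r.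
    (LINT x|lebesgue_on T. p x * \<phi> x) = weak_laplacian_functional Eh ne v T \<phi>))"
    unfolding weak_laplacian_def weak_laplacian_functional_def by (rule refl)
  note ex = weak_laplacian_exists_unique[OF mesh ne v T, of r]
  show "weak_laplacian Eh ne r v T \<in> poly_space r"
    unfolding eq using theI'[OF ex] by (rule conjunct1)
  show "(LINT x|lebesgue_on T. weak_laplacian Eh ne r v T x * \<phi> x) = weak_laplacian_functional Eh ne v T \<phi>"
    if "\<phi> \<in> poly_space r"
    unfolding eq using theI'[OF ex, THEN conjunct2] that by (rule bspec)
  show "weak_laplacian Eh ne r v T = p" if "p \<in> poly_space r" "\<And>\<phi>. \<phi> \<in> poly_space r \<Longrightarrow>
       (LINT x|lebesgue_on T. p x * \<phi> x) = weak_laplacian_functional Eh ne v T \<phi>"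
    unfolding eq using ex that by (intro the1_equality) blast+
qed

section \<open>The vector space of weak functions\<close>

text \<open>Records carry no vector space structure; triples of their components do.\<close>

type_synonym 'a parts =
  "('a set \<Rightarrow> 'a \<Rightarrow> real) \<times> ('a set \<Rightarrow> 'a \<Rightarrow> real) \<times> ('a set \<Rightarrow> 'a \<Rightarrow> real)"

definition of_parts :: "'a parts \<Rightarrow> 'a weak_function" where
  "of_parts w = \<lparr>cell_part = fst w, face_part = fst (snd w), normal_part = snd (snd w)\<rparr>"

lemma of_parts_simps [simp]:
  "cell_part (of_parts w) = fst w" "face_part (of_parts w) = fst (snd w)" "normal_part (of_parts w) = snd (snd w)"
  by (simp_all add: of_parts_def)

lemma of_parts_surj: "\<exists>w. v = of_parts w"
  by (rule exI[of _ "(cell_part v, face_part v, normal_part v)"]) (simp add: of_parts_def)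

definition parts_space ::
    "'a::euclidean_space set \<Rightarrow> 'a set set \<Rightarrow> 'a set set \<Rightarrow> nat \<Rightarrow> 'a parts set" where
  "parts_space \<Omega> Th Eh k = {w. of_parts w \<in> Vh0 \<Omega> Th Eh k}"

lemma subspace_poly_space: "subspace (poly_space k)"
  by (simp add: poly_space_eq_span)

lemma subspace_face_poly_space: "subspace (face_poly_space k e)"
  by (simp add: face_poly_space_eq_span)

lemma parts_space_iff:
  "w \<in> parts_space \<Omega> Th Eh k \<longleftrightarrow>
     (\<forall>T\<in>Th. fst w T \<in> poly_space k) \<and> (\<forall>T. T \<notin> Th \<longrightarrow> fst w T = 0) \<and>
     (\<forall>e\<in>Eh. fst (snd w) e \<in> face_poly_space k e) \<and> (\<forall>e. e \<notin> Eh \<longrightarrow> fst (snd w) e = 0) \<and>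
     (\<forall>e\<in>Eh. snd (snd w) e \<in> face_poly_space (k - 1) e) \<and> (\<forall>e. e \<notin> Eh \<longrightarrow> snd (snd w) e = 0) \<and>
     (\<forall>e\<in>Eh. e \<subseteq> frontier \<Omega> \<longrightarrow> (\<forall>x\<in>e. fst (snd w) e x = 0 \<and> snd (snd w) e x = 0))"
  unfolding parts_space_def Vh0_def Vh_def of_parts_simps zero_fun_def mem_Collect_eq by blast

lemma subspace_parts_space: "subspace (parts_space \<Omega> Th Eh k)"
proof (rule subspaceI)
  show "0 \<in> parts_space \<Omega> Th Eh k"
    by (simp add: parts_space_iff subspace_0[OF subspace_poly_space] subspace_0[OF subspace_face_poly_space])
  show "u + v \<in> parts_space \<Omega> Th Eh k" if "u \<in> parts_space \<Omega> Th Eh k" "v \<in> parts_space \<Omega> Th Eh k" for u v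
    using that
    by (simp add: parts_space_iff subspace_add[OF subspace_poly_space] subspace_add[OF subspace_face_poly_space])
  show "c *\<^sub>R u \<in> parts_space \<Omega> Th Eh k" if "u \<in> parts_space \<Omega> Th Eh k" for c u
    using that
    by (simp add: parts_space_iff subspace_mul[OF subspace_poly_space] subspace_mul[OF subspace_face_poly_space])
qed

text \<open>Together with \<open>triple_in_span\<close> this gives a finite spanning set for families of polynomials that
  are indexed by cells and faces.\<close>

lemma family_in_span:
  fixes B :: "'i \<Rightarrow> 'v::real_vector set"
  assumes "finite A" "\<And>a. a \<in> A \<Longrightarrow> f a \<in> span (B a)" "\<And>a. a \<notin> A \<Longrightarrow> f a = 0"
  shows "f \<in> span (\<Union>a\<in>A. (\<lambda>b a'. if a' = a then b else 0) ` B a)"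
proof -
  have "f = (\<Sum>a\<in>A. (\<lambda>a'. if a' = a then f a else 0))"
  proof
    fix a'
    have "(\<Sum>a\<in>A. (\<lambda>a'. if a' = a then f a else 0)) a' = (\<Sum>a\<in>A. if a' = a then f a else 0)"
      by (rule sum_fun_apply)
    then show "f a' = (\<Sum>a\<in>A. (\<lambda>a'. if a' = a then f a else 0)) a'"
      using assms(1) assms(3)[of a'] by (simp add: sum.delta')
  qed
  also have "\<dots> \<in> span (\<Union>a\<in>A. (\<lambda>b a'. if a' = a then b else 0) ` B a)"
  proof (rule span_sum)
    fix a assume a: "a \<in> A"
    have "linear (\<lambda>b a'. if a' = a then b else (0::'v))"
      by (rule linearI) (auto simp: fun_eq_iff)
    then have img: "span ((\<lambda>b a'. if a' = a then b else (0::'v)) ` B a) = (\<lambda>b a'. if a' = a then b else 0) ` span (B a)"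
      by (rule linear_span_image)
    have "(\<lambda>a'. if a' = a then f a else 0) \<in> span ((\<lambda>b a'. if a' = a then b else 0) ` B a)"
      unfolding img by (rule imageI[OF assms(2)[OF a]])
    moreover have "span ((\<lambda>b a'. if a' = a then b else (0::'v)) ` B a) \<subseteq>
        span (\<Union>a\<in>A. (\<lambda>b a'. if a' = a then b else 0) ` B a)"
      by (rule span_mono) (use a in blast)
    ultimately show "(\<lambda>a'. if a' = a then f a else 0) \<in> span (\<Union>a\<in>A. (\<lambda>b a'. if a' = a then b else 0) ` B a)"
      by (rule subsetD[rotated])
  qed
  finally show ?thesis .
qed

lemma triple_in_span:
  fixes p :: "'u::real_vector" and q :: "'v::real_vector" and s :: "'w::real_vector"
  assumes "p \<in> span A" "q \<in> span B" "s \<in> span C"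
  shows "(p, q, s) \<in> span ((\<lambda>p. (p, 0, 0)) ` A \<union> (\<lambda>q. (0, q, 0)) ` B \<union> (\<lambda>s. (0, 0, s)) ` C)" (is "_ \<in> span ?S")
proof -
  have "linear (\<lambda>p::'u. (p, 0::'v, 0::'w))" "linear (\<lambda>q::'v. (0::'u, q, 0::'w))" "linear (\<lambda>s::'w. (0::'u, 0::'v, s))"
    by (auto intro: linearI)
  note l = this[THEN linear_span_image]
  have "(p, 0, 0) \<in> span ((\<lambda>p. (p, 0::'v, 0::'w)) ` A)" using assms(1) unfolding l(1) by blast
  moreover have "(0, q, 0) \<in> span ((\<lambda>q. (0::'u, q, 0::'w)) ` B)" using assms(2) unfolding l(2) by blast
  moreover have "(0, 0, s) \<in> span ((\<lambda>s. (0::'u, 0::'v, s)) ` C)" using assms(3) unfolding l(3) by blast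
  ultimately have "(p, 0, 0) \<in> span ?S" "(0, q, 0) \<in> span ?S" "(0, 0, s) \<in> span ?S"
    using span_mono[of "(\<lambda>p. (p, 0, 0)) ` A" ?S] span_mono[of "(\<lambda>q. (0, q, 0)) ` B" ?S]
      span_mono[of "(\<lambda>s. (0, 0, s)) ` C" ?S] by blast+
  then have "(p, 0, 0) + (0, q, 0) + (0, 0, s) \<in> span ?S" by (intro span_add)
  then show ?thesis by simp
qed

lemma parts_space_finite_dimensional:
  assumes "finite Th" "finite Eh"
  shows "\<exists>S. finite S \<and> parts_space \<Omega> Th Eh k = span S"
proof -
  define A where "A = (\<Union>T\<in>Th. (\<lambda>b T'. if T' = T then b else 0) ` (monomial_functions k :: ('a \<Rightarrow> real) set))"
  define B where "B k = (\<Union>e\<in>Eh. (\<lambda>b e'. if e' = e then b else 0) ` restrict_fun e ` monomial_functions k)" for k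
  define S0 where "S0 = (\<lambda>p. (p, 0, 0)) ` A \<union> (\<lambda>q. (0, q, 0)) ` B k \<union> (\<lambda>s. (0, 0, s)) ` B (k - 1)"
  have fin: "finite S0"
    unfolding S0_def A_def B_def using assms by (intro finite_UnI finite_imageI finite_UN_I finite_monomial_functions)
  have sub: "parts_space \<Omega> Th Eh k \<subseteq> span S0"
  proof
    fix w assume w: "w \<in> parts_space \<Omega> Th Eh k"
    obtain p q s where pqs: "w = (p, q, s)" by (cases w) auto
    have "p \<in> span A"
      unfolding A_def using w by (intro family_in_span assms) (auto simp: parts_space_iff pqs poly_space_eq_span)
    moreover have "q \<in> span (B k)"
      unfolding B_def using w by (intro family_in_span assms) (auto simp: parts_space_iff pqs face_poly_space_eq_span)
    moreover have "s \<in> span (B (k - 1))"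
      unfolding B_def using w by (intro family_in_span assms) (auto simp: parts_space_iff pqs face_poly_space_eq_span)
    ultimately show "w \<in> span S0" unfolding pqs S0_def by (rule triple_in_span)
  qed
  obtain S where S: "S \<subseteq> parts_space \<Omega> Th Eh k" "independent S" "parts_space \<Omega> Th Eh k \<subseteq> span S"
    using maximal_independent_subset by blast
  have "finite S"
    using independent_span_bound[OF fin S(2)] S(1) sub by blast
  moreover have "span S \<subseteq> parts_space \<Omega> Th Eh k"
    using S(1) by (intro span_minimal subspace_parts_space)
  ultimately show ?thesis using S(3) by blast
qed

lemma cell_inner_linear:
  assumes "\<And>T. T \<in> Th \<Longrightarrow> L2_fun (lebesgue_on T) (p T)" "\<And>T. T \<in> Th \<Longrightarrow> L2_fun (lebesgue_on T) (q T)"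
    "\<And>T. T \<in> Th \<Longrightarrow> L2_fun (lebesgue_on T) (q' T)"
    and eq: "\<And>T. T \<in> Th \<Longrightarrow> z T = (\<lambda>x. a * q T x + b * q' T x)"
  shows "cell_inner Th p z = a * cell_inner Th p q + b * cell_inner Th p q'"
proof -
  have "(LINT x|lebesgue_on T. p T x * z T x) =
    a * (LINT x|lebesgue_on T. p T x * q T x) + b * (LINT x|lebesgue_on T. p T x * q' T x)" if "T \<in> Th" for T
    using L2_fun_mult_integrable[OF assms(1,2)[OF that]] L2_fun_mult_integrable[OF assms(1,3)[OF that]]
    by (simp add: eq[OF that] distrib_left mult.left_commute)
  then show ?thesis by (simp add: cell_inner_def sum.distrib sum_distrib_left)
qed

lemma cell_inner_commute: "cell_inner Th p q = cell_inner Th q p"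
  by (simp add: cell_inner_def mult.commute)

lemma cell_inner_nonneg: "0 \<le> cell_inner Th p p"
  unfolding cell_inner_def by (intro sum_nonneg integral_nonneg_AE) simp

definition mass_form :: "'a::euclidean_space set set \<Rightarrow> 'a parts \<Rightarrow> 'a parts \<Rightarrow> real" where
  "mass_form Th u v = cell_inner Th (fst u) (fst v)"

definition stiffness_form ::
    "'a::euclidean_space set set \<Rightarrow> 'a set set \<Rightarrow> ('a set \<Rightarrow> 'a) \<Rightarrow> nat \<Rightarrow> 'a parts \<Rightarrow> 'a parts \<Rightarrow> real" where
  "stiffness_form Th Eh ne r u v =
     cell_inner Th (weak_laplacian Eh ne r (of_parts u)) (weak_laplacian Eh ne r (of_parts v))"

lemma parts_space_combination:
  assumes "u \<in> parts_space \<Omega> Th Eh k" "v \<in> parts_space \<Omega> Th Eh k"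
  shows "a *\<^sub>R u + b *\<^sub>R v \<in> parts_space \<Omega> Th Eh k"
  using assms by (intro subspace_add subspace_mul subspace_parts_space)

lemma cell_parts_L2:
  assumes "is_mesh \<Omega> Th Eh" "u \<in> parts_space \<Omega>' Th Eh k" "T \<in> Th"
  shows "L2_fun (lebesgue_on T) (fst u T)"
  using assms by (intro polynomial_L2[OF mesh_cell(1)]) (auto simp: parts_space_iff)

lemma load_linear_form:
  assumes mesh: "is_mesh \<Omega> Th Eh" and g: "\<And>T. T \<in> Th \<Longrightarrow> L2_fun (lebesgue_on T) (g T)"
  shows "linear_form_on (parts_space \<Omega> Th Eh k) (\<lambda>v. cell_inner Th g (fst v))"
  unfolding linear_form_on_def
proof (intro ballI allI)
  fix u v a b assume uv: "u \<in> parts_space \<Omega> Th Eh k" "v \<in> parts_space \<Omega> Th Eh k"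
  show "cell_inner Th g (fst (a *\<^sub>R u + b *\<^sub>R v)) = a * cell_inner Th g (fst u) + b * cell_inner Th g (fst v)"
    by (rule cell_inner_linear) (auto simp: g cell_parts_L2[OF mesh uv(1)] cell_parts_L2[OF mesh uv(2)] fun_eq_iff)
qed

lemma mass_form_psd:
  assumes mesh: "is_mesh \<Omega> Th Eh"
  shows "psd_form_on (parts_space \<Omega> Th Eh k) (mass_form Th)"
  unfolding psd_form_on_def mass_form_def
  by (intro conjI ballI load_linear_form[OF mesh] cell_parts_L2[OF mesh] cell_inner_nonneg)
    (auto intro: cell_inner_commute)

text \<open>The face and normal parts of a null vector of the mass form may be arbitrary; the cell parts
  are zero even as functions on the whole space.\<close>

lemma mass_form_null:
  assumes mesh: "is_mesh \<Omega> Th Eh" and u: "u \<in> parts_space \<Omega> Th Eh k" "mass_form Th u u = 0"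
  shows "fst u = 0"
proof
  fix T
  show "fst u T = 0 T"
  proof (cases "T \<in> Th")
    case True
    have "\<forall>T\<in>Th. (LINT x|lebesgue_on T. fst u T x * fst u T x) = 0"
      using u(2) mesh_finite(1)[OF mesh] unfolding mass_form_def cell_inner_def
      by (subst (asm) sum_nonneg_eq_0_iff) (auto intro!: integral_nonneg_AE)
    then have "(LINT x|lebesgue_on T. (fst u T x)\<^sup>2) = 0" using True by (simp add: power2_eq_square)
    then show ?thesis
      using polynomial_L2_definite[OF mesh_cell(1,2)[OF mesh True], of "fst u T" k] u(1) True
      by (simp add: parts_space_iff)
  next
    case False
    then show ?thesis using u(1) by (simp add: parts_space_iff)
  qed
qed

lemma parts_space_Vh: "u \<in> parts_space \<Omega> Th Eh k \<Longrightarrow> of_parts u \<in> Vh Th Eh k"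
  by (simp add: parts_space_def Vh0_def)

text \<open>The combination of the weak Laplacians solves the problem that determines the weak Laplacian
  of the combination uniquely.\<close>

lemma weak_laplacian_linear:
  fixes \<Omega> :: "'a::euclidean_space set"
  assumes mesh: "is_mesh \<Omega> Th Eh" and ne: "\<forall>e\<in>Eh. is_unit_normal (ne e) e"
    and u: "u \<in> parts_space \<Omega> Th Eh k" and v: "v \<in> parts_space \<Omega> Th Eh k" and T: "T \<in> Th"
  shows "weak_laplacian Eh ne r (of_parts (a *\<^sub>R u + b *\<^sub>R v)) T =
    (\<lambda>x. a * weak_laplacian Eh ne r (of_parts u) T x + b * weak_laplacian Eh ne r (of_parts v) T x)"
    (is "_ = ?p")
proof (rule weak_laplacian_properties(3)[OF mesh ne parts_space_Vh[OF parts_space_combination[OF u v]] T])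
  note uV = parts_space_Vh[OF u] and vV = parts_space_Vh[OF v]
  note Lu = weak_laplacian_properties[where r = r, OF mesh ne uV T] and Lv = weak_laplacian_properties[where r = r, OF mesh ne vV T]
  have "a *\<^sub>R weak_laplacian Eh ne r (of_parts u) T + b *\<^sub>R weak_laplacian Eh ne r (of_parts v) T \<in> poly_space r"
    using Lu(1) Lv(1) by (intro subspace_add subspace_mul subspace_poly_space)
  then show "?p \<in> poly_space r" by (simp add: scaleR_fun_def plus_fun_def)
  fix \<phi> :: "'a \<Rightarrow> real" assume \<phi>: "\<phi> \<in> poly_space r"
  note L2 = polynomial_L2[OF mesh_cell(1)[OF mesh T]]
  note iu = weak_laplacian_summands_integrable[OF mesh ne uV T poly_space_real_polynomial_function[OF \<phi>]]
  note iv = weak_laplacian_summands_integrable[OF mesh ne vV T poly_space_real_polynomial_function[OF \<phi>]]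
  have "(LINT x|lebesgue_on T. ?p x * \<phi> x) =
    a * (LINT x|lebesgue_on T. weak_laplacian Eh ne r (of_parts u) T x * \<phi> x) +
    b * (LINT x|lebesgue_on T. weak_laplacian Eh ne r (of_parts v) T x * \<phi> x)"
    using L2_fun_mult_integrable[OF L2[OF Lu(1)] L2[OF \<phi>]] L2_fun_mult_integrable[OF L2[OF Lv(1)] L2[OF \<phi>]]
    by (simp add: distrib_right mult.assoc)
  also have "\<dots> = a * weak_laplacian_functional Eh ne (of_parts u) T \<phi> + b * weak_laplacian_functional Eh ne (of_parts v) T \<phi>"
    by (simp only: Lu(2)[OF \<phi>] Lv(2)[OF \<phi>])
  also have "\<dots> = weak_laplacian_functional Eh ne (of_parts (a *\<^sub>R u + b *\<^sub>R v)) T \<phi>"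
  proof -
    let ?A = "\<lambda>v. LINT x|lebesgue_on T. cell_part v T x * laplacian \<phi> x"
    let ?B = "\<lambda>v. \<Sum>e\<in>faces_of Eh T. LINT x|face_measure e. face_part v e x * (gradient \<phi> x \<bullet> outward_normal T e)"
    let ?C = "\<lambda>v. \<Sum>e\<in>faces_of Eh T. LINT x|face_measure e. normal_part v e x * (ne e \<bullet> outward_normal T e) * \<phi> x"
    let ?w = "of_parts (a *\<^sub>R u + b *\<^sub>R v)"
    have "?A ?w = a * ?A (of_parts u) + b * ?A (of_parts v)"
      using iu(1) iv(1) by (simp add: distrib_right mult.assoc)
    moreover have "?B ?w = a * ?B (of_parts u) + b * ?B (of_parts v)"
      by (rule sum_of_integrals_linear[OF iu(2) iv(2)]) (simp_all add: distrib_right mult.assoc)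
    moreover have "?C ?w = a * ?C (of_parts u) + b * ?C (of_parts v)"
      by (rule sum_of_integrals_linear[OF iu(3) iv(3)]) (simp_all add: distrib_right mult.assoc)
    ultimately show ?thesis unfolding weak_laplacian_functional_def by (simp add: algebra_simps)
  qed
  finally show "(LINT x|lebesgue_on T. ?p x * \<phi> x) = weak_laplacian_functional Eh ne (of_parts (a *\<^sub>R u + b *\<^sub>R v)) T \<phi>" .
qed

lemma stiffness_form_psd:
  assumes mesh: "is_mesh \<Omega> Th Eh" and ne: "\<forall>e\<in>Eh. is_unit_normal (ne e) e"
  shows "psd_form_on (parts_space \<Omega> Th Eh k) (stiffness_form Th Eh ne r)"
proof -
  have L2: "L2_fun (lebesgue_on T) (weak_laplacian Eh ne r (of_parts u) T)"
    if "u \<in> parts_space \<Omega> Th Eh k" "T \<in> Th" for u T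
    by (rule polynomial_L2[OF mesh_cell(1)[OF mesh that(2)]
          weak_laplacian_properties(1)[OF mesh ne parts_space_Vh[OF that(1)] that(2)]])
  have "linear_form_on (parts_space \<Omega> Th Eh k) (stiffness_form Th Eh ne r u)"
    if u: "u \<in> parts_space \<Omega> Th Eh k" for u
    unfolding linear_form_on_def stiffness_form_def
  proof (intro ballI allI)
    fix v w a b assume vw: "v \<in> parts_space \<Omega> Th Eh k" "w \<in> parts_space \<Omega> Th Eh k"
    show "cell_inner Th (weak_laplacian Eh ne r (of_parts u)) (weak_laplacian Eh ne r (of_parts (a *\<^sub>R v + b *\<^sub>R w))) =
      a * cell_inner Th (weak_laplacian Eh ne r (of_parts u)) (weak_laplacian Eh ne r (of_parts v)) +
      b * cell_inner Th (weak_laplacian Eh ne r (of_parts u)) (weak_laplacian Eh ne r (of_parts w))"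
      by (rule cell_inner_linear[OF L2[OF u] L2[OF vw(1)] L2[OF vw(2)] weak_laplacian_linear[OF mesh ne vw]])
  qed
  moreover have "stiffness_form Th Eh ne r u v = stiffness_form Th Eh ne r v u" "0 \<le> stiffness_form Th Eh ne r u u" for u v
    unfolding stiffness_form_def by (rule cell_inner_commute, rule cell_inner_nonneg)
  ultimately show ?thesis unfolding psd_form_on_def by blast
qed

section \<open>Scalar evolution equations\<close>

definition time_H1 :: "real \<Rightarrow> (real \<Rightarrow> real) \<Rightarrow> (real \<Rightarrow> real) \<Rightarrow> bool" where
  "time_H1 tb y w \<longleftrightarrow> L2_fun (lebesgue_on {0<..<tb}) y \<and> L2_fun (lebesgue_on {0<..<tb}) w \<and>
     weak_deriv {0<..<tb} [1] y w"

lemma finite_measure_time: "finite_measure (lebesgue_on {0<..<tb::real})"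
  by (intro finite_measure_lebesgue_on) (simp add: lmeasurable_interval)

lemma continuous_on_UNIV_L2_time:
  assumes "continuous_on UNIV (g :: real \<Rightarrow> real)"
  shows "L2_fun (lebesgue_on {0<..<tb}) g"
proof -
  have "bounded (g ` {0..tb})"
    by (intro compact_imp_bounded compact_continuous_image continuous_on_subset[OF assms]) auto
  then obtain B where B: "\<forall>x\<in>{0..tb}. \<bar>g x\<bar> \<le> B" by (auto simp: bounded_iff)
  show ?thesis
  proof (rule L2_fun_finite_measure[OF finite_measure_time])
    show "g \<in> borel_measurable (lebesgue_on {0<..<tb})"
      using borel_measurable_continuous_onI[OF assms]
      by (intro measurable_restrict_space1 measurable_completion) simp
    show "AE x in lebesgue_on {0<..<tb}. \<bar>g x\<bar> \<le> B"
      by (intro AE_I2) (use B in \<open>simp add: space_restrict_space\<close>)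
  qed
qed

lemma test_function_derivative:
  fixes \<phi> :: "real \<Rightarrow> real"
  assumes "test_function S \<phi>"
  shows "(\<phi> has_real_derivative iter_partial [1] \<phi> t) (at t)"
    "continuous_on A \<phi>" "continuous_on A (iter_partial [1] \<phi>)"
proof -
  have "\<phi> differentiable at t" using test_function_smooth(1)[OF assms, of "[]"] by (simp add: iter_partial_Nil)
  then have "(\<phi> has_derivative frechet_derivative \<phi> (at t)) (at t)" by (simp add: frechet_derivative_works)
  moreover have "frechet_derivative \<phi> (at t) = (\<lambda>r. iter_partial [1] \<phi> t * r)"
  proof
    fix r :: real
    have "frechet_derivative \<phi> (at t) (r *\<^sub>R 1) = r *\<^sub>R frechet_derivative \<phi> (at t) 1"
      by (rule linear_cmul[OF has_derivative_linear[OF calculation]])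
    then show "frechet_derivative \<phi> (at t) r = iter_partial [1] \<phi> t * r"
      by (simp add: iter_partial_Cons iter_partial_Nil partial_def mult.commute)
  qed
  ultimately show "(\<phi> has_real_derivative iter_partial [1] \<phi> t) (at t)"
    by (simp add: has_field_derivative_def)
  show "continuous_on A \<phi>" using test_function_smooth(2)[OF assms, of "[]"] by (simp add: iter_partial_Nil)
  show "continuous_on A (iter_partial [1] \<phi>)" by (rule test_function_smooth(2)[OF assms]) simp
qed

lemma time_H1_sum:
  assumes "\<And>i. i \<in> I \<Longrightarrow> time_H1 tb (y i) (w i)"
  shows "time_H1 tb (\<lambda>t. \<Sum>i\<in>I. c i * y i t) (\<lambda>t. \<Sum>i\<in>I. c i * w i t)"
proof -
  let ?M = "lebesgue_on {0<..<tb}"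
  have y: "L2_fun ?M (y i)" and w: "L2_fun ?M (w i)" and d: "weak_deriv {0<..<tb} [1] (y i) (w i)"
    if "i \<in> I" for i
    using assms[OF that] by (auto simp: time_H1_def)
  have "weak_deriv {0<..<tb} [1] (\<lambda>t. \<Sum>i\<in>I. c i * y i t) (\<lambda>t. \<Sum>i\<in>I. c i * w i t)"
    unfolding weak_deriv_def
  proof (intro allI impI)
    fix \<phi> :: "real \<Rightarrow> real" assume \<phi>: "test_function {0<..<tb} \<phi>"
    note L2\<phi> = continuous_on_UNIV_L2_time[OF test_function_derivative(2)[OF \<phi>], of tb]
    note L2\<phi>' = continuous_on_UNIV_L2_time[OF test_function_derivative(3)[OF \<phi>], of tb]
    have "(LINT t|?M. (\<Sum>i\<in>I. c i * y i t) * iter_partial [1] \<phi> t) =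
        (LINT t|?M. (\<Sum>i\<in>I. c i * (y i t * iter_partial [1] \<phi> t)))"
      by (simp add: sum_distrib_right mult.assoc)
    also have "\<dots> = (\<Sum>i\<in>I. c i * (LINT t|?M. y i t * iter_partial [1] \<phi> t))"
      using L2_fun_mult_integrable[OF y L2\<phi>'] by (subst Bochner_Integration.integral_sum) auto
    also have "\<dots> = (\<Sum>i\<in>I. - (c i * (LINT t|?M. w i t * \<phi> t)))"
    proof (rule sum.cong[OF refl])
      fix i assume "i \<in> I"
      then have "(LINT t|?M. y i t * iter_partial [1] \<phi> t) = (-1) ^ length [1::real] * (LINT t|?M. w i t * \<phi> t)"
        using d \<phi> unfolding weak_deriv_def by blast
      then show "c i * (LINT t|?M. y i t * iter_partial [1] \<phi> t) = - (c i * (LINT t|?M. w i t * \<phi> t))" by simp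
    qed
    also have "\<dots> = (-1) ^ length [1::real] * (\<Sum>i\<in>I. c i * (LINT t|?M. w i t * \<phi> t))"
      by (simp add: sum_negf)
    also have "(\<Sum>i\<in>I. c i * (LINT t|?M. w i t * \<phi> t)) = (LINT t|?M. (\<Sum>i\<in>I. c i * (w i t * \<phi> t)))"
      using L2_fun_mult_integrable[OF w L2\<phi>] by (subst Bochner_Integration.integral_sum) auto
    also have "\<dots> = (LINT t|?M. (\<Sum>i\<in>I. c i * w i t) * \<phi> t)"
      by (simp add: sum_distrib_right mult.assoc)
    finally show "(LINT t|?M. (\<Sum>i\<in>I. c i * y i t) * iter_partial [1] \<phi> t) =
      (-1) ^ length [1::real] * (LINT t|?M. (\<Sum>i\<in>I. c i * w i t) * \<phi> t)" .
  qed
  moreover have "L2_fun ?M (\<lambda>t. \<Sum>i\<in>I. c i * y i t)"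
    by (rule L2_fun_sum, rule L2_fun_scale, rule y)
  moreover have "L2_fun ?M (\<lambda>t. \<Sum>i\<in>I. c i * w i t)"
    by (rule L2_fun_sum, rule L2_fun_scale, rule w)
  ultimately show ?thesis unfolding time_H1_def by blast
qed

text \<open>Since the derivative vanishes at both ends, the integrand over the open interval agrees everywhere
  with the one over \<open>[s,tb]\<close>.\<close>

lemma integral_to_endpoint:
  fixes F F' :: "real \<Rightarrow> real"
  assumes s: "0 \<le> s" "s < tb" and der: "\<And>t. (F has_real_derivative F' t) (at t)"
    and cont: "continuous_on UNIV F'" and zero: "F' 0 = 0" "F' tb = 0" "F tb = 0"
  shows "(LINT t|lebesgue_on {0<..<tb}. indicator {s..} t * F' t) = - F s"
proof -
  have [measurable]: "F' \<in> borel_measurable borel" using cont by (rule borel_measurable_continuous_onI)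
  have "(LINT t|lebesgue_on {0<..<tb}. indicator {s..} t * F' t) =
      (LINT t|lebesgue. indicator {0<..<tb} t *\<^sub>R (indicator {s..} t * F' t))"
    by (subst integral_restrict_space) auto
  also have "\<dots> = (LINT t|lebesgue. F' t * indicator {s..tb} t)"
  proof (rule Bochner_Integration.integral_cong)
    fix t
    show "indicator {0<..<tb} t *\<^sub>R (indicator {s..} t * F' t) = F' t * indicator {s..tb} t"
      using s zero by (cases "t = 0"; cases "t = tb") (auto simp: indicator_def)
  qed simp
  also have "\<dots> = (LINT t|lborel. F' t * indicator {s..tb} t)"
    by (intro integral_completion) measurable
  also have "\<dots> = F tb - F s"
    using s der cont by (intro integral_FTC_Icc_real) (auto simp: continuous_on_eq_continuous_at)
  finally show ?thesis using zero by simp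
qed

text \<open>The integrands converge except at \<open>s = t\<close> and are dominated by \<open>\<bar>H\<bar>\<close>.\<close>

lemma continuous_indefinite_integral:
  fixes H :: "real \<Rightarrow> real"
  assumes H: "integrable (lebesgue_on {0<..<tb}) H"
  shows "continuous_on UNIV (\<lambda>t. LINT s|lebesgue_on {0<..<tb}. indicator {..t} s * H s)"
  unfolding continuous_on_sequentially
proof (intro ballI allI impI)
  let ?M = "lebesgue_on {0<..<tb}"
  have [measurable]: "H \<in> borel_measurable ?M" using H by auto
  have ind [measurable]: "(\<lambda>s. indicator {..t} s :: real) \<in> borel_measurable ?M" for t :: real
    by (intro measurable_restrict_space1 measurable_completion) simp
  fix X :: "nat \<Rightarrow> real" and t assume "(\<forall>n. X n \<in> UNIV) \<and> X \<longlonglongrightarrow> t"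
  then have X: "X \<longlonglongrightarrow> t" by simp
  have "(\<lambda>n. LINT s|?M. indicator {..X n} s * H s) \<longlonglongrightarrow> (LINT s|?M. indicator {..t} s * H s)"
  proof (rule integral_dominated_convergence[where w = "\<lambda>s. norm (H s)"])
    have "{t} \<in> null_sets lebesgue" by (simp add: negligible_iff_null_sets[symmetric])
    then have "AE s in lebesgue. s \<noteq> t" using AE_not_in by fastforce
    then have "AE s in ?M. s \<noteq> t" by (subst AE_restrict_space_iff) auto
    then show "AE s in ?M. (\<lambda>n. indicator {..X n} s * H s) \<longlonglongrightarrow> indicator {..t} s * H s"
    proof eventually_elim
      case (elim s)
      have "eventually (\<lambda>n. indicator {..X n} s * H s = indicator {..t} s * H s) sequentially"
      proof (cases "s < t")
        case True
        then have "eventually (\<lambda>n. s < X n) sequentially" using order_tendstoD(1)[OF X] by blast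
        then show ?thesis by eventually_elim (use True in simp)
      next
        case False
        then have "t < s" using elim by simp
        then have "eventually (\<lambda>n. X n < s) sequentially" using order_tendstoD(2)[OF X] by blast
        then show ?thesis by eventually_elim (use \<open>t < s\<close> in simp)
      qed
      then show ?case by (rule tendsto_eventually)
    qed
    show "AE s in ?M. norm (indicator {..X n} s * H s) \<le> norm (H s)" for n
      by (intro AE_I2) (simp add: indicator_def)
  qed (use H in auto)
  then show "((\<lambda>t. LINT s|?M. indicator {..t} s * H s) \<circ> X) \<longlonglongrightarrow> (LINT s|?M. indicator {..t} s * H s)"
    by (simp add: o_def)
qed

text \<open>As \<open>H\<close> is merely integrable, integration by parts is not available through derivatives; it is
  Fubini's theorem on the triangle \<open>s \<le> t\<close>.\<close>

lemma indefinite_integral_by_parts: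
  fixes H F F' :: "real \<Rightarrow> real"
  assumes H: "integrable (lebesgue_on {0<..<tb}) H" and der: "\<And>t. (F has_real_derivative F' t) (at t)"
    and cont: "continuous_on UNIV F'" and zero: "F' 0 = 0" "F' tb = 0" "F tb = 0"
  shows "(LINT t|lebesgue_on {0<..<tb}. (LINT s|lebesgue_on {0<..<tb}. indicator {..t} s * H s) * F' t) =
    - (LINT s|lebesgue_on {0<..<tb}. H s * F s)"
proof -
  let ?M = "lebesgue_on {0<..<tb}"
  interpret M: finite_measure ?M by (rule finite_measure_time)
  interpret pair_sigma_finite ?M ?M by standard
  have F'_L2: "L2_fun ?M F'" using cont by (rule continuous_on_UNIV_L2_time)
  have F'_int: "integrable ?M F'"
    using L2_fun_mult_integrable[OF F'_L2 continuous_on_UNIV_L2_time[OF continuous_on_const[of _ 1]]] by simp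
  have [measurable]: "H \<in> borel_measurable ?M" "F' \<in> borel_measurable ?M" using H F'_int by auto
  have [measurable]: "(\<lambda>t. t) \<in> borel_measurable ?M"
    by (intro measurable_restrict_space1 measurable_completion) simp
  have prod: "integrable (?M \<Otimes>\<^sub>M ?M) (\<lambda>(s, t). H s * F' t)"
  proof (rule Fubini_integrable)
    show "integrable ?M (\<lambda>s. LINT t|?M. norm (case (s, t) of (s, t) \<Rightarrow> H s * F' t))"
      using H by (simp add: abs_mult)
    show "AE s in ?M. integrable ?M (\<lambda>t. case (s, t) of (s, t) \<Rightarrow> H s * F' t)"
      using F'_int by simp
  qed measurable
  have tri: "integrable (?M \<Otimes>\<^sub>M ?M) (\<lambda>(s, t). (if s \<le> t then 1 else 0) * (H s * F' t))"
    by (rule Bochner_Integration.integrable_bound[OF prod]) (auto simp: case_prod_beta intro!: AE_I2)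
  have "(LINT t|?M. (LINT s|?M. indicator {..t} s * H s) * F' t) =
    (LINT t|?M. (LINT s|?M. (if s \<le> t then 1 else 0) * (H s * F' t)))"
  proof (rule Bochner_Integration.integral_cong[OF refl])
    fix t
    have "(LINT s|?M. (if s \<le> t then 1 else 0) * (H s * F' t)) = (LINT s|?M. indicator {..t} s * H s * F' t)"
      by (intro Bochner_Integration.integral_cong) (auto simp: indicator_def)
    then show "(LINT s|?M. indicator {..t} s * H s) * F' t = (LINT s|?M. (if s \<le> t then 1 else 0) * (H s * F' t))"
      by simp
  qed
  also have "\<dots> = (LINT s|?M. (LINT t|?M. (if s \<le> t then 1 else 0) * (H s * F' t)))"
    by (rule Fubini_integral[OF tri])
  also have "\<dots> = (LINT s|?M. - (H s * F s))"
  proof (rule Bochner_Integration.integral_cong[OF refl])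
    fix s assume "s \<in> space ?M"
    then have s: "0 \<le> s" "s < tb" by (auto simp: space_restrict_space)
    have "(LINT t|?M. (if s \<le> t then 1 else 0) * (H s * F' t)) = (LINT t|?M. H s * (indicator {s..} t * F' t))"
      by (intro Bochner_Integration.integral_cong) (auto simp: indicator_def)
    also have "\<dots> = H s * (LINT t|?M. indicator {s..} t * F' t)" by simp
    also have "\<dots> = - (H s * F s)" using integral_to_endpoint[OF s der cont zero] by simp
    finally show "(LINT t|?M. (if s \<le> t then 1 else 0) * (H s * F' t)) = - (H s * F s)" .
  qed
  finally show ?thesis by simp
qed

text \<open>Variation of constants gives \<open>y\<close> as the product of \<open>exp (- c t)\<close> and an indefinite integral. Such
  a product need not be differentiable everywhere, so its weak derivative is computed by moving the
  exponential factor to the test function.\<close>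

lemma scalar_evolution:
  fixes G :: "real \<Rightarrow> real"
  assumes tb: "0 < tb" and G: "L2_fun (lebesgue_on {0<..<tb}) G"
  shows "\<exists>y. continuous_on UNIV y \<and> y 0 = y0 \<and> time_H1 tb y (\<lambda>t. G t - c * y t)"
proof -
  let ?M = "lebesgue_on {0<..<tb}"
  define H where "H s = exp (c * s) * G s" for s
  define I where "I t = (LINT s|?M. indicator {..t} s * H s)" for t
  define y where "y t = exp (- c * t) * (y0 + I t)" for t
  have H: "integrable ?M H"
    unfolding H_def by (rule L2_fun_mult_integrable[OF continuous_on_UNIV_L2_time G]) (intro continuous_intros)
  have I_cont: "continuous_on UNIV I"
    unfolding I_def[abs_def] by (rule continuous_indefinite_integral[OF H])
  have y_cont: "continuous_on UNIV y"
    unfolding y_def[abs_def] by (intro continuous_on_mult continuous_on_add continuous_on_exp continuous_on_const continuous_on_id I_cont)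
  have "I 0 = (LINT s|?M. 0)"
    unfolding I_def by (intro Bochner_Integration.integral_cong) (auto simp: space_restrict_space)
  then have y_0: "y 0 = y0" by (simp add: y_def)
  have y_L2: "L2_fun ?M y" by (rule continuous_on_UNIV_L2_time[OF y_cont])
  have "weak_deriv {0<..<tb} [1] y (\<lambda>t. G t - c * y t)"
    unfolding weak_deriv_def
  proof (intro allI impI)
    fix \<phi> :: "real \<Rightarrow> real" assume \<phi>: "test_function {0<..<tb} \<phi>"
    define \<phi>' where "\<phi>' = iter_partial [1] \<phi>"
    note d\<phi> = test_function_derivative[OF \<phi>, folded \<phi>'_def]
    obtain K where K: "compact K" "K \<subseteq> {0<..<tb}" "\<And>bs t. t \<notin> K \<Longrightarrow> iter_partial bs \<phi> t = 0"
      by (rule test_function_support[OF \<phi>]) (rule that)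
    have zero: "\<phi> t = 0" "\<phi>' t = 0" if "t \<notin> {0<..<tb}" for t
    proof -
      have "t \<notin> K" using K(2) that by blast
      then show "\<phi> t = 0" "\<phi>' t = 0"
        using K(3)[of t "[]"] K(3)[of t "[1]"] by (simp_all add: iter_partial_Nil \<phi>'_def)
    qed
    note L2\<phi> = continuous_on_UNIV_L2_time[OF d\<phi>(2), of tb] and L2\<phi>' = continuous_on_UNIV_L2_time[OF d\<phi>(3), of tb]
    define F F' where "F t = exp (- c * t) * \<phi> t" and "F' t = exp (- c * t) * \<phi>' t - c * F t" for t
    have F: "(F has_real_derivative F' t) (at t)" for t
    proof -
      have "((\<lambda>t. exp (- c * t)) has_real_derivative - c * exp (- c * t)) (at t)"
        by (rule derivative_eq_intros refl | simp)+
      from DERIV_mult'[OF this d\<phi>(1)] show ?thesis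
        by (simp add: F_def[abs_def] F'_def mult.assoc)
    qed
    have F'_cont: "continuous_on UNIV F'"
      unfolding F'_def[abs_def] F_def by (intro continuous_intros d\<phi>)
    have F_zero: "F' 0 = 0" "F' tb = 0" "F tb = 0" "F 0 = 0" using zero by (auto simp: F_def F'_def)
    have F'_L2: "L2_fun ?M F'" using F'_cont by (rule continuous_on_UNIV_L2_time)
    have F'_int: "integrable ?M F'"
      using L2_fun_mult_integrable[OF F'_L2 continuous_on_UNIV_L2_time[OF continuous_on_const[of _ 1]]] by simp
    have IF': "integrable ?M (\<lambda>t. I t * F' t)"
      by (intro L2_fun_mult_integrable F'_L2 continuous_on_UNIV_L2_time I_cont)
    have y\<phi>: "integrable ?M (\<lambda>t. y t * \<phi> t)" by (rule L2_fun_mult_integrable[OF y_L2 L2\<phi>])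
    have "(LINT t|?M. F' t) = (LINT t|?M. indicator {0..} t * F' t)"
      by (intro Bochner_Integration.integral_cong) (auto simp: space_restrict_space)
    also have "\<dots> = 0" using integral_to_endpoint[OF order_refl tb F F'_cont F_zero(1,2,3)] F_zero by simp
    finally have int_F': "(LINT t|?M. F' t) = 0" .
    have "y t * \<phi>' t = y0 * F' t + I t * F' t + c * (y t * \<phi> t)" for t
      unfolding y_def F'_def F_def by (simp only: ring_distribs diff_conv_add_uminus mult_minus_right mult_ac)
    then have "(LINT t|?M. y t * \<phi>' t) = (LINT t|?M. y0 * F' t + I t * F' t + c * (y t * \<phi> t))" by (simp only:)
    also have "\<dots> = (LINT t|?M. I t * F' t) + c * (LINT t|?M. y t * \<phi> t)"
      using F'_int IF' y\<phi> int_F' by simp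
    also have "(LINT t|?M. I t * F' t) = - (LINT t|?M. H t * F t)"
      unfolding I_def by (rule indefinite_integral_by_parts[OF H F F'_cont F_zero(1,2,3)])
    also have "(\<lambda>t. H t * F t) = (\<lambda>t. G t * \<phi> t)"
    proof
      fix t
      have "exp (c * t) * exp (- c * t) = 1" by (simp flip: exp_add)
      then have "exp (c * t) * exp (- c * t) * (G t * \<phi> t) = G t * \<phi> t" by (simp only: mult_1)
      then show "H t * F t = G t * \<phi> t" unfolding H_def F_def by (simp only: mult_ac)
    qed
    also have "- (LINT t|?M. G t * \<phi> t) + c * (LINT t|?M. y t * \<phi> t) = - (LINT t|?M. G t * \<phi> t - c * (y t * \<phi> t))"
      using y\<phi> L2_fun_mult_integrable[OF G L2\<phi>] by simp
    also have "\<dots> = (-1) ^ length [1::real] * (LINT t|?M. (G t - c * y t) * \<phi> t)"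
      by (simp add: left_diff_distrib mult.assoc)
    finally show "(LINT t|?M. y t * iter_partial [1] \<phi> t) = (-1) ^ length [1::real] * (LINT t|?M. (G t - c * y t) * \<phi> t)"
      by (simp only: \<phi>'_def)
  qed
  moreover have "L2_fun ?M (\<lambda>t. G t - c * y t)" by (intro L2_fun_diff L2_fun_scale G y_L2)
  ultimately have "time_H1 tb y (\<lambda>t. G t - c * y t)" using y_L2 by (simp add: time_H1_def)
  then show ?thesis using y_cont y_0 by blast
qed

section \<open>The load\<close>

lemma cell_inner_bound:
  fixes \<Omega> :: "'a::euclidean_space set"
  assumes \<Omega>: "polyhedral_domain \<Omega>" and mesh: "is_mesh \<Omega> Th Eh"
    and q: "\<And>T. T \<in> Th \<Longrightarrow> L2_fun (lebesgue_on T) (q T)" and g: "L2_fun (lebesgue_on \<Omega>) g"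
  shows "\<bar>cell_inner Th (\<lambda>T. g) q\<bar> \<le> (\<Sum>T\<in>Th. L2_norm (lebesgue_on T) (q T)) * L2_norm (lebesgue_on \<Omega>) g"
proof -
  have "\<bar>cell_inner Th (\<lambda>T. g) q\<bar> \<le> (\<Sum>T\<in>Th. \<bar>LINT x|lebesgue_on T. g x * q T x\<bar>)"
    unfolding cell_inner_def by (rule sum_abs)
  also have "\<dots> \<le> (\<Sum>T\<in>Th. L2_norm (lebesgue_on T) (q T) * L2_norm (lebesgue_on \<Omega>) g)"
  proof (rule sum_mono)
    fix T assume T: "T \<in> Th"
    note gT = domain_L2_on_cell[OF \<Omega> mesh T g]
    have "\<bar>LINT x|lebesgue_on T. g x * q T x\<bar> \<le> L2_norm (lebesgue_on T) g * L2_norm (lebesgue_on T) (q T)"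
      by (rule L2_Cauchy_Schwarz[OF gT(1) q[OF T]])
    also have "\<dots> \<le> L2_norm (lebesgue_on \<Omega>) g * L2_norm (lebesgue_on T) (q T)"
      by (intro mult_right_mono gT(2) L2_norm_nonneg)
    finally show "\<bar>LINT x|lebesgue_on T. g x * q T x\<bar> \<le> L2_norm (lebesgue_on T) (q T) * L2_norm (lebesgue_on \<Omega>) g"
      by (simp add: mult.commute)
  qed
  finally show ?thesis by (simp add: sum_distrib_right)
qed

lemma simple_load:
  fixes \<Omega> :: "'a::euclidean_space set"
  assumes \<Omega>: "polyhedral_domain \<Omega>" and mesh: "is_mesh \<Omega> Th Eh"
    and q: "\<And>T. T \<in> Th \<Longrightarrow> L2_fun (lebesgue_on T) (q T)" and s: "simple_L2_valued tb \<Omega> s"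
  shows "L2_fun (lebesgue_on \<Omega>) (s t)"
    "(\<lambda>t. cell_inner Th (\<lambda>T. s t) q) \<in> borel_measurable (lebesgue_on {0<..<tb})"
proof -
  obtain m :: nat and A g where A: "\<And>i. i < m \<Longrightarrow> A i \<in> sets lebesgue"
    and g: "\<And>i. i < m \<Longrightarrow> L2_fun (lebesgue_on \<Omega>) (g i)"
    and s_eq: "s = (\<lambda>t x. \<Sum>i<m. indicator (A i) t * g i x)"
    using s unfolding simple_L2_valued_def by blast
  show "L2_fun (lebesgue_on \<Omega>) (s t)"
    unfolding s_eq using g by (intro L2_fun_sum L2_fun_scale) simp
  have "(LINT x|lebesgue_on T. s t x * q T x) = (\<Sum>i<m. indicator (A i) t * (LINT x|lebesgue_on T. g i x * q T x))"
    if T: "T \<in> Th" for t T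
  proof -
    have "integrable (lebesgue_on T) (\<lambda>x. g i x * q T x)" if "i < m" for i
      by (rule L2_fun_mult_integrable[OF domain_L2_on_cell(1)[OF \<Omega> mesh T g[OF that]] q[OF T]])
    then have "(LINT x|lebesgue_on T. (\<Sum>i<m. indicator (A i) t * (g i x * q T x))) =
        (\<Sum>i<m. indicator (A i) t * (LINT x|lebesgue_on T. g i x * q T x))"
      by (subst Bochner_Integration.integral_sum) auto
    then show ?thesis by (simp add: s_eq sum_distrib_right mult.assoc)
  qed
  then have "(\<lambda>t. cell_inner Th (\<lambda>T. s t) q) =
      (\<lambda>t. \<Sum>T\<in>Th. \<Sum>i<m. indicator (A i) t * (LINT x|lebesgue_on T. g i x * q T x))"
    by (simp add: cell_inner_def)
  moreover have "(\<lambda>t. indicator (A i) t :: real) \<in> borel_measurable (lebesgue_on {0<..<tb})" if "i < m" for i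
    using A[OF that] by (intro measurable_restrict_space1 borel_measurable_indicator)
  ultimately show "(\<lambda>t. cell_inner Th (\<lambda>T. s t) q) \<in> borel_measurable (lebesgue_on {0<..<tb})"
    by (simp only:) (intro borel_measurable_sum borel_measurable_times borel_measurable_const; simp)
qed

text \<open>The pairing with a fixed element of \<open>L\<^sup>2\<close> is continuous, so it is measurable in time as a limit
  of the pairings with simple functions and is bounded by a multiple of the norm of \<open>f\<close>.\<close>

lemma load_L2_in_time:
  fixes \<Omega> :: "'a::euclidean_space set"
  assumes \<Omega>: "polyhedral_domain \<Omega>" and mesh: "is_mesh \<Omega> Th Eh" and f: "f \<in> L2_L2 tb \<Omega>"
    and q: "\<And>T. T \<in> Th \<Longrightarrow> L2_fun (lebesgue_on T) (q T)"
  shows "\<exists>G. L2_fun (lebesgue_on {0<..<tb}) G \<and>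
    (AE t in lebesgue_on {0<..<tb}. G t = cell_inner Th (\<lambda>T. f t) q)"
proof -
  let ?M = "lebesgue_on {0<..<tb}"
  obtain s where s_all: "\<forall>n. simple_L2_valued tb \<Omega> (s n)"
    and lim: "AE t in ?M. L2_fun (lebesgue_on \<Omega>) (f t) \<and>
         (\<lambda>n. L2_norm (lebesgue_on \<Omega>) (\<lambda>x. s n t x - f t x)) \<longlonglongrightarrow> 0"
    and norm_int: "integrable ?M (\<lambda>t. (L2_norm (lebesgue_on \<Omega>) (f t))\<^sup>2)"
    using f unfolding L2_L2_def mem_Collect_eq by (elim conjE exE) (rule that; assumption)
  have s: "simple_L2_valued tb \<Omega> (s n)" for n using s_all by (rule spec)
  note s_L2 = simple_load(1)[OF \<Omega> mesh q s]
  define C where "C = (\<Sum>T\<in>Th. L2_norm (lebesgue_on T) (q T))"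
  have C: "0 \<le> C" unfolding C_def by (intro sum_nonneg L2_norm_nonneg)
  note bound = cell_inner_bound[where q = q, OF \<Omega> mesh, folded C_def]
  have "AE t in ?M. (\<lambda>n. cell_inner Th (\<lambda>T. s n t) q) \<longlonglongrightarrow> cell_inner Th (\<lambda>T. f t) q"
    using lim
  proof eventually_elim
    case (elim t)
    have diff: "cell_inner Th (\<lambda>T. s n t) q - cell_inner Th (\<lambda>T. f t) q = cell_inner Th (\<lambda>T x. s n t x - f t x) q" for n
    proof -
      have "cell_inner Th q (\<lambda>T x. s n t x - f t x) = 1 * cell_inner Th q (\<lambda>T. s n t) + (-1) * cell_inner Th q (\<lambda>T. f t)"
      proof (rule cell_inner_linear)
        fix T assume T: "T \<in> Th"
        show "L2_fun (lebesgue_on T) (q T)" by (rule q[OF T])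
        show "L2_fun (lebesgue_on T) (s n t)" by (rule domain_L2_on_cell(1)[OF \<Omega> mesh T s_L2])
        show "L2_fun (lebesgue_on T) (f t)" by (rule domain_L2_on_cell(1)[OF \<Omega> mesh T conjunct1[OF elim]])
      qed simp
      then show ?thesis by (simp add: cell_inner_commute[of Th q])
    qed
    have le: "norm (cell_inner Th (\<lambda>T. s n t) q - cell_inner Th (\<lambda>T. f t) q)
        \<le> C * L2_norm (lebesgue_on \<Omega>) (\<lambda>x. s n t x - f t x)" for n
      unfolding diff real_norm_def by (rule bound[OF q L2_fun_diff[OF s_L2 conjunct1[OF elim]]])
    have lim0: "(\<lambda>n. C * L2_norm (lebesgue_on \<Omega>) (\<lambda>x. s n t x - f t x)) \<longlonglongrightarrow> 0"
      using tendsto_mult_left[OF conjunct2[OF elim], of C] by simp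
    have "(\<lambda>n. cell_inner Th (\<lambda>T. s n t) q - cell_inner Th (\<lambda>T. f t) q) \<longlonglongrightarrow> 0"
      by (rule Lim_null_comparison[OF always_eventually[OF allI[OF le]] lim0])
    then show ?case by (rule LIM_zero_cancel)
  qed
  then have eq: "AE t in ?M. lim (\<lambda>n. cell_inner Th (\<lambda>T. s n t) q) = cell_inner Th (\<lambda>T. f t) q"
    by eventually_elim (rule limI)
  have meas: "(\<lambda>t. lim (\<lambda>n. cell_inner Th (\<lambda>T. s n t) q)) \<in> borel_measurable ?M"
    by (intro borel_measurable_lim_metric simple_load(2)[OF \<Omega> mesh q s])
  have "L2_fun ?M (\<lambda>t. lim (\<lambda>n. cell_inner Th (\<lambda>T. s n t) q))"
  proof (rule L2_fun_bound[OF _ meas])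
    have "(\<lambda>t. sqrt ((L2_norm (lebesgue_on \<Omega>) (f t))\<^sup>2)) \<in> borel_measurable ?M"
      by (rule measurable_compose[OF borel_measurable_integrable[OF norm_int]]) simp
    then have "L2_fun ?M (\<lambda>t. L2_norm (lebesgue_on \<Omega>) (f t))"
      using norm_int by (simp add: L2_fun_def L2_norm_nonneg)
    then show "L2_fun ?M (\<lambda>t. C * L2_norm (lebesgue_on \<Omega>) (f t))" by (rule L2_fun_scale)
    show "AE t in ?M. \<bar>lim (\<lambda>n. cell_inner Th (\<lambda>T. s n t) q)\<bar> \<le> \<bar>C * L2_norm (lebesgue_on \<Omega>) (f t)\<bar>"
      using eq lim
    proof eventually_elim
      case (elim t)
      have "\<bar>cell_inner Th (\<lambda>T. f t) q\<bar> \<le> C * L2_norm (lebesgue_on \<Omega>) (f t)"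
        using elim(2) by (intro bound q) blast+
      then show ?case unfolding elim(1) by linarith
    qed
  qed
  then show ?thesis using eq by blast
qed

section \<open>The semidiscrete scheme\<close>

text \<open>The equations of the scheme have to be tested on the frame only, and on null vectors.\<close>

lemma linear_form_zero_by_frame:
  assumes U: "subspace U" and l: "linear_form_on U l" and frame: "orthonormal_frame U c n e"
    and e: "\<And>i. i < n \<Longrightarrow> l (e i) = 0" and null: "\<And>r. r \<in> U \<Longrightarrow> c r r = 0 \<Longrightarrow> l r = 0" and v: "v \<in> U"
  shows "l v = 0"
proof -
  define z where "z = (\<Sum>i<n. c v (e i) *\<^sub>R e i)"
  have eU: "e i \<in> U" if "i \<in> {..<n}" for i using orthonormal_frameD(1)[OF frame] that by simp
  have z: "z \<in> U" unfolding z_def using eU U by (intro subspace_sum subspace_mul) auto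
  have "l z = (\<Sum>i<n. c v (e i) * l (e i))"
    unfolding z_def by (rule linear_form_on_sum[OF l U eU])
  then have "l z = 0" using e by simp
  moreover have "l (v - z) = 0"
    using orthonormal_frameD(3)[OF frame v] U v z by (intro null) (simp_all add: subspace_diff z_def)
  ultimately show ?thesis using linear_form_on_simps(2)[OF l v z] by simp
qed

lemma evaluation_of_combination:
  assumes "l \<in> evaluations"
  shows "l (of_parts (\<Sum>i\<in>I. c i *\<^sub>R e i)) = (\<Sum>i\<in>I. c i * l (of_parts (e i)))"
  using assms unfolding evaluations_def by (auto simp: fst_sum snd_sum sum_fun_apply)

lemma time_H1_cong:
  assumes "time_H1 tb y w" "\<And>t. t \<in> {0<..<tb} \<Longrightarrow> z t = y t"
  shows "time_H1 tb z w"
proof -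
  let ?M = "lebesgue_on {0<..<tb}"
  have eq: "z t = y t" if "t \<in> space ?M" for t using that assms(2) by (simp add: space_restrict_space)
  have "L2_fun ?M z"
  proof -
    have "z \<in> borel_measurable ?M \<longleftrightarrow> y \<in> borel_measurable ?M" by (rule measurable_cong) (rule eq)
    moreover have "integrable ?M (\<lambda>t. (z t)\<^sup>2) \<longleftrightarrow> integrable ?M (\<lambda>t. (y t)\<^sup>2)"
      by (rule Bochner_Integration.integrable_cong) (simp_all add: eq)
    ultimately show ?thesis using assms(1) by (simp add: time_H1_def L2_fun_def)
  qed
  moreover have "(LINT t|?M. z t * g t) = (LINT t|?M. y t * g t)" for g
    by (rule Bochner_Integration.integral_cong) (simp_all add: eq)
  ultimately show ?thesis using assms(1) by (simp add: time_H1_def weak_deriv_def)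
qed

lemma AE_half_open_time:
  assumes "AE t in lebesgue_on {0<..<tb::real}. Q t"
  shows "AE t in lebesgue_on {0<..tb}. Q t"
proof -
  have 1: "AE t in lebesgue. t \<in> {0<..<tb} \<longrightarrow> Q t"
    using assms by (subst (asm) AE_restrict_space_iff) auto
  have "{tb} \<in> null_sets lebesgue" by (simp add: negligible_iff_null_sets[symmetric])
  then have "AE t in lebesgue. t \<notin> {tb}" by (rule AE_not_in)
  with 1 have "AE t in lebesgue. t \<in> {0<..tb} \<longrightarrow> Q t"
    by eventually_elim auto
  then show ?thesis by (subst AE_restrict_space_iff) auto
qed

lemma psd_form_on_add:
  assumes "psd_form_on U c" "psd_form_on U d"
  shows "psd_form_on U (\<lambda>x y. c x y + d x y)"
  using assms unfolding psd_form_on_def linear_form_on_def by (auto simp: algebra_simps)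

theorem theorem3p4:
  fixes \<Omega> :: "'a::euclidean_space set"
    and Th Eh :: "'a set set"
    and ne :: "'a set \<Rightarrow> 'a"
    and f :: "real \<Rightarrow> 'a \<Rightarrow> real"
    and \<psi> :: "'a \<Rightarrow> real"
    and tb hbar \<rho>v \<rho>e \<kappa> \<sigma> \<gamma> \<rho>s C1 C2 :: real
    and N k r :: nat
  assumes dim: "DIM('a) = 2 \<or> DIM('a) = 3"
    and domain: "polyhedral_domain \<Omega>"
    and time: "0 < tb"
    and f: "f \<in> L2_L2 tb \<Omega>"
    and psi: "\<psi> \<in> H0m \<Omega> 2"
    and mesh: "is_mesh \<Omega> Th Eh"
    and size: "0 < hbar" "mesh_size Th \<in> {0<..hbar}"
    and constants: "0 < \<rho>v" "0 < \<rho>e" "0 < \<kappa>" "0 < \<sigma>" "0 < \<gamma>" "0 < \<rho>s"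
    and regular: "shape_regular \<rho>v \<rho>e \<kappa> \<sigma> \<gamma> \<rho>s N Th Eh"
    and normals: "\<forall>e\<in>Eh. is_unit_normal (ne e) e"
    and k: "k \<ge> 2"
    and norm_equiv_constants: "0 < C1" "0 < C2"
    and norm_equiv: "\<forall>v\<in>Vh Th Eh k.
           C1 * norm_2h Th Eh ne v \<le> triple_norm Th Eh ne r v \<and>
           triple_norm Th Eh ne r v \<le> C2 * norm_2h Th Eh ne v"
  shows "\<exists>u u'. (\<forall>t\<in>{0..tb}. u t \<in> Vh0 \<Omega> Th Eh k) \<and>
           H1_time tb (Vh0 \<Omega> Th Eh k) u u' \<and>
           initial_value tb u (Qh \<Omega> Th Eh ne k \<psi>) \<and>
           (AE t in lebesgue_on {0<..tb}. \<forall>v\<in>Vh0 \<Omega> Th Eh k.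
              cell_inner Th (cell_part (u' t)) (cell_part v)
              + cell_inner Th (weak_laplacian Eh ne r (u t)) (weak_laplacian Eh ne r v)
              = cell_inner Th (\<lambda>T. f t) (cell_part v))"
proof -
  let ?M = "lebesgue_on {0<..<tb}"
  define X where "X = parts_space \<Omega> Th Eh k"
  define m where "m = mass_form Th"
  define a where "a = stiffness_form Th Eh ne r"
  define c where "c u v = m u v + a u v" for u v
  note X = subspace_parts_space[of \<Omega> Th Eh k, folded X_def]
  have m: "psd_form_on X m" unfolding X_def m_def by (rule mass_form_psd[OF mesh])
  have a: "psd_form_on X a" unfolding X_def a_def by (rule stiffness_form_psd[OF mesh normals])
  have c: "psd_form_on X c" unfolding c_def[abs_def] by (rule psd_form_on_add[OF m a])
  have m_null: "fst v = 0" if "v \<in> X" "m v v = 0" for v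
    using mass_form_null[OF mesh] that unfolding X_def m_def by blast
  have c_null: "m v v = 0" "a v v = 0" if "v \<in> X" "c v v = 0" for v
    using that psd_form_onD(3)[OF m that(1)] psd_form_onD(3)[OF a that(1)] by (auto simp: c_def)

  obtain S where S: "finite S" "X = span S"
    using parts_space_finite_dimensional[OF mesh_finite(1,2)[OF mesh]] unfolding X_def by blast
  have "\<exists>n e. orthonormal_frame (span S) c n e \<and> (\<forall>i<n. \<forall>j<n. i \<noteq> j \<longrightarrow> m (e i) (e j) = 0)"
    using c m unfolding S(2)
    by (rule simultaneous_diagonalization[OF S(1)]) (use psd_form_onD(3)[OF a] in \<open>simp add: c_def S(2)\<close>)
  then obtain n e where frame: "orthonormal_frame X c n e"
    and m_diag: "\<forall>i<n. \<forall>j<n. i \<noteq> j \<longrightarrow> m (e i) (e j) = 0" unfolding S(2) by blast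
  note eX = orthonormal_frameD(1)[OF frame]
  define \<mu> where "\<mu> i = m (e i) (e i)" for i
  \<comment> \<open>Only the eigenvectors with nonzero eigenvalue evolve; the coefficients of the others are zero.\<close>
  define P where "P = {i. i < n \<and> \<mu> i \<noteq> 0}"
  have P: "finite P" "\<And>i. i \<in> P \<Longrightarrow> i < n" "\<And>i. i \<in> P \<Longrightarrow> \<mu> i \<noteq> 0" by (auto simp: P_def)
  have m_e: "m (e i) (e j) = (if i = j then \<mu> i else 0)" if "i < n" "j < n" for i j
    using m_diag that by (simp add: \<mu>_def)
  have a_e: "a (e i) (e j) = (if i = j then 1 - \<mu> i else 0)" if "i < n" "j < n" for i j
    using orthonormal_frameD(2)[OF frame that] m_e[OF that] by (auto simp: c_def split: if_splits)

  have comb_X: "(\<Sum>i\<in>P. x i *\<^sub>R e i) \<in> X" for x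
    using eX P(2) X by (intro subspace_sum subspace_mul) auto
  have form_comb: "q (\<Sum>i\<in>P. x i *\<^sub>R e i) v = (\<Sum>i\<in>P. x i * q (e i) v)" if "psd_form_on X q" "v \<in> X" for q x v
    by (rule linear_form_on_sum[OF psd_form_on_linear_left[OF that(1) X that(2)] X]) (use eX P(2) in blast)
  have m_comb: "m (\<Sum>i\<in>P. x i *\<^sub>R e i) (e j) = (if j \<in> P then x j * \<mu> j else 0)" if j: "j < n" for x j
  proof -
    have "(\<Sum>i\<in>P. x i * m (e i) (e j)) = (\<Sum>i\<in>P. if i = j then x i * \<mu> i else 0)"
      using P(2) j by (intro sum.cong) (auto simp: m_e)
    then show ?thesis using P(1) by (simp add: form_comb[OF m eX[OF j]] sum.delta)
  qed
  have a_comb: "a (\<Sum>i\<in>P. x i *\<^sub>R e i) (e j) = (if j \<in> P then x j * (1 - \<mu> j) else 0)" if j: "j < n" for x j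
  proof -
    have "(\<Sum>i\<in>P. x i * a (e i) (e j)) = (\<Sum>i\<in>P. if i = j then x i * (1 - \<mu> i) else 0)"
      using P(2) j by (intro sum.cong) (auto simp: a_e)
    then show ?thesis using P(1) by (simp add: form_comb[OF a eX[OF j]] sum.delta)
  qed
  have e_null: "fst (e j) = 0" if "j < n" "j \<notin> P" for j
    using m_null[OF eX[OF that(1)]] that by (simp add: P_def \<mu>_def)

  have "\<exists>\<psi>p. Qh \<Omega> Th Eh ne k \<psi> = of_parts \<psi>p" by (rule of_parts_surj)
  then obtain \<psi>p where \<psi>p: "Qh \<Omega> Th Eh ne k \<psi> = of_parts \<psi>p" by blast
  have Qh: "Qh \<Omega> Th Eh ne k \<psi> \<in> Vh0 \<Omega> Th Eh k" by (rule Qh_in_Vh0[OF domain mesh normals psi])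
  then have \<psi>X: "\<psi>p \<in> X" by (simp add: X_def parts_space_def \<psi>p)
  \<comment> \<open>The difference from the given datum is orthogonal to the whole frame in the mass form.\<close>
  have initial: "fst (\<Sum>i\<in>P. (m \<psi>p (e i) / \<mu> i) *\<^sub>R e i) = fst \<psi>p"
  proof -
    define z where "z = (\<Sum>i\<in>P. (m \<psi>p (e i) / \<mu> i) *\<^sub>R e i)"
    have z: "z \<in> X" unfolding z_def by (rule comb_X)
    have d: "\<psi>p - z \<in> X" using X \<psi>X z by (rule subspace_diff)
    have "m (\<psi>p - z) (\<psi>p - z) = 0"
    proof (rule linear_form_zero_by_frame[OF X psd_form_onD(1)[OF m d] frame _ _ d])
      fix j assume j: "j < n"
      have "m (\<psi>p - z) (e j) = m \<psi>p (e j) - m z (e j)"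
        by (rule linear_form_on_simps(2)[OF psd_form_on_linear_left[OF m X eX[OF j]] \<psi>X z])
      moreover have "m \<psi>p (e j) = 0" if "j \<notin> P"
      proof -
        have "m (e j) (e j) = 0" using that j by (simp add: P_def \<mu>_def)
        from psd_form_on_null[OF m X eX[OF j] this \<psi>X] show ?thesis
          using psd_form_onD(2)[OF m \<psi>X eX[OF j]] by simp
      qed
      ultimately show "m (\<psi>p - z) (e j) = 0"
        using P(3)[of j] by (simp add: z_def m_comb[OF j])
    next
      fix r assume r: "r \<in> X" "c r r = 0"
      show "m (\<psi>p - z) r = 0"
        using psd_form_on_null[OF m X r(1) c_null(1)[OF r] d] psd_form_onD(2)[OF m d r(1)] by simp
    qed
    then have "fst (\<psi>p - z) = 0" by (rule m_null[OF d])
    then show ?thesis by (simp add: z_def)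
  qed

  have fst_L2: "L2_fun (lebesgue_on T) (fst v T)" if "v \<in> X" "T \<in> Th" for v T
    using cell_parts_L2[OF mesh] that unfolding X_def by blast
  have "\<forall>i\<in>P. \<exists>G. L2_fun ?M G \<and> (AE t in ?M. G t = cell_inner Th (\<lambda>T. f t) (fst (e i)))"
  proof
    fix i assume "i \<in> P"
    show "\<exists>G. L2_fun ?M G \<and> (AE t in ?M. G t = cell_inner Th (\<lambda>T. f t) (fst (e i)))"
      by (rule load_L2_in_time[OF domain mesh f fst_L2[OF eX[OF P(2)[OF \<open>i \<in> P\<close>]]]])
  qed
  from bchoice[OF this] obtain G where G_all: "\<forall>i\<in>P. L2_fun ?M (G i) \<and>
      (AE t in ?M. G i t = cell_inner Th (\<lambda>T. f t) (fst (e i)))" by blast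
  have G: "L2_fun ?M (G i)" "AE t in ?M. G i t = cell_inner Th (\<lambda>T. f t) (fst (e i))" if "i \<in> P" for i
    using bspec[OF G_all that] by (rule conjunct1, rule conjunct2)
  define decay where "decay i = (1 - \<mu> i) / \<mu> i" for i
  have "\<forall>i\<in>P. \<exists>y. continuous_on UNIV y \<and> y 0 = m \<psi>p (e i) / \<mu> i \<and>
      time_H1 tb y (\<lambda>t. (1 / \<mu> i) * G i t - decay i * y t)"
  proof
    fix i assume "i \<in> P"
    show "\<exists>y. continuous_on UNIV y \<and> y 0 = m \<psi>p (e i) / \<mu> i \<and>
        time_H1 tb y (\<lambda>t. (1 / \<mu> i) * G i t - decay i * y t)"
      by (rule scalar_evolution[OF time L2_fun_scale[OF G(1)[OF \<open>i \<in> P\<close>]]])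
  qed
  from bchoice[OF this] obtain y where y: "\<forall>i\<in>P. continuous_on UNIV (y i) \<and> y i 0 = m \<psi>p (e i) / \<mu> i \<and>
      time_H1 tb (y i) (\<lambda>t. (1 / \<mu> i) * G i t - decay i * y i t)"
    by (elim exE) (rule that)
  define w where "w i t = (1 / \<mu> i) * G i t - decay i * y i t" for i t
  define U where "U t = (\<Sum>i\<in>P. y i t *\<^sub>R e i)" for t
  define W where "W t = (\<Sum>i\<in>P. w i t *\<^sub>R e i)" for t
  have U: "U t \<in> X" and W: "W t \<in> X" for t unfolding U_def W_def by (rule comb_X)+
  have in_Vh0: "of_parts v \<in> Vh0 \<Omega> Th Eh k" if "v \<in> X" for v
    using that by (simp add: X_def parts_space_def)
  \<comment> \<open>Only the cell part of the initial datum is attained continuously; its other parts need not satisfy the algebraic constraint.\<close>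
  define u where "u t = (if t = 0 then Qh \<Omega> Th Eh ne k \<psi> else of_parts (U t))" for t

  have member: "u t \<in> Vh0 \<Omega> Th Eh k" for t
    using Qh in_Vh0[OF U] by (simp add: u_def)

  have "H1_time tb (Vh0 \<Omega> Th Eh k) u (\<lambda>t. of_parts (W t))"
    unfolding H1_time_def
  proof (intro conjI ballI)
    show "u t \<in> Vh0 \<Omega> Th Eh k" "of_parts (W t) \<in> Vh0 \<Omega> Th Eh k" for t
      by (rule member, rule in_Vh0[OF W])
    fix l :: "'a weak_function \<Rightarrow> real" assume l: "l \<in> evaluations"
    have "time_H1 tb (\<lambda>t. \<Sum>i\<in>P. l (of_parts (e i)) * y i t) (\<lambda>t. \<Sum>i\<in>P. l (of_parts (e i)) * w i t)"
      by (rule time_H1_sum) (use y in \<open>simp add: w_def[abs_def]\<close>)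
    also have "(\<lambda>t. \<Sum>i\<in>P. l (of_parts (e i)) * w i t) = (\<lambda>t. l (of_parts (W t)))"
      unfolding W_def evaluation_of_combination[OF l] by (simp only: mult.commute)
    finally have "time_H1 tb (\<lambda>t. l (u t)) (\<lambda>t. l (of_parts (W t)))"
    proof (rule time_H1_cong)
      show "l (u t) = (\<Sum>i\<in>P. l (of_parts (e i)) * y i t)" if "t \<in> {0<..<tb}" for t
        using that unfolding u_def U_def by (simp add: evaluation_of_combination[OF l] mult.commute)
    qed
    then show "L2_fun ?M (\<lambda>t. l (u t))" "L2_fun ?M (\<lambda>t. l (of_parts (W t)))"
      "weak_deriv {0<..<tb} [1] (\<lambda>t. l (u t)) (\<lambda>t. l (of_parts (W t)))"
      by (auto simp: time_H1_def)
  qed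

  moreover have "initial_value tb u (Qh \<Omega> Th Eh ne k \<psi>)"
    unfolding initial_value_def
  proof (intro conjI allI ballI)
    show "u 0 = Qh \<Omega> Th Eh ne k \<psi>" by (simp add: u_def)
    have y_cont: "continuous_on A (y i)" if "i \<in> P" for i A
      using y that continuous_on_subset by blast
    fix T x
    have U0: "fst (U 0) = fst \<psi>p"
      unfolding initial[symmetric] U_def using y by (intro arg_cong[of _ _ fst] sum.cong) auto
    have "cell_part (u t) T x = fst (U t) T x" for t
      using U0 by (simp add: u_def \<psi>p)
    moreover have "fst (U t) T x = (\<Sum>i\<in>P. y i t * fst (e i) T x)" for t
      by (simp add: U_def fst_sum sum_fun_apply)
    ultimately show "continuous_on {0..tb} (\<lambda>t. cell_part (u t) T x)"
      by (simp only:) (intro continuous_intros y_cont)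
  next
    have y_cont: "continuous_on A (y i)" if "i \<in> P" for i A
      using y that continuous_on_subset by blast
    fix l :: "'a weak_function \<Rightarrow> real" assume l: "l \<in> evaluations"
    have "continuous_on {0<..tb} (\<lambda>t. \<Sum>i\<in>P. y i t * l (of_parts (e i)))"
      by (intro continuous_intros y_cont)
    then show "continuous_on {0<..tb} (\<lambda>t. l (u t))"
      by (rule continuous_on_eq) (simp add: u_def U_def evaluation_of_combination[OF l])
  qed

  moreover have "AE t in lebesgue_on {0<..tb}. \<forall>v\<in>Vh0 \<Omega> Th Eh k.
      cell_inner Th (cell_part (of_parts (W t))) (cell_part v)
      + cell_inner Th (weak_laplacian Eh ne r (u t)) (weak_laplacian Eh ne r v)
      = cell_inner Th (\<lambda>T. f t) (cell_part v)"
  proof -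
    have f_L2: "AE t in ?M. L2_fun (lebesgue_on \<Omega>) (f t)"
      using f unfolding L2_L2_def mem_Collect_eq by (elim conjE exE) (erule eventually_mono, erule conjunct1)
    have "AE t in ?M. \<forall>i\<in>P. G i t = cell_inner Th (\<lambda>T. f t) (fst (e i))"
      using G(2) P(1) by (simp add: AE_finite_all)
    with f_L2 have "AE t in ?M. L2_fun (lebesgue_on \<Omega>) (f t) \<and> (\<forall>i\<in>P. G i t = cell_inner Th (\<lambda>T. f t) (fst (e i)))"
      by eventually_elim blast
    from AE_half_open_time[OF this] AE_space show ?thesis
    proof eventually_elim
      case (elim t)
      have t: "0 < t" using elim(2) by (simp add: space_restrict_space)
      define F where "F v = cell_inner Th (\<lambda>T. f t) (fst v)" for v :: "'a parts"
      have F: "linear_form_on X F"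
        unfolding F_def[abs_def] X_def
        by (rule load_linear_form[OF mesh domain_L2_on_cell(1)[OF domain mesh _ conjunct1[OF elim(1)]]])
      have F_zero: "F v = 0" if "fst v = 0" for v by (simp add: F_def that cell_inner_def)
      have "m (W t) v + a (U t) v - F v = 0" if v: "v \<in> X" for v
      proof (rule linear_form_zero_by_frame[OF X _ frame _ _ v])
        show "linear_form_on X (\<lambda>v. m (W t) v + a (U t) v - F v)"
          using psd_form_onD(1)[OF m W] psd_form_onD(1)[OF a U] F
          unfolding linear_form_on_def by (simp add: algebra_simps)
        show "m (W t) (e j) + a (U t) (e j) - F (e j) = 0" if j: "j < n" for j
        proof (cases "j \<in> P")
          case True
          have "F (e j) = G j t" using elim(1) True by (simp add: F_def)
          moreover have "m (W t) (e j) = w j t * \<mu> j" "a (U t) (e j) = y j t * (1 - \<mu> j)"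
            using True unfolding W_def U_def m_comb[OF j] a_comb[OF j] by simp_all
          moreover have "w j t * \<mu> j = G j t - (1 - \<mu> j) * y j t"
            using P(3)[OF True] unfolding w_def decay_def by (simp add: field_simps)
          ultimately show ?thesis by (simp add: mult.commute)
        next
          case False
          then show ?thesis by (simp add: W_def U_def m_comb[OF j] a_comb[OF j] F_zero[OF e_null[OF j False]])
        qed
        show "m (W t) s + a (U t) s - F s = 0" if s: "s \<in> X" "c s s = 0" for s
          using psd_form_on_null[OF m X s(1) c_null(1)[OF s] W] psd_form_onD(2)[OF m W s(1)]
            psd_form_on_null[OF a X s(1) c_null(2)[OF s] U] psd_form_onD(2)[OF a U s(1)]
            F_zero[OF m_null[OF s(1) c_null(1)[OF s]]] by simp
      qed
      then have eq: "m (W t) v + a (U t) v = F v" if "v \<in> X" for v using that by simp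
      show ?case
      proof
        fix v assume "v \<in> Vh0 \<Omega> Th Eh k"
        moreover obtain p where p: "v = of_parts p" using of_parts_surj by blast
        ultimately have "p \<in> X" by (simp add: X_def parts_space_def)
        from eq[OF this] show "cell_inner Th (cell_part (of_parts (W t))) (cell_part v)
          + cell_inner Th (weak_laplacian Eh ne r (u t)) (weak_laplacian Eh ne r v)
          = cell_inner Th (\<lambda>T. f t) (cell_part v)"
          using t by (simp add: p m_def mass_form_def a_def stiffness_form_def F_def u_def)
      qed
    qed
  qed
  ultimately show ?thesis using member by blast
qed

end
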